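(* Let $G$ be a finitely generated group, and let $\Delta^G\doteq_{\mathbb{C}}\prod_{j=1}^s f_j^{\mu_j}$ be the decomposition into irreducible factors (over $\mathbb{C}$) of its Alexander polynomial. Then: (i) $b_1^{\mathrm{gen}}(G,f_j)\le\mu_j$, for each $j=1,\dots,s$. (ii) If the Alexander ideal of $G$ is almost principal, then, for all $\rho\in\mathbb{T}_G^0\setminus\{1\}$, $$b_1(G,\rho)\le\sum_{j=1}^s\mu_j\cdot\nu_\rho(f_j).$$
   Context: Let $G$ be a finitely generated group, $n=b_1(G)$, and $G_{\mathrm{abf}}=G_{\mathrm{ab}}/\mathrm{Torsion}\cong\mathbb{Z}^n$. Identify $\mathbb{Z}[G_{\mathrm{abf}}]$ with $\Lambda_n=\mathbb{Z}[t_1^{\pm1},\dots,t_n^{\pm1}]$. Let $\mathbb{T}_G=\mathrm{Hom}(G,\mathbb{C}^* )$, with identity component $\mathbb{T}_G^0=\mathrm{Hom}(G_{\mathrm{abf}},\mathbb{C}^* )\cong(\mathbb{C}^* )^n$, whose coordinate ring is $\mathbb{C}[G_{\mathrm{abf}}]=\Lambda_n\otimes\mathbb{C}$. For $\rho\in\mathbb{T}_G$, let $\mathbb{C}_\rho$ be the corresponding rank one local system, $b_1(G,\rho)=\dim_{\mathbb{C}}H_1(G;\mathbb{C}_\rho)$, and $\mathcal{V}_k(G)=\{\rho\in\mathbb{T}_G\mid b_1(G,\rho)\ge k\}$. The Alexander module is $A_G=\mathbb{Z}[G_{\mathrm{abf}}]\otimes_{\mathbb{Z}[G]}I_G$, where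 $I_G$ is the augmentation ideal of $\mathbb{Z}[G]$. If $\Lambda_n^h\to\Lambda_n^m\to A_G\to0$ is a presentation, the Alexander ideal $\mathcal{E}_1(A_G)$ is the ideal generated by the minors of size $m-1$ of the presentation matrix (equal to $\Lambda_n$ if $m\le1$, and to $0$ if $m-1>h$). The Alexander polynomial $\Delta^G\in\Lambda_n$ is the greatest common divisor of all elements of $\mathcal{E}_1(A_G)$, well defined up to units; $\doteq_{\mathbb{C}}$ denotes equality up to units of $\Lambda_n\otimes\mathbb{C}$. In the decomposition into irreducible factors (which presupposes $\Delta^G\neq 0$), the $f_j\in\Lambda_n\otimes\mathbb{C}$ are pairwise non-associate irreducible elements and $\mu_j\ge1$. For an irreducible $f\in\mathbb{C}[G_{\mathrm{abf}}]$ with zero set $V(f)\subset\mathbb{T}_G^0$, the generic Betti number is $b_1^{\mathrm{gen}}(G,f)=\max\{k\mid V(f)\subset\mathcal{V}_k(G)\}$. For $\rho\in\mathbb{T}^0_G=(\mathbb{C}^* )^n$, $\nu_\rho(f)$ denotes the order of vanishing of the germ of $f$ at $\rho$, i.e. the degree of the first non-vanishing homogeneous term in the Taylor expansion of $f$ at $\rho$. The Alexander ideal $\mathcal{E}_1(A_G)$ is almost principal if there is an integer $d\ge0$ such that $I^d\cdot(\Delta^G)\subset\mathcal{E}_1(A_G)$ over $\mathbb{C}$ (i.e. after extension of these ideals to $\Lambda_n\otimes\mathbb{C}$), where $I$ is the augmentation ideal of $\mathbb{Z}[G_{\mathrm{abf}}]$. *)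

theory Defs
  imports
    "HOL-Analysis.Derivative"
    "HOL-Library.Poly_Mapping"
    "HOL-Computational_Algebra.Factorial_Ring"
    "Jordan_Normal_Form.Determinant"
    "Jordan_Normal_Form.DL_Submatrix"
begin

text \<open>
  Groups are types of class \<^class>\<open>group_add\<close>: written additively, but not necessarily
  commutative. With this notation the group ring \<open>R[G]\<close> is \<open>'g \<Rightarrow>\<^sub>0 R\<close>, whose multiplication is
  the convolution product, and \<open>frag_of g\<close> is the group element \<open>g\<close> inside \<open>\<int>[G]\<close>.
\<close>

inductive_set group_span :: "'a::group_add set \<Rightarrow> 'a set" for S where
  zero: "0 \<in> group_span S"
| base: "x \<in> S \<Longrightarrow> x \<in> group_span S"
| add: "x \<in> group_span S \<Longrightarrow> y \<in> group_span S \<Longrightarrow> x + y \<in> group_span S"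
| uminus: "x \<in> group_span S \<Longrightarrow> - x \<in> group_span S"

lemma group_span_diff: "x \<in> group_span S \<Longrightarrow> y \<in> group_span S \<Longrightarrow> x - y \<in> group_span S"
  using group_span.add[OF _ group_span.uminus] by fastforce

definition finitely_generated :: "'g::group_add itself \<Rightarrow> bool" where
  "finitely_generated _ \<longleftrightarrow> (\<exists>S :: 'g set. finite S \<and> group_span S = UNIV)"

definition commutator_subgroup :: "'g::group_add set" where
  "commutator_subgroup = group_span {a + b - a - b | a b. True}"

lemma commutator_subgroup_intros:
  "0 \<in> commutator_subgroup"
  "a + b - a - b \<in> commutator_subgroup"
  "x \<in> commutator_subgroup \<Longrightarrow> y \<in> commutator_subgroup \<Longrightarrow> x + y \<in> commutator_subgroup"
  "x \<in> commutator_subgroup \<Longrightarrow> - x \<in> commutator_subgroup"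
  unfolding commutator_subgroup_def by (blast intro: group_span.intros)+

lemma commutator_subgroup_conj:
  assumes "x \<in> commutator_subgroup"
  shows "g + x - g \<in> commutator_subgroup"
proof -
  have "(g + x - g - x) + x \<in> commutator_subgroup"
    using assms commutator_subgroup_intros by blast
  then show ?thesis by simp
qed

quotient_type (overloaded) 'g ab =
  "'g::group_add" / "\<lambda>x y. x - y \<in> commutator_subgroup"
proof (rule equivpI)
  show "reflp (\<lambda>x y :: 'g. x - y \<in> commutator_subgroup)"
    by (auto intro!: reflpI commutator_subgroup_intros)
  show "symp (\<lambda>x y :: 'g. x - y \<in> commutator_subgroup)"
    by (metis (mono_tags, lifting) commutator_subgroup_intros(4) minus_diff_eq sympI)
  show "transp (\<lambda>x y :: 'g. x - y \<in> commutator_subgroup)"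
  proof (rule transpI)
    fix x y z :: 'g
    assume "x - y \<in> commutator_subgroup" "y - z \<in> commutator_subgroup"
    from commutator_subgroup_intros(3)[OF this] show "x - z \<in> commutator_subgroup"
      by (simp add: algebra_simps)
  qed
qed

instantiation ab :: (group_add) ab_group_add
begin

lift_definition zero_ab :: "'a ab" is 0 .

lift_definition plus_ab :: "'a ab \<Rightarrow> 'a ab \<Rightarrow> 'a ab" is "(+)"
proof -
  fix a b c d :: 'a
  assume 1: "a - b \<in> commutator_subgroup" and 2: "c - d \<in> commutator_subgroup"
  have "(a + (c - d) - a) + (a - b) \<in> commutator_subgroup"
    by (intro commutator_subgroup_intros commutator_subgroup_conj 1 2)
  moreover have "b + d - b - d \<in> commutator_subgroup"
    by (rule commutator_subgroup_intros)
  moreover have "a + c - (b + d) = (a + (c - d) - a) + (a - b) + (b + d - b - d) + (d + b - d - b)"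
    by (simp add: diff_conv_add_uminus add.assoc minus_add del: add_uminus_conv_diff)
  ultimately show "a + c - (b + d) \<in> commutator_subgroup"
    by (metis commutator_subgroup_intros(2,3))
qed

lift_definition uminus_ab :: "'a ab \<Rightarrow> 'a ab" is uminus
proof -
  fix a b :: 'a
  assume "a - b \<in> commutator_subgroup"
  then have "- b + (- (a - b)) - (- b) \<in> commutator_subgroup"
    by (intro commutator_subgroup_conj commutator_subgroup_intros)
  then show "- a - - b \<in> commutator_subgroup"
    by (simp add: algebra_simps)
qed

definition minus_ab :: "'a ab \<Rightarrow> 'a ab \<Rightarrow> 'a ab" where
  "minus_ab x y = x + - y"

instance
proof
  fix a b c :: "'a ab"
  show "a + b + c = a + (b + c)"
    by transfer (simp add: algebra_simps commutator_subgroup_intros)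
  show "a + b = b + a"
  proof transfer
    fix a b :: 'a
    show "a + b - (b + a) \<in> commutator_subgroup"
      using commutator_subgroup_intros(2)[of a b]
      by (simp add: diff_conv_add_uminus add.assoc minus_add del: add_uminus_conv_diff)
  qed
  show "0 + a = a" by transfer (simp add: commutator_subgroup_intros)
  show "- a + a = 0" by transfer (simp add: commutator_subgroup_intros)
  show "a - b = a + - b" by (rule minus_ab_def)
qed

end

definition is_torsion :: "'a::ab_group_add \<Rightarrow> bool" where
  "is_torsion x \<longleftrightarrow> (\<exists>k::nat. k > 0 \<and> (\<Sum>i<k. x) = 0)"

lemma sum_const_mult: "(\<Sum>i<k * l. x) = (\<Sum>i<k. \<Sum>j<l. (x::'a::ab_group_add))" for k l :: nat
proof (induction k)
  case (Suc k)
  have add: "(\<Sum>i<m + n. x) = (\<Sum>i<m. x) + (\<Sum>i<n. x)" for m n :: nat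
    by (induction n) (auto simp: algebra_simps)
  show ?case using Suc by (simp add: add algebra_simps)
qed simp

lemma is_torsion_0: "is_torsion 0"
  unfolding is_torsion_def by (intro exI[of _ 1]) simp

lemma is_torsion_uminus: "is_torsion x \<Longrightarrow> is_torsion (- x)"
  unfolding is_torsion_def by (simp add: sum_negf)

lemma is_torsion_add:
  assumes "is_torsion x" "is_torsion y"
  shows "is_torsion (x + y)"
proof -
  obtain k l :: nat where k: "k > 0" "(\<Sum>i<k. x) = 0" and l: "l > 0" "(\<Sum>i<l. y) = 0"
    using assms unfolding is_torsion_def by blast
  have "(\<Sum>i<k * l. x + y) = (\<Sum>i<l * k. x) + (\<Sum>i<k * l. y)"
    by (simp add: sum.distrib mult.commute)
  also have "\<dots> = 0" by (simp only: sum_const_mult k l) simp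
  finally show ?thesis using k l unfolding is_torsion_def by (intro exI[of _ "k * l"]) simp
qed

quotient_type (overloaded) 'a mod_torsion =
  "'a::ab_group_add" / "\<lambda>x y. is_torsion (x - y)"
proof (rule equivpI)
  show "reflp (\<lambda>x y :: 'a. is_torsion (x - y))"
    by (auto intro!: reflpI is_torsion_0)
  show "symp (\<lambda>x y :: 'a. is_torsion (x - y))"
    by (metis (mono_tags, lifting) is_torsion_uminus minus_diff_eq sympI)
  show "transp (\<lambda>x y :: 'a. is_torsion (x - y))"
  proof (rule transpI)
    fix x y z :: 'a
    assume "is_torsion (x - y)" "is_torsion (y - z)"
    from is_torsion_add[OF this] show "is_torsion (x - z)" by simp
  qed
qed

instantiation mod_torsion :: (ab_group_add) ab_group_add
begin

lift_definition zero_mod_torsion :: "'a mod_torsion" is 0 .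

lift_definition plus_mod_torsion :: "'a mod_torsion \<Rightarrow> 'a mod_torsion \<Rightarrow> 'a mod_torsion" is "(+)"
  using is_torsion_add by (fastforce simp: algebra_simps)

lift_definition uminus_mod_torsion :: "'a mod_torsion \<Rightarrow> 'a mod_torsion" is uminus
  using is_torsion_uminus by fastforce

definition minus_mod_torsion :: "'a mod_torsion \<Rightarrow> 'a mod_torsion \<Rightarrow> 'a mod_torsion" where
  "minus_mod_torsion x y = x + - y"

instance
proof
  fix a b c :: "'a mod_torsion"
  show "a + b + c = a + (b + c)" by transfer (simp add: algebra_simps is_torsion_0)
  show "a + b = b + a" by transfer (simp add: algebra_simps is_torsion_0)
  show "0 + a = a" by transfer (simp add: is_torsion_0)
  show "- a + a = 0" by transfer (simp add: is_torsion_0)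
  show "a - b = a + - b" by (rule minus_mod_torsion_def)
qed

end

type_synonym 'g abf = "'g ab mod_torsion"

definition abf_proj :: "'g::group_add \<Rightarrow> 'g abf" where
  "abf_proj g = abs_mod_torsion (abs_ab g)"

text \<open>
  An identification \<open>G\<^sub>a\<^sub>b\<^sub>f \<cong> \<int>\<^sup>n\<close>; its existence forces \<open>n = b\<^sub>1(G)\<close>. Under it \<open>'g abf \<Rightarrow>\<^sub>0 int\<close> is
  \<open>\<Lambda>\<^sub>n\<close>, the group element \<open>u\<close> being the monomial with exponent vector \<open>\<phi> u\<close>.
\<close>
definition abf_coordinates :: "nat \<Rightarrow> ('g::group_add abf \<Rightarrow> int Matrix.vec) \<Rightarrow> bool" where
  "abf_coordinates n \<phi> \<longleftrightarrow>
     bij_betw \<phi> UNIV (carrier_vec n) \<and> (\<forall>x y. \<phi> (x + y) = \<phi> x + \<phi> y)"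

definition characters :: "('a::monoid_add \<Rightarrow> complex) set" where
  "characters = {\<rho>. (\<forall>x. \<rho> x \<noteq> 0) \<and> (\<forall>x y. \<rho> (x + y) = \<rho> x * \<rho> y)}"

definition cscale :: "complex \<Rightarrow> ('a \<Rightarrow>\<^sub>0 complex) \<Rightarrow> ('a \<Rightarrow>\<^sub>0 complex)" where
  "cscale c = Poly_Mapping.map ((*) c)"

lemma lookup_cscale: "Poly_Mapping.lookup (cscale c x) k = c * Poly_Mapping.lookup x k"
  unfolding cscale_def by (simp add: Poly_Mapping.map.rep_eq when_def)

interpretation cscale: vector_space cscale
  by standard (auto intro!: poly_mapping_eqI simp: lookup_cscale Poly_Mapping.lookup_add algebra_simps)

text \<open>A basis of the quotient space \<open>Z / B\<close>, given by representatives in \<open>Z\<close>.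
  As for \<^term>\<open>vector_space.dim\<close>, the dimension of an infinite-dimensional quotient is \<open>0\<close>; this does
  not happen for \<open>H\<^sub>1\<close> of a finitely generated group.\<close>
definition basis_modulo ::
    "('k::field \<Rightarrow> 'v::ab_group_add \<Rightarrow> 'v) \<Rightarrow> 'v set \<Rightarrow> 'v set \<Rightarrow> 'v set \<Rightarrow> bool" where
  "basis_modulo scl Z B S \<longleftrightarrow> S \<subseteq> Z \<and>
     (\<forall>z\<in>Z. \<exists>T c. finite T \<and> T \<subseteq> S \<and> z - (\<Sum>s\<in>T. scl (c s) s) \<in> B) \<and>
     (\<forall>T c. finite T \<and> T \<subseteq> S \<and> (\<Sum>s\<in>T. scl (c s) s) \<in> B \<longrightarrow> (\<forall>s\<in>T. c s = 0))"

definition quotient_dim ::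
    "('k::field \<Rightarrow> 'v::ab_group_add \<Rightarrow> 'v) \<Rightarrow> 'v set \<Rightarrow> 'v set \<Rightarrow> nat" where
  "quotient_dim scl Z B = card (SOME S. basis_modulo scl Z B S)"

text \<open>
  \<open>H\<^sub>1(G; \<complex>\<^sub>\<rho>)\<close> is computed by \<open>\<complex>\<^sub>\<rho> \<otimes>\<^bsub>\<int>[G]\<^esub> (bar resolution)\<close>, where \<open>\<complex>\<^sub>\<rho>\<close> is the right \<open>\<int>[G]\<close>-module
  on which \<open>g\<close> acts by \<open>\<rho> g\<close>:
  \<open>\<partial>\<^sub>1 [g] = \<rho>(g) - 1\<close> and \<open>\<partial>\<^sub>2 [g|h] = \<rho>(g) [h] - [gh] + [g]\<close>.
\<close>
definition bar_d1 :: "('g::group_add \<Rightarrow> complex) \<Rightarrow> ('g \<Rightarrow>\<^sub>0 complex) \<Rightarrow> complex" where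
  "bar_d1 \<rho> c = (\<Sum>g\<in>Poly_Mapping.keys c. Poly_Mapping.lookup c g * (\<rho> g - 1))"

definition bar_d2 ::
    "('g::group_add \<Rightarrow> complex) \<Rightarrow> ('g \<times> 'g \<Rightarrow>\<^sub>0 complex) \<Rightarrow> ('g \<Rightarrow>\<^sub>0 complex)" where
  "bar_d2 \<rho> c = (\<Sum>(g, h)\<in>Poly_Mapping.keys c. cscale (Poly_Mapping.lookup c (g, h))
     (Poly_Mapping.single h (\<rho> g) - Poly_Mapping.single (g + h) 1 + Poly_Mapping.single g 1))"

definition twisted_b1 :: "('g::group_add \<Rightarrow> complex) \<Rightarrow> nat" where
  "twisted_b1 \<rho> = quotient_dim cscale {c. bar_d1 \<rho> c = 0} (range (bar_d2 \<rho>))"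

definition char_variety :: "nat \<Rightarrow> ('g::group_add \<Rightarrow> complex) set" where
  "char_variety k = {\<rho> \<in> characters. twisted_b1 \<rho> \<ge> k}"

text \<open>
  Points of \<open>\<T>\<^sub>G\<^sup>0\<close> are characters \<open>\<sigma>\<close> of \<open>G\<^sub>a\<^sub>b\<^sub>f\<close>; as a point of \<open>\<T>\<^sub>G\<close>, such a \<open>\<sigma>\<close> is \<open>\<sigma> \<circ> abf_proj\<close>.
\<close>
definition eval_char :: "('a \<Rightarrow>\<^sub>0 complex) \<Rightarrow> ('a \<Rightarrow> complex) \<Rightarrow> complex" where
  "eval_char f \<sigma> = (\<Sum>u\<in>Poly_Mapping.keys f. Poly_Mapping.lookup f u * \<sigma> u)"

definition zero_locus :: "('g::group_add abf \<Rightarrow>\<^sub>0 complex) \<Rightarrow> ('g abf \<Rightarrow> complex) set" where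
  "zero_locus f = {\<sigma> \<in> characters. eval_char f \<sigma> = 0}"

text \<open>
  If \<open>f\<close> is irreducible then \<open>V(f)\<close> is nonempty, and the set below is finite.
\<close>
definition generic_b1 :: "('g::group_add abf \<Rightarrow>\<^sub>0 complex) \<Rightarrow> nat" where
  "generic_b1 f = Max {k. (\<lambda>\<sigma>. \<sigma> \<circ> abf_proj) ` zero_locus f \<subseteq> char_variety k}"

definition torus_point :: "nat \<Rightarrow> ('g::group_add abf \<Rightarrow> int Matrix.vec) \<Rightarrow>
    ('g abf \<Rightarrow> complex) \<Rightarrow> complex Matrix.vec" where
  "torus_point n \<phi> \<sigma> = Matrix.vec n (\<lambda>i. \<sigma> (inv_into UNIV \<phi> (unit_vec n i)))"

definition laurent_eval :: "nat \<Rightarrow> ('g::group_add abf \<Rightarrow> int Matrix.vec) \<Rightarrow>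
    ('g abf \<Rightarrow>\<^sub>0 complex) \<Rightarrow> complex Matrix.vec \<Rightarrow> complex" where
  "laurent_eval n \<phi> f z =
     (\<Sum>u\<in>Poly_Mapping.keys f. Poly_Mapping.lookup f u *
       (\<Prod>i<n. power_int (vec_index z i) (vec_index (\<phi> u) i)))"

text \<open>
  The homogeneous term of degree \<open>k\<close> of the Taylor expansion of \<open>F\<close> at \<open>z\<close> is the form
  \<open>w \<mapsto> (1/k!) (d/ds)\<^sup>k F (z + s w)\<close> at \<open>s = 0\<close>. The order of vanishing is only meaningful for \<open>f \<noteq> 0\<close>.
\<close>
definition taylor_term ::
    "(complex Matrix.vec \<Rightarrow> complex) \<Rightarrow> complex Matrix.vec \<Rightarrow> nat \<Rightarrow> complex Matrix.vec \<Rightarrow> complex" where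
  "taylor_term F z k w = (deriv ^^ k) (\<lambda>s. F (z + s \<cdot>\<^sub>v w)) 0 / fact k"

definition vanishing_order :: "nat \<Rightarrow> ('g::group_add abf \<Rightarrow> int Matrix.vec) \<Rightarrow>
    ('g abf \<Rightarrow> complex) \<Rightarrow> ('g abf \<Rightarrow>\<^sub>0 complex) \<Rightarrow> nat" where
  "vanishing_order n \<phi> \<sigma> f =
     (LEAST k. \<exists>w\<in>carrier_vec n. taylor_term (laurent_eval n \<phi> f) (torus_point n \<phi> \<sigma>) k w \<noteq> 0)"

definition augmentation :: "('a \<Rightarrow>\<^sub>0 int) \<Rightarrow> int" where
  "augmentation x = (\<Sum>g\<in>Poly_Mapping.keys x. Poly_Mapping.lookup x g)"

definition augmentation_ideal :: "('a \<Rightarrow>\<^sub>0 int) set" where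
  "augmentation_ideal = {x. augmentation x = 0}"

lemma augmentation_superset:
  assumes "finite A" "Poly_Mapping.keys x \<subseteq> A"
  shows "augmentation x = (\<Sum>g\<in>A. Poly_Mapping.lookup x g)"
  unfolding augmentation_def using assms
  by (intro sum.mono_neutral_left) (auto simp: Poly_Mapping.in_keys_iff)

lemma augmentation_add: "augmentation (x + y) = augmentation x + augmentation y"
proof -
  have "finite (Poly_Mapping.keys x \<union> Poly_Mapping.keys y)" by simp
  note sup = augmentation_superset[OF this]
  show ?thesis
    using Poly_Mapping.keys_add[of x y] by (simp add: sup Poly_Mapping.lookup_add sum.distrib)
qed

lemma augmentation_0: "augmentation 0 = 0"
  by (simp add: augmentation_def)

lemma augmentation_uminus: "augmentation (- x) = - augmentation x"
  using augmentation_add[of x "- x"] by (simp add: augmentation_0)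

lemma augmentation_diff: "augmentation (x - y) = augmentation x - augmentation y"
  using augmentation_add[of x "- y"] by (simp add: augmentation_uminus)

lemma augmentation_frag_of: "augmentation (frag_of g) = 1"
  by (simp add: augmentation_def)

lemma augmentation_mult:
  fixes x y :: "'a::monoid_add \<Rightarrow>\<^sub>0 int"
  shows "augmentation (x * y) = augmentation x * augmentation y"
proof (induction x rule: frag_induction[of _ UNIV, OF subset_UNIV])
  case (2 g)
  show ?case
    by (induction y rule: frag_induction[of _ UNIV, OF subset_UNIV])
       (auto simp: augmentation_0 augmentation_frag_of mult_single augmentation_diff algebra_simps)
qed (auto simp: augmentation_0 augmentation_diff algebra_simps)

typedef 'g aug = "augmentation_ideal :: ('g \<Rightarrow>\<^sub>0 int) set"
  by (rule exI[of _ 0]) (simp add: augmentation_ideal_def augmentation_0)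

setup_lifting type_definition_aug
lifting_forget poly_mapping.lifting

lift_definition aug_add :: "'g aug \<Rightarrow> 'g aug \<Rightarrow> 'g aug" is "(+)"
  by (simp add: augmentation_ideal_def augmentation_add)

lift_definition aug_lmult :: "('g::group_add \<Rightarrow>\<^sub>0 int) \<Rightarrow> 'g aug \<Rightarrow> 'g aug" is "(*)"
  by (simp add: augmentation_ideal_def augmentation_mult)

definition group_ring_proj :: "('g::group_add \<Rightarrow>\<^sub>0 int) \<Rightarrow> ('g abf \<Rightarrow>\<^sub>0 int)" where
  "group_ring_proj = frag_extend (\<lambda>g. frag_of (abf_proj g))"

text \<open>
  \<open>\<int>[G\<^sub>a\<^sub>b\<^sub>f] \<otimes>\<^bsub>\<int>[G]\<^esub> I\<^sub>G\<close> is the quotient of the free abelian group on \<open>\<int>[G\<^sub>a\<^sub>b\<^sub>f] \<times> I\<^sub>G\<close> by the subgroup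
  generated by the bilinearity and balancing relations.
\<close>
type_synonym 'g tensor_free = "('g abf \<Rightarrow>\<^sub>0 int) \<times> 'g aug \<Rightarrow>\<^sub>0 int"

definition tensor_gens :: "'g::group_add tensor_free set" where
  "tensor_gens =
     {frag_of (p + q, x) - frag_of (p, x) - frag_of (q, x) | p q x. True} \<union>
     {frag_of (p, aug_add x y) - frag_of (p, x) - frag_of (p, y) | p x y. True} \<union>
     {frag_of (p * group_ring_proj r, x) - frag_of (p, aug_lmult r x) | p r x. True}"

quotient_type (overloaded) 'g alexander_module =
  "'g::group_add tensor_free" / "\<lambda>x y. x - y \<in> group_span tensor_gens"
proof (rule equivpI)
  show "reflp (\<lambda>x y :: 'g tensor_free. x - y \<in> group_span tensor_gens)"
    by (auto intro!: reflpI group_span.zero)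
  show "symp (\<lambda>x y :: 'g tensor_free. x - y \<in> group_span tensor_gens)"
    by (metis (mono_tags, lifting) group_span.uminus minus_diff_eq sympI)
  show "transp (\<lambda>x y :: 'g tensor_free. x - y \<in> group_span tensor_gens)"
  proof (rule transpI)
    fix x y z :: "'g tensor_free"
    assume "x - y \<in> group_span tensor_gens" "y - z \<in> group_span tensor_gens"
    from group_span.add[OF this] show "x - z \<in> group_span tensor_gens" by simp
  qed
qed

instantiation alexander_module :: (group_add) ab_group_add
begin

lift_definition zero_alexander_module :: "'a alexander_module" is 0 .

lift_definition plus_alexander_module ::
    "'a alexander_module \<Rightarrow> 'a alexander_module \<Rightarrow> 'a alexander_module" is "(+)"
  by (metis add_diff_add group_span.add)

lift_definition uminus_alexander_module ::
    "'a alexander_module \<Rightarrow> 'a alexander_module" is uminus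
  by (metis group_span.uminus minus_diff_minus)

definition minus_alexander_module ::
    "'a alexander_module \<Rightarrow> 'a alexander_module \<Rightarrow> 'a alexander_module" where
  "minus_alexander_module x y = x + - y"

instance
proof
  fix a b c :: "'a alexander_module"
  show "a + b + c = a + (b + c)" by transfer (simp add: algebra_simps group_span.zero)
  show "a + b = b + a" by transfer (simp add: algebra_simps group_span.zero)
  show "0 + a = a" by transfer (simp add: group_span.zero)
  show "- a + a = 0" by transfer (simp add: group_span.zero)
  show "a - b = a + - b" by (rule minus_alexander_module_def)
qed

end

definition tensor_free_scale ::
    "('g::group_add abf \<Rightarrow>\<^sub>0 int) \<Rightarrow> 'g tensor_free \<Rightarrow> 'g tensor_free" where
  "tensor_free_scale r = frag_extend (\<lambda>(p, x). frag_of (r * p, x))"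

lemma tensor_free_scale_span:
  assumes "x \<in> group_span tensor_gens"
  shows "tensor_free_scale r x \<in> group_span tensor_gens"
  using assms
proof induction
  case (base x)
  then have "tensor_free_scale r x \<in> tensor_gens"
    unfolding tensor_gens_def tensor_free_scale_def
    by (auto simp: frag_extend_diff distrib_left mult.assoc[symmetric]) blast+
  then show ?case by (rule group_span.base)
qed (auto simp: tensor_free_scale_def frag_extend_add frag_extend_minus intro: group_span.intros)

lift_definition alexander_scale ::
    "('g::group_add abf \<Rightarrow>\<^sub>0 int) \<Rightarrow> 'g alexander_module \<Rightarrow> 'g alexander_module"
  is tensor_free_scale
  by (metis frag_extend_diff tensor_free_scale_def tensor_free_scale_span)

interpretation alexander: Modules.module alexander_scale
proof
  fix r s :: "'g::group_add abf \<Rightarrow>\<^sub>0 int" and x y :: "'g alexander_module"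
  show "alexander_scale r (x + y) = alexander_scale r x + alexander_scale r y"
    by transfer (simp add: tensor_free_scale_def frag_extend_add group_span.zero)
  show "alexander_scale (r + s) x = alexander_scale r x + alexander_scale s x"
  proof transfer
    fix r s :: "'g abf \<Rightarrow>\<^sub>0 int" and x :: "'g tensor_free"
    show "tensor_free_scale (r + s) x - (tensor_free_scale r x + tensor_free_scale s x)
            \<in> group_span tensor_gens"
    proof (induction x rule: frag_induction[of _ UNIV, OF subset_UNIV])
      case (2 px)
      obtain p x where "px = (p, x)" by force
      moreover have "frag_of (r * p + s * p, x) - frag_of (r * p, x) - frag_of (s * p, x)
          \<in> group_span tensor_gens"
        unfolding tensor_gens_def by (intro group_span.base UnI1) blast
      ultimately show ?case
        by (simp add: tensor_free_scale_def distrib_right diff_diff_eq)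
    next
      case (3 a b)
      from group_span_diff[OF this] show ?case
        by (simp add: tensor_free_scale_def frag_extend_diff algebra_simps)
    qed (simp add: tensor_free_scale_def group_span.zero)
  qed
  show "alexander_scale r (alexander_scale s x) = alexander_scale (r * s) x"
  proof transfer
    fix r s :: "'g abf \<Rightarrow>\<^sub>0 int" and x :: "'g tensor_free"
    have "tensor_free_scale r (tensor_free_scale s x) = tensor_free_scale (r * s) x"
      by (induction x rule: frag_induction[of _ UNIV, OF subset_UNIV])
         (auto simp: tensor_free_scale_def frag_extend_diff mult.assoc)
    then show "tensor_free_scale r (tensor_free_scale s x) - tensor_free_scale (r * s) x
        \<in> group_span tensor_gens"
      by (simp add: group_span.zero)
  qed
  show "alexander_scale 1 x = x"
  proof transfer
    fix x :: "'g tensor_free"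
    have "tensor_free_scale 1 x = x"
      by (induction x rule: frag_induction[of _ UNIV, OF subset_UNIV])
         (auto simp: tensor_free_scale_def frag_extend_diff)
    then show "tensor_free_scale 1 x - x \<in> group_span tensor_gens"
      by (simp add: group_span.zero)
  qed
qed

text \<open>
  \<open>M\<close> is the \<open>h \<times> m\<close> matrix of an exact sequence \<open>R\<^sup>h \<rightarrow> R\<^sup>m \<rightarrow> A \<rightarrow> 0\<close>: its rows are the relations
  between the images \<open>a i\<close> of the standard basis vectors of \<open>R\<^sup>m\<close>.
\<close>
definition presentation_matrix ::
    "('r::comm_ring_1 \<Rightarrow> 'm::ab_group_add \<Rightarrow> 'm) \<Rightarrow> 'r Matrix.mat \<Rightarrow> bool" where
  "presentation_matrix scl M \<longleftrightarrow>
     (\<exists>a :: nat \<Rightarrow> 'm.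
        let \<pi> = (\<lambda>c :: 'r Matrix.vec. \<Sum>i<dim_col M. scl (vec_index c i) (a i)) in
          \<pi> ` carrier_vec (dim_col M) = UNIV \<and>
          {c \<in> carrier_vec (dim_col M). \<pi> c = 0} =
            (\<lambda>d. transpose_mat M *\<^sub>v d) ` carrier_vec (dim_row M))"

definition minors :: "nat \<Rightarrow> 'r::comm_ring_1 Matrix.mat \<Rightarrow> 'r set" where
  "minors k M = {Determinant.det (submatrix M I J) | I J.
     I \<subseteq> {..<dim_row M} \<and> J \<subseteq> {..<dim_col M} \<and> card I = k \<and> card J = k}"

definition ideal_gen :: "'r::comm_ring_1 set \<Rightarrow> 'r set" where
  "ideal_gen = Modules.module.span (*)"

text \<open>
  The truncated difference is harmless: for \<open>m \<le> 1\<close> the only minor is the empty one, equal to \<open>1\<close>,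
  and for \<open>m - 1 > h\<close> there are no minors.
\<close>
definition alexander_ideal_of :: "'r::comm_ring_1 Matrix.mat \<Rightarrow> 'r set" where
  "alexander_ideal_of M = ideal_gen (minors (dim_col M - 1) M)"

definition is_gcd_of :: "'r::comm_ring_1 \<Rightarrow> 'r set \<Rightarrow> bool" where
  "is_gcd_of d E \<longleftrightarrow> (\<forall>x\<in>E. d dvd x) \<and> (\<forall>c. (\<forall>x\<in>E. c dvd x) \<longrightarrow> c dvd d)"

definition eq_up_to_unit :: "'r::comm_ring_1 \<Rightarrow> 'r \<Rightarrow> bool" where
  "eq_up_to_unit a b \<longleftrightarrow> (\<exists>u. u dvd 1 \<and> a = u * b)"

definition complexify :: "('a \<Rightarrow>\<^sub>0 int) \<Rightarrow> ('a \<Rightarrow>\<^sub>0 complex)" where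
  "complexify = Poly_Mapping.map of_int"

definition ideal_mult :: "'r::comm_ring_1 set \<Rightarrow> 'r set \<Rightarrow> 'r set" where
  "ideal_mult A B = ideal_gen {a * b | a b. a \<in> A \<and> b \<in> B}"

definition ideal_power :: "'r::comm_ring_1 set \<Rightarrow> nat \<Rightarrow> 'r set" where
  "ideal_power A d = (ideal_mult A ^^ d) UNIV"

definition complex_extension :: "('a::comm_monoid_add \<Rightarrow>\<^sub>0 int) set \<Rightarrow> ('a \<Rightarrow>\<^sub>0 complex) set" where
  "complex_extension J = ideal_gen (complexify ` J)"

definition almost_principal ::
    "('a::comm_monoid_add \<Rightarrow>\<^sub>0 int) set \<Rightarrow> ('a \<Rightarrow>\<^sub>0 int) \<Rightarrow> bool" where
  "almost_principal E \<Delta> \<longleftrightarrow> (\<exists>d.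
     complex_extension (ideal_mult (ideal_power augmentation_ideal d) (ideal_gen {\<Delta>}))
       \<subseteq> complex_extension E)"

end

theory Submission
  imports Defs
    "HOL-Computational_Algebra.Polynomial"
    "HOL-Computational_Algebra.Fundamental_Theorem_Algebra"
    "HOL-Computational_Algebra.Polynomial_FPS"
    "HOL-Analysis.FPS_Convergence"
begin

text \<open>
  For \<open>\<sigma> \<noteq> 1\<close> the dual of \<open>\<complex>\<^sub>\<sigma> \<otimes> A\<^sub>G\<close> is the space of crossed homomorphisms \<open>G \<rightarrow> \<complex>\<^sub>\<sigma>\<close>, of dimension
  \<open>b\<^sub>1(G, \<sigma>) + 1\<close>. Hence a presentation matrix evaluated at \<open>\<sigma>\<close> kills that many independent vectors, and
  along any line through \<open>\<sigma>\<close> its minors of size \<open>m - 1\<close> vanish to order at least \<open>b\<^sub>1(G, \<sigma>)\<close>. If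
  \<open>y \<Delta>\<close> lies in the Alexander ideal and \<open>y(\<sigma>) \<noteq> 0\<close>, then \<open>\<Delta>\<close> vanishes to that order too. For (ii), almost
  principality supplies \<open>y = (u - 1)\<^sup>d\<close> with \<open>\<sigma>(u) \<noteq> 1\<close>, and the line is chosen such that every \<open>f\<^sub>j\<close>
  vanishes along it to order exactly \<open>\<nu>\<^sub>\<sigma>(f\<^sub>j)\<close>. For (i), unique factorization gives a cofactor \<open>y\<close>
  not divisible by \<open>f\<^sub>j\<close> and then a simple zero of \<open>f\<^sub>j\<close> at which neither \<open>y\<close> nor the other factors
  vanish; it can be taken different from \<open>1\<close> unless \<open>n = 1\<close>, where \<open>b\<^sub>1(G, 1) \<le> 1\<close> suffices.
\<close>

section \<open>Gauss lemma for subrings\<close>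

text \<open>Adjoining variables one at a time needs Laurent rings in fewer variables, and these
  appear as subsets of one fixed ring type. Units, divisors and primes are therefore taken relative
  to a carrier. Factoriality is required over both int and complex: \<open>\<Delta>\<close> is an
  integral gcd, while the \<open>f j\<close> are irreducible only over complex. A complex common
  divisor of the cofactors contradicts nothing until an integral prime lying over it has been found.
  Restricting to a line turns orders of germs into \<open>subdegree\<close>, which is additive on
  products, and a lower bound on the order into divisibility by a power of \<open>fps_X\<close>. The
  exponent is \<open>b\<close> although the kernel has dimension \<open>b + 1\<close>, because a
  minor of size \<open>m - 1\<close> drops one column and only the kernel vectors with entry 0 there
  survive. The derivative enters (i) because the exponent of \<open>f j\<close> gets multiplied by
  its order along the line; the bound \<open>\<mu> j\<close> comes out only at a zero that is simple
  in some direction.\<close>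

locale subdomain =
  fixes S :: "'a::comm_ring_1 set"
  assumes one_closed: "1 \<in> S"
    and add_closed: "a \<in> S \<Longrightarrow> b \<in> S \<Longrightarrow> a + b \<in> S"
    and mult_closed: "a \<in> S \<Longrightarrow> b \<in> S \<Longrightarrow> a * b \<in> S"
    and uminus_closed: "a \<in> S \<Longrightarrow> - a \<in> S"
    and no_zero_div: "a \<in> S \<Longrightarrow> b \<in> S \<Longrightarrow> a * b = 0 \<Longrightarrow> a = 0 \<or> b = 0"
begin

lemma diff_closed: "a \<in> S \<Longrightarrow> b \<in> S \<Longrightarrow> a - b \<in> S"
  using add_closed[of a "- b"] uminus_closed[of b] by simp

lemma zero_closed: "0 \<in> S"
  using diff_closed[OF one_closed one_closed] by simp

lemma sum_closed: "(\<And>i. i \<in> I \<Longrightarrow> h i \<in> S) \<Longrightarrow> sum h I \<in> S"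
  by (induction I rule: infinite_finite_induct) (auto intro: zero_closed add_closed)

lemma cancel_left:
  assumes "a \<in> S" "b \<in> S" "c \<in> S" "a \<noteq> 0" "a * b = a * c"
  shows "b = c"
  using no_zero_div[of a "b - c"] assms diff_closed by (auto simp: algebra_simps)

end

definition dvd_in :: "'a::comm_ring_1 set \<Rightarrow> 'a \<Rightarrow> 'a \<Rightarrow> bool" where
  "dvd_in S a b \<longleftrightarrow> (\<exists>c\<in>S. b = a * c)"

definition unit_in :: "'a::comm_ring_1 set \<Rightarrow> 'a \<Rightarrow> bool" where
  "unit_in S a \<longleftrightarrow> a \<in> S \<and> (\<exists>c\<in>S. a * c = 1)"

definition prime_in :: "'a::comm_ring_1 set \<Rightarrow> 'a \<Rightarrow> bool" where
  "prime_in S p \<longleftrightarrow> p \<in> S \<and> p \<noteq> 0 \<and> \<not> unit_in S p \<and>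
     (\<forall>a\<in>S. \<forall>b\<in>S. dvd_in S p (a * b) \<longrightarrow> dvd_in S p a \<or> dvd_in S p b)"

text \<open>Factors are prime, not just irreducible, so uniqueness of factorization is built in: a
  domain is factorial iff all its nonzero elements lie in this set. Starting from units avoids
  bookkeeping up to associates.\<close>

inductive_set prime_products :: "'a::comm_ring_1 set \<Rightarrow> 'a set" for S where
  unit: "unit_in S u \<Longrightarrow> u \<in> prime_products S"
| prime: "prime_in S p \<Longrightarrow> a \<in> prime_products S \<Longrightarrow> p * a \<in> prime_products S"

lemma dvd_in_UNIV [simp]: "dvd_in UNIV = (dvd)"
  by (auto simp: dvd_in_def dvd_def fun_eq_iff)

lemma unit_in_UNIV [simp]: "unit_in UNIV a \<longleftrightarrow> a dvd 1"
  by (auto simp: unit_in_def dvd_def)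

context subdomain
begin

lemma unit_in_mult: "unit_in S a \<Longrightarrow> unit_in S b \<Longrightarrow> unit_in S (a * b)"
  unfolding unit_in_def
  by (metis (no_types, lifting) mult.assoc mult.left_commute mult_1_right mult_closed)

lemma unit_in_one: "unit_in S 1"
  using one_closed by (auto simp: unit_in_def)

lemma dvd_in_mult: "dvd_in S a b \<Longrightarrow> c \<in> S \<Longrightarrow> dvd_in S a (b * c)"
  unfolding dvd_in_def by (metis mult.assoc mult_closed)

lemma dvd_in_mult_left: "dvd_in S a b \<Longrightarrow> c \<in> S \<Longrightarrow> dvd_in S a (c * b)"
  using dvd_in_mult[of a b c] by (simp add: mult.commute)

lemma dvd_in_trans: "dvd_in S a b \<Longrightarrow> dvd_in S b c \<Longrightarrow> dvd_in S a c"
  unfolding dvd_in_def by (metis mult.assoc mult_closed)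

lemma dvd_in_add: "dvd_in S a b \<Longrightarrow> dvd_in S a c \<Longrightarrow> dvd_in S a (b + c)"
  unfolding dvd_in_def by (metis add_closed distrib_left)

lemma dvd_in_zero: "dvd_in S a 0"
  unfolding dvd_in_def using zero_closed by (metis mult_zero_right)

lemma dvd_in_self: "dvd_in S a a"
  unfolding dvd_in_def by (metis mult_1_right one_closed)

lemma prime_products_closed: "a \<in> prime_products S \<Longrightarrow> a \<in> S"
  by (induction rule: prime_products.induct) (auto simp: unit_in_def prime_in_def mult_closed)

lemma prime_products_mult:
  assumes "a \<in> prime_products S" "b \<in> prime_products S"
  shows "a * b \<in> prime_products S"
  using assms(1)
proof (induction rule: prime_products.induct)
  case (unit u)
  show ?case using assms(2)
  proof (induction rule: prime_products.induct)
    case (unit v)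
    then show ?case using unit_in_mult[OF \<open>unit_in S u\<close>] prime_products.unit by blast
  next
    case (prime p a)
    then show ?case using prime_products.prime[of S p "u * a"] by (simp add: mult_ac)
  qed
next
  case (prime p a)
  then show ?case using prime_products.prime[of S p "a * b"] by (simp add: mult_ac)
qed

lemma unit_in_cofactor:
  assumes "unit_in S (a * b)" "a \<in> S" "b \<in> S"
  shows "unit_in S a"
  using assms unfolding unit_in_def by (metis mult.assoc mult_closed)

end

locale factorial_subdomain = subdomain +
  assumes factorial: "a \<in> S \<Longrightarrow> a \<noteq> 0 \<Longrightarrow> a \<in> prime_products S"

section \<open>Polynomials with coefficients in a subdomain\<close>

definition polys :: "'a::comm_ring_1 set \<Rightarrow> 'a poly set" where
  "polys S = {p. \<forall>i. coeff p i \<in> S}"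

lemma pCons_in_polys_iff: "pCons a p \<in> polys S \<longleftrightarrow> a \<in> S \<and> p \<in> polys S"
  by (auto simp: polys_def coeff_pCons split: nat.splits)

context subdomain
begin

lemma coeff_closed: "p \<in> polys S \<Longrightarrow> coeff p i \<in> S"
  by (simp add: polys_def)

text \<open>The coefficient type is just a commutative ring, and zero divisors are excluded only
  inside \<open>S\<close>. The product of the leading coefficients is nonzero because both lie in
  \<open>S\<close>.\<close>

lemma polys_mult_nonzero:
  assumes "p \<in> polys S" "q \<in> polys S" "p \<noteq> 0" "q \<noteq> 0"
  shows "p * q \<noteq> 0" "degree (p * q) = degree p + degree q"
    "lead_coeff (p * q) = lead_coeff p * lead_coeff q"
proof -
  have "coeff (p * q) (degree p + degree q) = lead_coeff p * lead_coeff q"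
    by (rule coeff_mult_degree_sum)
  also have "\<dots> \<noteq> 0"
    using no_zero_div[OF coeff_closed coeff_closed] assms by fastforce
  finally have *: "coeff (p * q) (degree p + degree q) \<noteq> 0" .
  then show "p * q \<noteq> 0" by auto
  show d: "degree (p * q) = degree p + degree q"
    using le_degree[OF *] degree_mult_le[of p q] by simp
  then show "lead_coeff (p * q) = lead_coeff p * lead_coeff q"
    by (simp add: coeff_mult_degree_sum)
qed

lemma monom_polys: "c \<in> S \<Longrightarrow> monom c n \<in> polys S"
  by (auto simp: polys_def zero_closed)

lemma const_polys: "c \<in> S \<Longrightarrow> [:c:] \<in> polys S"
  using monom_polys[of c 0] by (simp add: monom_0)

lemma subdomain_polys: "subdomain (polys S)"
proof
  show "1 \<in> polys S" using const_polys[OF one_closed] by (simp add: one_pCons)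
  show "a + b \<in> polys S" if "a \<in> polys S" "b \<in> polys S" for a b
    using that by (simp add: polys_def add_closed)
  show "- a \<in> polys S" if "a \<in> polys S" for a
    using that by (simp add: polys_def uminus_closed)
  show "a * b \<in> polys S" if "a \<in> polys S" "b \<in> polys S" for a b
    using that by (auto simp: polys_def coeff_mult intro!: sum_closed mult_closed)
  show "a = 0 \<or> b = 0" if "a \<in> polys S" "b \<in> polys S" "a * b = 0" for a b
    using that polys_mult_nonzero by blast
qed

end

section \<open>Constant polynomials, pseudo-division and Bezout identities\<close>

context subdomain
begin

interpretation poly: subdomain "polys S"
  by (rule subdomain_polys)

lemma dvd_in_const_polys:
  assumes "c \<in> S"
  shows "dvd_in (polys S) [:c:] p \<longleftrightarrow> (\<forall>i. dvd_in S c (coeff p i))"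
proof
  assume "dvd_in (polys S) [:c:] p"
  then show "\<forall>i. dvd_in S c (coeff p i)"
    by (auto simp: dvd_in_def polys_def)
next
  assume "\<forall>i. dvd_in S c (coeff p i)"
  then obtain d where d: "\<And>i. d i \<in> S" "\<And>i. coeff p i = c * d i"
    unfolding dvd_in_def by metis
  define q where "q = (\<Sum>i\<le>degree p. monom (d i) i)"
  have "[:c:] * q = (\<Sum>i\<le>degree p. monom (coeff p i) i)"
    by (simp add: q_def sum_distrib_left d(2) smult_monom)
  also have "\<dots> = p" by (rule poly_as_sum_of_monoms)
  finally have "p = [:c:] * q" ..
  moreover have "q \<in> polys S"
    unfolding q_def by (intro poly.sum_closed monom_polys d)
  ultimately show "dvd_in (polys S) [:c:] p" unfolding dvd_in_def by blast
qed

lemma unit_in_const_polys: "unit_in (polys S) [:c:] \<longleftrightarrow> unit_in S c"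
proof
  assume "unit_in S c"
  then show "unit_in (polys S) [:c:]"
    unfolding unit_in_def
  proof (elim conjE bexE, intro conjI)
    fix d assume "c \<in> S" "d \<in> S" "c * d = 1"
    then show "[:c:] \<in> polys S" "\<exists>c'\<in>polys S. [:c:] * c' = 1"
      using const_polys by (auto intro!: bexI[of _ "[:d:]"] simp: one_pCons)
  qed
next
  assume "unit_in (polys S) [:c:]"
  then obtain q where q: "[:c:] \<in> polys S" "q \<in> polys S" "[:c:] * q = 1"
    by (auto simp: unit_in_def)
  have "c * coeff q 0 = 1" using arg_cong[OF q(3), of "\<lambda>p. coeff p 0"] by simp
  then show "unit_in S c"
    using q(1,2) coeff_closed[OF q(1), of 0] coeff_closed[OF q(2), of 0] by (auto simp: unit_in_def)
qed

lemma unit_in_polys_degree: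
  assumes "unit_in (polys S) u"
  shows "degree u = 0"
proof -
  obtain q where q: "u \<in> polys S" "q \<in> polys S" "u * q = 1"
    using assms by (auto simp: unit_in_def)
  have "(1::'a) \<noteq> 0 \<or> u = 0"
  proof (cases "(1::'a) = 0")
    case True
    have "coeff u i = 0" for i using True by (metis mult_1_right mult_zero_right)
    then show ?thesis by (simp add: poly_eq_iff)
  qed simp
  then show ?thesis
    using polys_mult_nonzero(2)[OF q(1,2)] q(3) by (cases "u = 0 \<or> q = 0") auto
qed

text \<open>Gauss's argument: let \<open>i\<close> and \<open>j\<close> be the first indices at
  which \<open>p\<close> does not divide the coefficient of \<open>f\<close> and of
  \<open>g\<close>. The coefficient of \<open>f * g\<close> at \<open>i + j\<close> is the product
  of these two coefficients plus multiples of \<open>p\<close>.\<close>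

lemma prime_in_const_polys:
  assumes "prime_in S p"
  shows "prime_in (polys S) [:p:]"
proof -
  have p: "p \<in> S" "p \<noteq> 0" "\<not> unit_in S p"
    and prime: "\<And>a b. a \<in> S \<Longrightarrow> b \<in> S \<Longrightarrow> dvd_in S p (a * b) \<Longrightarrow> dvd_in S p a \<or> dvd_in S p b"
    using assms by (auto simp: prime_in_def)
  have "dvd_in (polys S) [:p:] f \<or> dvd_in (polys S) [:p:] g"
    if fg: "f \<in> polys S" "g \<in> polys S" "dvd_in (polys S) [:p:] (f * g)" for f g
  proof (rule ccontr)
    assume neg: "\<not> (dvd_in (polys S) [:p:] f \<or> dvd_in (polys S) [:p:] g)"
    define i where "i = (LEAST i. \<not> dvd_in S p (coeff f i))"
    define j where "j = (LEAST j. \<not> dvd_in S p (coeff g j))"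
    have ex: "\<exists>i. \<not> dvd_in S p (coeff f i)" "\<exists>j. \<not> dvd_in S p (coeff g j)"
      using neg dvd_in_const_polys[OF p(1)] by auto
    have i: "\<not> dvd_in S p (coeff f i)" "\<And>k. k < i \<Longrightarrow> dvd_in S p (coeff f k)"
      unfolding i_def using LeastI_ex[OF ex(1)] not_less_Least by blast+
    have j: "\<not> dvd_in S p (coeff g j)" "\<And>k. k < j \<Longrightarrow> dvd_in S p (coeff g k)"
      unfolding j_def using LeastI_ex[OF ex(2)] not_less_Least by blast+
    have "coeff (f * g) (i + j) = (\<Sum>k\<le>i+j. coeff f k * coeff g (i + j - k))"
      by (simp add: coeff_mult)
    also have "\<dots> = coeff f i * coeff g j + (\<Sum>k\<in>{..i+j}-{i}. coeff f k * coeff g (i + j - k))"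
      by (subst sum.remove[of _ i]) auto
    finally have *: "coeff f i * coeff g j = coeff (f * g) (i + j)
        + - (\<Sum>k\<in>{..i+j}-{i}. coeff f k * coeff g (i + j - k))" by simp
    have neg_dvd: "dvd_in S p (- a)" if "dvd_in S p a" for a
      using that dvd_in_mult[of p a "- 1"] one_closed uminus_closed by simp
    have sum: "dvd_in S p (\<Sum>k\<in>K. a k)" if "\<And>k. k \<in> K \<Longrightarrow> dvd_in S p (a k)" for K and a :: "nat \<Rightarrow> 'a"
      using that by (induction K rule: infinite_finite_induct) (auto intro: dvd_in_zero dvd_in_add)
    have "dvd_in S p (\<Sum>k\<in>{..i+j}-{i}. coeff f k * coeff g (i + j - k))"
    proof (rule sum)
      fix k assume k: "k \<in> {..i+j}-{i}"
      show "dvd_in S p (coeff f k * coeff g (i + j - k))"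
      proof (cases "k < i")
        case True then show ?thesis using i(2) dvd_in_mult coeff_closed fg by blast
      next
        case False
        then have "i + j - k < j" using k by auto
        then show ?thesis using j(2) dvd_in_mult_left coeff_closed fg by blast
      qed
    qed
    moreover have "dvd_in S p (coeff (f * g) (i + j))"
      using fg(3) dvd_in_const_polys[OF p(1)] by blast
    ultimately have "dvd_in S p (coeff f i * coeff g j)"
      unfolding * by (intro dvd_in_add neg_dvd)
    then show False using prime[OF coeff_closed[OF fg(1)] coeff_closed[OF fg(2)]] i(1) j(1) by blast
  qed
  moreover have "[:p:] \<in> polys S" using p const_polys by blast
  ultimately show ?thesis
    unfolding prime_in_def using p unit_in_const_polys[of p] by auto
qed

text \<open>Pseudo-division: the leading coefficient of \<open>r\<close> need not be invertible, so
  \<open>y\<close> is multiplied by it before its top term is cancelled. The remainder stays in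
  \<open>J\<close>, and minimality of \<open>degree r\<close> allows the process to stop only at 0.
  The constant \<open>c\<close> collects the multipliers.\<close>

lemma least_degree_pseudo_dvd:
  assumes J: "\<And>a b. a \<in> J \<Longrightarrow> b \<in> J \<Longrightarrow> a - b \<in> J" "\<And>a b. a \<in> J \<Longrightarrow> b \<in> polys S \<Longrightarrow> b * a \<in> J"
    and JS: "J \<subseteq> polys S"
    and r: "r \<in> J" "r \<noteq> 0" "\<And>a. a \<in> J \<Longrightarrow> a \<noteq> 0 \<Longrightarrow> degree r \<le> degree a"
    and y: "y \<in> J"
  shows "\<exists>c\<in>S. c \<noteq> 0 \<and> dvd_in (polys S) r ([:c:] * y)"
  using y
proof (induction "degree y" arbitrary: y rule: less_induct)
  case less
  have rS: "r \<in> polys S" and yS: "y \<in> polys S" using r(1) less.prems JS by auto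
  have lr: "lead_coeff r \<noteq> 0" "lead_coeff r \<in> S" using r(2) rS by (auto simp: coeff_closed)
  show ?case
  proof (cases "y = 0")
    case True
    then show ?thesis
      using lr poly.dvd_in_zero by (intro bexI[of _ "lead_coeff r"]) auto
  next
    case False
    have deg: "degree r \<le> degree y" using r(3) less.prems False by blast
    define t where "t = monom (lead_coeff y) (degree y - degree r)"
    have tS: "t \<in> polys S" unfolding t_def by (intro monom_polys coeff_closed yS)
    define y' where "y' = [:lead_coeff r:] * y - t * r"
    have ly: "lead_coeff y \<noteq> 0" "lead_coeff y \<in> S" using False yS by (auto simp: coeff_closed)
    have t0: "t \<noteq> 0" using ly by (simp add: t_def monom_eq_0_iff)
    have y'J: "y' \<in> J" unfolding y'_def
      using J(1) J(2) const_polys[OF lr(2)] tS r(1) less.prems by blast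
    have "degree ([:lead_coeff r:] * y) = degree y"
      using polys_mult_nonzero(2)[OF const_polys[OF lr(2)] yS] lr False by simp
    moreover have dt: "degree (t * r) = degree y"
      using polys_mult_nonzero(2)[OF tS rS t0 r(2)] deg ly by (simp add: t_def degree_monom_eq)
    ultimately have "degree y' \<le> degree y"
      unfolding y'_def by (intro degree_diff_le) simp_all
    have "lead_coeff (t * r) = lead_coeff y * lead_coeff r"
      using polys_mult_nonzero(3)[OF tS rS t0 r(2)] ly by (simp add: t_def degree_monom_eq)
    then have "coeff (t * r) (degree y) = lead_coeff y * lead_coeff r" by (simp only: dt)
    then have c0: "coeff y' (degree y) = 0"
      unfolding y'_def by (simp add: mult.commute)
    have "y' = 0 \<or> degree y' < degree y"
      using \<open>degree y' \<le> degree y\<close> c0 by (metis leading_coeff_0_iff le_neq_implies_less)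
    then have "\<exists>c\<in>S. c \<noteq> 0 \<and> dvd_in (polys S) r ([:c:] * y')"
    proof
      assume "y' = 0"
      then show ?thesis
        using lr poly.dvd_in_zero by (intro bexI[of _ "lead_coeff r"]) auto
    qed (use less.hyps y'J in blast)
    then obtain c where c: "c \<in> S" "c \<noteq> 0" "dvd_in (polys S) r ([:c:] * y')" by blast
    have cl: "c * lead_coeff r \<in> S" "c * lead_coeff r \<noteq> 0"
      using c lr mult_closed no_zero_div by blast+
    have "[:c * lead_coeff r:] * y = [:c:] * y' + ([:c:] * t) * r"
      unfolding y'_def by (simp add: algebra_simps smult_diff_right)
    moreover have "dvd_in (polys S) r (([:c:] * t) * r)"
      using poly.dvd_in_mult_left[OF poly.dvd_in_self] poly.mult_closed[OF const_polys[OF c(1)] tS]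
      by blast
    ultimately have "dvd_in (polys S) r ([:c * lead_coeff r:] * y)"
      using c(3) poly.dvd_in_add by metis
    then show ?thesis using cl by blast
  qed
qed

text \<open>Here \<open>r\<close> is a gcd of \<open>f\<close> and \<open>g\<close> over the
  fraction field with denominators cleared: an element of least degree in the ideal generated by
  \<open>f\<close> and \<open>g\<close>. The last two conclusions say that it is a common divisor up
  to constants.\<close>

lemma bezout_least_degree:
  assumes "f \<in> polys S" "g \<in> polys S" "f \<noteq> 0"
  obtains r u v where "u \<in> polys S" "v \<in> polys S" "r \<noteq> 0" "r = u * f + v * g"
    "\<exists>c\<in>S. c \<noteq> 0 \<and> dvd_in (polys S) r ([:c:] * f)"
    "\<exists>c\<in>S. c \<noteq> 0 \<and> dvd_in (polys S) r ([:c:] * g)"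
proof -
  define J where "J = {u * f + v * g | u v. u \<in> polys S \<and> v \<in> polys S}"
  have J1: "a - b \<in> J" if "a \<in> J" "b \<in> J" for a b
  proof -
    obtain u v where "a = u * f + v * g" and cl: "u \<in> polys S" "v \<in> polys S"
      using \<open>a \<in> J\<close> unfolding J_def by blast
    moreover obtain u' v' where "b = u' * f + v' * g" and cl': "u' \<in> polys S" "v' \<in> polys S"
      using \<open>b \<in> J\<close> unfolding J_def by blast
    ultimately have "a - b = (u - u') * f + (v - v') * g" by (simp add: algebra_simps)
    then show ?thesis unfolding J_def using cl cl' poly.diff_closed by blast
  qed
  have J2: "b * a \<in> J" if "a \<in> J" "b \<in> polys S" for a b
  proof -
    obtain u v where "a = u * f + v * g" and cl: "u \<in> polys S" "v \<in> polys S"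
      using \<open>a \<in> J\<close> unfolding J_def by blast
    then have "b * a = (b * u) * f + (b * v) * g" by (simp add: algebra_simps)
    then show ?thesis unfolding J_def using cl that poly.mult_closed by blast
  qed
  have JS: "J \<subseteq> polys S"
    unfolding J_def using assms poly.add_closed poly.mult_closed by auto
  have "f = 1 * f + 0 * g" "g = 0 * f + 1 * g" by auto
  then have fJ: "f \<in> J" and gJ: "g \<in> J"
    unfolding J_def using poly.one_closed poly.zero_closed by blast+
  define r where "r = arg_min degree (\<lambda>a. a \<in> J \<and> a \<noteq> 0)"
  have r: "r \<in> J" "r \<noteq> 0" "\<And>a. a \<in> J \<Longrightarrow> a \<noteq> 0 \<Longrightarrow> degree r \<le> degree a"
    unfolding r_def
    using arg_min_nat_lemma[of "\<lambda>a. a \<in> J \<and> a \<noteq> 0" f degree] fJ assms(3) by auto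
  have *: "\<exists>c\<in>S. c \<noteq> 0 \<and> dvd_in (polys S) r ([:c:] * y)" if "y \<in> J" for y
    by (rule least_degree_pseudo_dvd[of J]) (use J1 J2 JS r that in blast)+
  obtain u v where "r = u * f + v * g" "u \<in> polys S" "v \<in> polys S"
    using r(1) unfolding J_def by blast
  then show thesis using that[of u v r] r(2) *[OF fJ] *[OF gJ] by blast
qed

text \<open>Bezout over the fraction field, with denominators cleared.\<close>
lemma bezout_constant:
  assumes q: "q \<in> polys S" "degree q > 0"
    and prime: "\<And>a b. a \<in> polys S \<Longrightarrow> b \<in> polys S \<Longrightarrow> dvd_in (polys S) q (a * b) \<Longrightarrow>
      dvd_in (polys S) q a \<or> dvd_in (polys S) q b"
    and p: "p \<in> polys S" "\<not> dvd_in (polys S) q p"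
  obtains u v c where "u \<in> polys S" "v \<in> polys S" "c \<in> S" "c \<noteq> 0" "u * q + v * p = [:c:]"
proof -
  have q0: "q \<noteq> 0" using q by auto
  obtain r u v where r: "u \<in> polys S" "v \<in> polys S" "r \<noteq> 0" "r = u * q + v * p"
    "\<exists>c\<in>S. c \<noteq> 0 \<and> dvd_in (polys S) r ([:c:] * q)"
    "\<exists>c\<in>S. c \<noteq> 0 \<and> dvd_in (polys S) r ([:c:] * p)"
    using bezout_least_degree[OF q(1) p(1) q0] by metis
  have rS: "r \<in> polys S" using r q p poly.add_closed poly.mult_closed by blast
  have ndvd: "\<not> dvd_in (polys S) q [:c:]" if "c \<in> S" "c \<noteq> 0" for c
  proof
    assume "dvd_in (polys S) q [:c:]"
    then obtain w where w: "w \<in> polys S" "[:c:] = q * w" by (auto simp: dvd_in_def)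
    then show False using polys_mult_nonzero(2)[OF q(1) w(1) q0] q(2) that
      by (cases "w = 0") (auto dest: arg_cong[of _ _ degree])
  qed
  have "\<not> dvd_in (polys S) q r"
  proof
    assume *: "dvd_in (polys S) q r"
    obtain c where c: "c \<in> S" "c \<noteq> 0" "dvd_in (polys S) r ([:c:] * p)" using r(6) by blast
    from poly.dvd_in_trans[OF * this(3)] show False
      using prime[OF const_polys[OF c(1)] p(1)] ndvd[OF c(1,2)] p(2) by blast
  qed
  \<comment> \<open>From \<open>[:c:] * q = r * w\<close> and \<open>q\<close> not dividing
    \<open>r\<close>, primality gives that \<open>q\<close> divides \<open>w\<close>. Cancelling
    \<open>q\<close> leaves \<open>r\<close> as a divisor of the nonzero constant \<open>c\<close>,
    so \<open>r\<close> itself is constant.\<close>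
  obtain c w where c: "c \<in> S" "c \<noteq> 0" "w \<in> polys S" "[:c:] * q = r * w"
    using r(5) by (auto simp: dvd_in_def)
  have "dvd_in (polys S) q (r * w)"
    unfolding c(4)[symmetric] using poly.dvd_in_mult_left[OF poly.dvd_in_self const_polys[OF c(1)]] .
  then have "dvd_in (polys S) q w"
    using prime[OF rS c(3)] \<open>\<not> dvd_in (polys S) q r\<close> by blast
  then obtain w' where w': "w' \<in> polys S" "w = q * w'" by (auto simp: dvd_in_def)
  have "q * [:c:] = q * (r * w')" using c(4) w'(2) by (simp add: mult_ac)
  then have "[:c:] = r * w'"
    using poly.cancel_left[OF q(1) const_polys[OF c(1)] poly.mult_closed[OF rS w'(1)] q0] by blast
  then have "degree r = 0"
    using polys_mult_nonzero(2)[OF rS w'(1) r(3)] c(2)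
    by (cases "w' = 0") (auto dest: arg_cong[of _ _ degree])
  then obtain d where d: "r = [:d:]" using degree_eq_zeroE by blast
  then have "d \<in> S" using coeff_closed[OF rS, of 0] by simp
  moreover have "d \<noteq> 0" using d r(3) by auto
  moreover have "u * q + v * p = [:d:]" using d r(4) by simp
  ultimately show thesis using that[of u v d] r(1,2) by blast
qed

end

section \<open>Gauss's lemma over a factorial carrier\<close>

context factorial_subdomain
begin

interpretation poly: subdomain "polys S"
  by (rule subdomain_polys)

text \<open>This is the way back from the fraction field: each prime factor of \<open>c\<close>
  stays prime as a constant polynomial, hence divides \<open>a\<close> or \<open>b\<close>, and can
  be cancelled there.\<close>

lemma cancel_constant:
  assumes "c \<in> S" "c \<noteq> 0" "f \<in> polys S" "a \<in> polys S" "b \<in> polys S" "[:c:] * f = a * b"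
  obtains a' b' c1 c2 where "a' \<in> polys S" "b' \<in> polys S" "c1 \<in> S" "c2 \<in> S"
    "f = a' * b'" "a = [:c1:] * a'" "b = [:c2:] * b'"
proof -
  have "\<exists>a' b' c1 c2. a' \<in> polys S \<and> b' \<in> polys S \<and> c1 \<in> S \<and> c2 \<in> S \<and>
    f = a' * b' \<and> a = [:c1:] * a' \<and> b = [:c2:] * b'"
    using factorial[OF assms(1,2)] assms(4-6)
  proof (induction c arbitrary: a b rule: prime_products.induct)
    case (unit u)
    then obtain v where v: "u \<in> S" "v \<in> S" "u * v = 1" by (auto simp: unit_in_def)
    have "f = [:v:] * ([:u:] * f)" using v by (simp add: mult.commute)
    also have "\<dots> = ([:v:] * a) * b" using unit.prems by (simp add: mult_ac)
    finally have "f = ([:v:] * a) * b" .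
    moreover have "a = [:u * v:] * a" using v by simp
    then have "a = [:u:] * ([:v:] * a)" by (simp add: mult.commute)
    moreover have "b = [:1:] * b" by simp
    ultimately show ?case
      using v one_closed unit.prems poly.mult_closed[OF const_polys[OF v(2)]] by blast
  next
    case (prime p d)
    have p: "p \<in> S" "p \<noteq> 0" using prime.hyps by (auto simp: prime_in_def)
    have d: "d \<in> S" using prime.hyps prime_products_closed by blast
    have eq: "[:p:] * ([:d:] * f) = a * b" using prime.prems by (simp add: mult_ac)
    have df: "[:d:] * f \<in> polys S" using const_polys[OF d] assms poly.mult_closed by blast
    have "dvd_in (polys S) [:p:] (a * b)" unfolding dvd_in_def using eq df by metis
    then consider "dvd_in (polys S) [:p:] a" | "dvd_in (polys S) [:p:] b"
      using prime_in_const_polys[OF prime.hyps(1)] prime.prems unfolding prime_in_def by blast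
    then show ?case
    proof cases
      case 1
      then obtain a1 where a1: "a1 \<in> polys S" "a = [:p:] * a1" by (auto simp: dvd_in_def)
      then have "[:p:] * ([:d:] * f) = [:p:] * (a1 * b)" using eq by (simp add: mult_ac)
      then have "[:d:] * f = a1 * b"
        using poly.cancel_left[OF const_polys[OF p(1)] df poly.mult_closed[OF a1(1) prime.prems(2)]] p(2) by simp
      then obtain a' b' c1 c2 where *: "a' \<in> polys S" "b' \<in> polys S" "c1 \<in> S" "c2 \<in> S"
        "f = a' * b'" "a1 = [:c1:] * a'" "b = [:c2:] * b'"
        using prime.IH[OF a1(1) prime.prems(2)] by blast
      have "a = [:p * c1:] * a'" using a1(2) *(6) by (simp add: mult.commute)
      then show ?thesis using * mult_closed[OF p(1) *(3)] by blast
    next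
      case 2
      then obtain b1 where b1: "b1 \<in> polys S" "b = [:p:] * b1" by (auto simp: dvd_in_def)
      then have "[:p:] * ([:d:] * f) = [:p:] * (a * b1)" using eq by (simp add: mult_ac)
      then have "[:d:] * f = a * b1"
        using poly.cancel_left[OF const_polys[OF p(1)] df poly.mult_closed[OF prime.prems(1) b1(1)]] p(2) by simp
      then obtain a' b' c1 c2 where *: "a' \<in> polys S" "b' \<in> polys S" "c1 \<in> S" "c2 \<in> S"
        "f = a' * b'" "a = [:c1:] * a'" "b1 = [:c2:] * b'"
        using prime.IH[OF prime.prems(1) b1(1)] by blast
      have "b = [:p * c2:] * b'" using b1(2) *(7) by (simp add: mult.commute)
      then show ?thesis using * mult_closed[OF p(1) *(4)] by blast
    qed
  qed
  then show thesis using that by blast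
qed

text \<open>Let \<open>r\<close> be the gcd of \<open>f\<close> and \<open>a\<close> over the
  fraction field. The relation \<open>[:c:] * f = r * w\<close> descends to a true factorization of
  \<open>f\<close>, one factor of which is constant. Either \<open>f\<close> and \<open>a\<close>
  are coprime up to constants, and then \<open>f\<close> divides \<open>b\<close>, or
  \<open>f\<close> agrees with \<open>r\<close> up to constants, and then it divides
  \<open>a\<close>.\<close>

lemma primitive_irreducible_prime:
  assumes f: "f \<in> polys S" "degree f > 0"
    and primitive: "\<And>c g. c \<in> S \<Longrightarrow> g \<in> polys S \<Longrightarrow> f = [:c:] * g \<Longrightarrow> unit_in S c"
    and irred: "\<And>g h. g \<in> polys S \<Longrightarrow> h \<in> polys S \<Longrightarrow> f = g * h \<Longrightarrow> degree g = 0 \<or> degree h = 0"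
  shows "prime_in (polys S) f"
proof -
  have f0: "f \<noteq> 0" using f by auto
  have "dvd_in (polys S) f a \<or> dvd_in (polys S) f b"
    if a: "a \<in> polys S" and b: "b \<in> polys S" and ab: "dvd_in (polys S) f (a * b)" for a b
  proof -
    obtain r u v where r: "u \<in> polys S" "v \<in> polys S" "r \<noteq> 0" "r = u * f + v * a"
      "\<exists>c\<in>S. c \<noteq> 0 \<and> dvd_in (polys S) r ([:c:] * f)"
      "\<exists>c\<in>S. c \<noteq> 0 \<and> dvd_in (polys S) r ([:c:] * a)"
      using bezout_least_degree[OF f(1) a f0] by metis
    have rS: "r \<in> polys S" using r f a poly.add_closed poly.mult_closed by blast
    obtain c w where cw: "c \<in> S" "c \<noteq> 0" "w \<in> polys S" "[:c:] * f = r * w"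
      using r(5) by (auto simp: dvd_in_def)
    obtain r' w' c1 c2 where r': "r' \<in> polys S" "w' \<in> polys S" "c1 \<in> S" "c2 \<in> S"
      "f = r' * w'" "r = [:c1:] * r'" "w = [:c2:] * w'"
      using cancel_constant[OF cw(1,2) f(1) rS cw(3,4)] by metis
    from irred[OF r'(1,2,5)] show ?thesis
    proof
      assume "degree r' = 0"
      then obtain d where "r' = [:d:]" using degree_eq_zeroE by blast
      then obtain e where e: "r = [:e:]" using r'(6) by simp
      have eS: "e \<in> S" "e \<noteq> 0" using coeff_closed[OF rS, of 0] e r(3) by auto
      \<comment> \<open>The Bezout identity multiplied by \<open>b\<close>: both terms on the right
        are divisible by \<open>f\<close>, so \<open>f\<close> divides \<open>b\<close> up to the
        constant \<open>e\<close>. Cancelling \<open>e\<close> moves a constant \<open>d1\<close>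
        into \<open>f\<close>, which primitivity turns into a unit.\<close>
      have "[:e:] * b = (u * b) * f + v * (a * b)"
        using r(4) e by (metis (no_types, lifting) distrib_right mult.assoc mult.commute)
      then have "dvd_in (polys S) f ([:e:] * b)"
        using poly.dvd_in_add[OF poly.dvd_in_mult_left[OF poly.dvd_in_self poly.mult_closed[OF r(1) b]]
            poly.dvd_in_mult_left[OF ab r(2)]] by simp
      then obtain x where x: "x \<in> polys S" "[:e:] * b = f * x" by (auto simp: dvd_in_def)
      obtain f' x' d1 d2 where f': "f' \<in> polys S" "x' \<in> polys S" "d1 \<in> S" "d2 \<in> S"
        "b = f' * x'" "f = [:d1:] * f'" "x = [:d2:] * x'"
        using cancel_constant[OF eS b f(1) x] by metis
      obtain i where i: "i \<in> S" "d1 * i = 1"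
        using primitive[OF f'(3,1,6)] by (auto simp: unit_in_def)
      have "f * ([:i:] * x') = [:d1 * i:] * (f' * x')" unfolding f'(6) by (simp add: mult_ac)
      then have "b = f * ([:i:] * x')" using i f'(5) by simp
      then show ?thesis
        unfolding dvd_in_def using poly.mult_closed[OF const_polys[OF i(1)] f'(2)] by blast
    next
      assume "degree w' = 0"
      then obtain d where d: "w' = [:d:]" using degree_eq_zeroE by blast
      obtain e x where x: "e \<in> S" "e \<noteq> 0" "x \<in> polys S" "[:e:] * a = r * x"
        using r(6) by (auto simp: dvd_in_def)
      have dS: "d \<in> S" using coeff_closed[OF r'(2), of 0] d by simp
      have c1x: "[:c1:] * x \<in> polys S" using const_polys[OF r'(3)] x poly.mult_closed by blast
      \<comment> \<open>Since \<open>w'\<close> is constant, \<open>f\<close> is a constant times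
        \<open>r'\<close>. Dividing \<open>a\<close> by \<open>r'\<close> after cancelling
        \<open>e\<close> therefore divides it by \<open>f\<close> up to a constant factor of
        \<open>f\<close>, again a unit.\<close>
      have "[:e:] * a = r' * ([:c1:] * x)" using x(4) r'(6) by (simp add: mult_ac)
      then obtain r'' x' d1 d2 where r'': "r'' \<in> polys S" "x' \<in> polys S" "d1 \<in> S" "d2 \<in> S"
        "a = r'' * x'" "r' = [:d1:] * r''" "[:c1:] * x = [:d2:] * x'"
        using cancel_constant[OF x(1,2) a r'(1) c1x] by metis
      have f2: "f = [:d * d1:] * r''" using r'(5) d r''(6) by (simp add: mult_ac)
      then obtain i where i: "i \<in> S" "d * d1 * i = 1"
        using primitive[OF mult_closed[OF dS r''(3)] r''(1)] by (auto simp: unit_in_def)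
      have "f * ([:i:] * x') = [:d * d1 * i:] * (r'' * x')" unfolding f2 by (simp add: mult_ac)
      then have "a = f * ([:i:] * x')" using i r''(5) by simp
      then show ?thesis
        unfolding dvd_in_def using poly.mult_closed[OF const_polys[OF i(1)] r''(2)] by blast
    qed
  qed
  then show ?thesis
    unfolding prime_in_def using f f0 unit_in_polys_degree[of f] by auto
qed

lemma const_prime_products:
  "c \<in> prime_products S \<Longrightarrow> [:c:] \<in> prime_products (polys S)"
proof (induction rule: prime_products.induct)
  case (unit u)
  then show ?case using unit_in_const_polys prime_products.unit by blast
next
  case (prime p a)
  then show ?case
    using prime_products.prime[OF prime_in_const_polys[OF prime.hyps(1)], of "[:a:]"]
    by (simp add: mult.commute)
qed

text \<open>Induction on a common multiple of all constant divisors of \<open>f\<close>, such as its leading coefficient.\<close>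
lemma primitive_part_aux:
  assumes "c \<in> prime_products S" "f \<in> polys S" "f \<noteq> 0"
    and "\<And>d h. d \<in> S \<Longrightarrow> h \<in> polys S \<Longrightarrow> f = [:d:] * h \<Longrightarrow> dvd_in S d c"
  shows "\<exists>d\<in>S. d \<noteq> 0 \<and> (\<exists>g\<in>polys S. f = [:d:] * g \<and>
    (\<forall>d\<in>S. \<forall>h\<in>polys S. g = [:d:] * h \<longrightarrow> unit_in S d))"
  using assms
proof (induction c arbitrary: f rule: prime_products.induct)
  case (unit u)
  have "unit_in S d" if "d \<in> S" "h \<in> polys S" "f = [:d:] * h" for d h
    using unit.prems(3)[OF that] unit.hyps unit_in_cofactor[of d] that(1) unfolding dvd_in_def by blast
  moreover have "(1::'a) \<noteq> 0"
    using unit.prems(2) mult_1_left[of "lead_coeff f"] by (metis mult_zero_left leading_coeff_0_iff)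
  moreover have "f = [:1:] * f" by simp
  ultimately show ?case using unit.prems(1) one_closed by blast
next
  case (prime p a)
  have p: "p \<in> S" "p \<noteq> 0"
    and prime_p: "\<And>a b. a \<in> S \<Longrightarrow> b \<in> S \<Longrightarrow> dvd_in S p (a * b) \<Longrightarrow> dvd_in S p a \<or> dvd_in S p b"
    using prime.hyps(1) by (auto simp: prime_in_def)
  have a: "a \<in> S" using prime.hyps(2) by (rule prime_products_closed)
  show ?case
  proof (cases "dvd_in (polys S) [:p:] f")
    case True
    then obtain h where h: "h \<in> polys S" "f = [:p:] * h" by (auto simp: dvd_in_def)
    have "dvd_in S d a" if d: "d \<in> S" "k \<in> polys S" "h = [:d:] * k" for d k
    proof -
      have "f = [:p * d:] * k" using h(2) d(3) by (simp add: mult.commute)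
      from prime.prems(3)[OF mult_closed[OF p(1) d(1)] d(2) this]
      obtain x where x: "x \<in> S" "p * a = p * (d * x)" by (auto simp: dvd_in_def mult.assoc)
      then have "a = d * x" using cancel_left[OF p(1) a mult_closed[OF d(1) x(1)] p(2)] by blast
      then show ?thesis using x(1) by (auto simp: dvd_in_def)
    qed
    moreover have "h \<noteq> 0" using h prime.prems(2) by auto
    ultimately obtain d g where g: "d \<in> S" "d \<noteq> 0" "g \<in> polys S" "h = [:d:] * g"
      "\<forall>d\<in>S. \<forall>h\<in>polys S. g = [:d:] * h \<longrightarrow> unit_in S d"
      using prime.IH[OF h(1)] by blast
    have "p * d \<in> S" "p * d \<noteq> 0" using g p mult_closed no_zero_div by blast+
    moreover have "f = [:p * d:] * g" using g h by (simp add: mult.commute)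
    ultimately show ?thesis using g by blast
  next
    case False
    have "dvd_in S d a" if d: "d \<in> S" "h \<in> polys S" "f = [:d:] * h" for d h
    proof -
      obtain x where x: "x \<in> S" "p * a = d * x" using prime.prems(3)[OF d] by (auto simp: dvd_in_def)
      have "\<not> dvd_in S p d"
      proof
        assume "dvd_in S p d"
        then obtain y where "y \<in> S" "d = p * y" by (auto simp: dvd_in_def)
        then have "f = [:p:] * ([:y:] * h)" "[:y:] * h \<in> polys S"
          using d(3) poly.mult_closed[OF const_polys d(2)] by (simp_all add: mult.commute)
        then show False using False unfolding dvd_in_def by blast
      qed
      moreover have "dvd_in S p (d * x)" using x(2) a unfolding dvd_in_def by metis
      ultimately obtain y where y: "y \<in> S" "x = p * y"
        using prime_p[OF d(1) x(1)] by (auto simp: dvd_in_def)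
      have "p * a = p * (d * y)" using x(2) y(2) by (simp add: mult_ac)
      then have "a = d * y" using cancel_left[OF p(1) a mult_closed[OF d(1) y(1)] p(2)] by blast
      then show ?thesis using y(1) by (auto simp: dvd_in_def)
    qed
    then show ?thesis using prime.IH[OF prime.prems(1,2)] by blast
  qed
qed

lemma primitive_part:
  assumes "f \<in> polys S" "f \<noteq> 0"
  obtains c g where "c \<in> S" "c \<noteq> 0" "g \<in> polys S" "f = [:c:] * g"
    "\<And>d h. d \<in> S \<Longrightarrow> h \<in> polys S \<Longrightarrow> g = [:d:] * h \<Longrightarrow> unit_in S d"
proof -
  have "lead_coeff f \<in> prime_products S"
    using assms factorial[OF coeff_closed[OF assms(1)], of "degree f"] by simp
  moreover have "dvd_in S d (lead_coeff f)" if "d \<in> S" "h \<in> polys S" "f = [:d:] * h" for d h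
  proof -
    have "lead_coeff f = d * coeff h (degree f)" by (subst that(3)) simp
    then show ?thesis using coeff_closed[OF that(2)] unfolding dvd_in_def by blast
  qed
  ultimately show thesis using primitive_part_aux[OF _ assms] that by blast
qed

text \<open>A primitive part of positive degree either splits into two factors of positive, hence
  smaller, degree or is prime by \<open>primitive_irreducible_prime\<close>; the content factors
  already in \<open>S\<close>.\<close>

theorem factorial_subdomain_polys: "factorial_subdomain (polys S)"
proof
  fix f assume "f \<in> polys S" "f \<noteq> 0"
  then show "f \<in> prime_products (polys S)"
  proof (induction "degree f" arbitrary: f rule: less_induct)
    case less
    obtain c g where g: "c \<in> S" "c \<noteq> 0" "g \<in> polys S" "f = [:c:] * g"
      "\<And>d h. d \<in> S \<Longrightarrow> h \<in> polys S \<Longrightarrow> g = [:d:] * h \<Longrightarrow> unit_in S d"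
      using primitive_part[OF less.prems] by metis
    have g0: "g \<noteq> 0" using g less.prems by auto
    have dg: "degree f = degree g"
      using polys_mult_nonzero(2)[OF const_polys[OF g(1)] g(3)] g g0 by simp
    have "g \<in> prime_products (polys S)"
    proof (cases "degree g = 0")
      case True
      then obtain d where d: "g = [:d:]" using degree_eq_zeroE by blast
      then have "d \<in> S" "d \<noteq> 0" using coeff_closed[OF g(3), of 0] g0 by auto
      then show ?thesis using d const_prime_products factorial by blast
    next
      case False
      show ?thesis
      proof (cases "\<exists>a b. a \<in> polys S \<and> b \<in> polys S \<and> g = a * b \<and> degree a \<noteq> 0 \<and> degree b \<noteq> 0")
        case True
        then obtain a b where ab: "a \<in> polys S" "b \<in> polys S" "g = a * b" "degree a \<noteq> 0" "degree b \<noteq> 0"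
          by blast
        have "a \<noteq> 0" "b \<noteq> 0" using ab by auto
        moreover have "degree g = degree a + degree b"
          using polys_mult_nonzero(2)[OF ab(1,2)] calculation ab(3) by simp
        ultimately have "a \<in> prime_products (polys S)" "b \<in> prime_products (polys S)"
          using less.hyps ab dg by auto
        then show ?thesis using ab(3) poly.prime_products_mult by blast
      next
        case irred: False
        have "prime_in (polys S) g"
          using primitive_irreducible_prime[OF g(3)] False g(5) irred by blast
        then show ?thesis
          using prime_products.prime[of "polys S" g 1] prime_products.unit[OF poly.unit_in_one] by simp
      qed
    qed
    then show ?case
      unfolding g(4) using const_prime_products factorial g poly.prime_products_mult by blast
  qed
qed

end

section \<open>Laurent extensions\<close>

text \<open>The ring \<open>S[x, 1/x]\<close> inside the ambient ring, with \<open>y\<close> in the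
  role of the inverse of \<open>x\<close>; the power of \<open>y\<close> is the denominator.\<close>

definition laurent_extension :: "'a::comm_ring_1 set \<Rightarrow> 'a \<Rightarrow> 'a \<Rightarrow> 'a set" where
  "laurent_extension S x y = {poly p x * y ^ k | p k. p \<in> polys S}"

locale laurent = subdomain +
  fixes x y
  assumes xy: "x * y = 1"
    and transcendental: "p \<in> polys S \<Longrightarrow> poly p x = 0 \<Longrightarrow> p = 0"
begin

interpretation poly: subdomain "polys S"
  by (rule subdomain_polys)

abbreviation L where "L \<equiv> laurent_extension S x y"

lemma xy_power: "x ^ k * y ^ k = 1"
  by (metis power_mult_distrib power_one xy)

lemma laurent_extensionI: "p \<in> polys S \<Longrightarrow> poly p x * y ^ k \<in> L"
  by (auto simp: laurent_extension_def)

lemma poly_in_extension: "p \<in> polys S \<Longrightarrow> poly p x \<in> L"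
  using laurent_extensionI[of p 0] by simp

lemma monom_one_polys: "monom 1 k \<in> polys S"
  by (intro monom_polys one_closed)

lemma x_power_in_extension: "x ^ k \<in> L"
  using poly_in_extension[OF monom_one_polys[of k]] by (simp add: poly_monom)

lemma y_power_in_extension: "y ^ k \<in> L"
  using laurent_extensionI[OF poly.one_closed, of k] by simp

lemma shift_denominator: "poly p x * y ^ k = poly (monom 1 j * p) x * y ^ (k + j)"
proof -
  have "poly (monom 1 j * p) x * y ^ (k + j) = poly p x * y ^ k * (x ^ j * y ^ j)"
    by (simp add: poly_monom power_add mult_ac)
  then show ?thesis by (simp add: xy_power)
qed

lemma const_in_extension: "c \<in> S \<Longrightarrow> c \<in> L"
  using poly_in_extension[OF const_polys] by simp

lemma extension_cancel_y:
  assumes "a * y ^ k = b * y ^ k"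
  shows "a = b"
proof -
  have "a * (x ^ k * y ^ k) = b * (x ^ k * y ^ k)"
    using arg_cong[OF assms, of "\<lambda>t. t * x ^ k"] by (simp add: mult_ac)
  then show ?thesis by (simp add: xy_power)
qed

lemma poly_inject:
  assumes "p \<in> polys S" "q \<in> polys S" "poly p x = poly q x"
  shows "p = q"
  using transcendental[OF poly.diff_closed[OF assms(1,2)]] assms(3) by simp

lemma subdomain_extension: "subdomain L"
proof
  show "1 \<in> L" using poly_in_extension[OF poly.one_closed] by simp
  fix a b assume "a \<in> L" "b \<in> L"
  then obtain p k q l where a: "p \<in> polys S" "a = poly p x * y ^ k"
    and b: "q \<in> polys S" "b = poly q x * y ^ l"
    by (auto simp: laurent_extension_def)
  have "a + b = poly (monom 1 l * p + monom 1 k * q) x * y ^ (k + l)"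
    unfolding a b poly_add distrib_right
    using shift_denominator[of p k l] shift_denominator[of q l k] by (simp add: add.commute)
  moreover have "monom 1 l * p + monom 1 k * q \<in> polys S"
    using a b monom_one_polys poly.add_closed poly.mult_closed by blast
  ultimately show "a + b \<in> L" using laurent_extensionI by metis
  have "a * b = poly (p * q) x * y ^ (k + l)" unfolding a b by (simp add: power_add mult_ac)
  then show "a * b \<in> L" using laurent_extensionI a b poly.mult_closed by metis
  have "- a = poly (- p) x * y ^ k" unfolding a by simp
  then show "- a \<in> L" using laurent_extensionI a poly.uminus_closed by metis
  assume "a * b = 0"
  then have "poly (p * q) x * y ^ (k + l) = 0 * y ^ (k + l)"
    using \<open>a * b = poly (p * q) x * y ^ (k + l)\<close> by simp
  then have "poly (p * q) x = 0" by (rule extension_cancel_y)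
  then have "p * q = 0" using transcendental poly.mult_closed a b by blast
  then have "p = 0 \<or> q = 0" using poly.no_zero_div a b by blast
  then show "a = 0 \<or> b = 0" using a b by auto
qed

interpretation ext: subdomain L
  by (rule subdomain_extension)

lemma unit_in_x_power: "unit_in L (x ^ k)"
  unfolding unit_in_def using x_power_in_extension y_power_in_extension xy_power by blast

lemma unit_in_y_power: "unit_in L (y ^ k)"
  unfolding unit_in_def using x_power_in_extension y_power_in_extension xy_power[of k]
  by (metis mult.commute)

lemma extract_monom:
  assumes "p \<in> polys S" "p \<noteq> 0"
  obtains j q where "q \<in> polys S" "coeff q 0 \<noteq> 0" "p = monom 1 j * q"
proof -
  have "\<exists>j q. q \<in> polys S \<and> coeff q 0 \<noteq> 0 \<and> p = monom 1 j * q"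
    using assms
  proof (induction p)
    case (pCons a p)
    show ?case
    proof (cases "a = 0")
      case False
      then show ?thesis
        using pCons by (intro exI[of _ 0] exI[of _ "pCons a p"]) (auto simp: one_pCons[symmetric] monom_0)
    next
      case True
      have "p \<in> polys S"
        using pCons.prems(1) by (simp_all add: pCons_in_polys_iff)
      moreover have "p \<noteq> 0" using pCons.prems True by auto
      ultimately obtain j q where "q \<in> polys S" "coeff q 0 \<noteq> 0" "p = monom 1 j * q"
        using pCons.IH by blast
      then show ?thesis
        using True by (intro exI[of _ "Suc j"] exI[of _ q]) (auto simp: monom_Suc)
    qed
  qed simp
  then show thesis using that by blast
qed

text \<open>Dividing by the largest power of \<open>x\<close> yields a polynomial with nonzero
  constant coefficient. For such representatives divisibility in \<open>L\<close> and among
  polynomials coincide, by \<open>dvd_in_extension_iff\<close>.\<close>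

lemma extension_normal_form:
  assumes "a \<in> L" "a \<noteq> 0"
  obtains p u where "p \<in> polys S" "coeff p 0 \<noteq> 0" "a = u * poly p x" "unit_in L u"
    "\<exists>j k. u = x ^ j * y ^ k"
proof -
  obtain q k where q: "q \<in> polys S" "a = poly q x * y ^ k"
    using assms(1) by (auto simp: laurent_extension_def)
  have "q \<noteq> 0" using q assms by auto
  then obtain j p where p: "p \<in> polys S" "coeff p 0 \<noteq> 0" "q = monom 1 j * p"
    using extract_monom q by blast
  have "a = (x ^ j * y ^ k) * poly p x" using q p by (simp add: poly_monom mult_ac)
  then show thesis
    using that p ext.unit_in_mult[OF unit_in_x_power unit_in_y_power] by blast
qed

text \<open>Clearing the denominator gives \<open>monom 1 k * a = q * w\<close>. The constant
  coefficient of \<open>q\<close> is nonzero, so that of \<open>w\<close> is 0, and the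
  \<open>k\<close> factors of the variable can be removed from \<open>w\<close> one after the
  other.\<close>

lemma dvd_in_extension_iff:
  assumes q: "q \<in> polys S" "coeff q 0 \<noteq> 0" and a: "a \<in> polys S"
  shows "dvd_in L (poly q x) (poly a x) \<longleftrightarrow> dvd_in (polys S) q a"
proof
  assume "dvd_in (polys S) q a"
  then show "dvd_in L (poly q x) (poly a x)"
    unfolding dvd_in_def using poly_in_extension by auto
next
  assume "dvd_in L (poly q x) (poly a x)"
  then obtain w k where w: "w \<in> polys S" "poly a x = poly q x * (poly w x * y ^ k)"
    unfolding dvd_in_def laurent_extension_def by blast
  have "poly a x * x ^ k = poly q x * poly w x * (x ^ k * y ^ k)" unfolding w(2) by (simp add: mult_ac)
  then have "poly (monom 1 k * a) x = poly (q * w) x" by (simp add: xy_power poly_monom mult.commute)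
  then have "monom 1 k * a = q * w"
    using poly_inject a q w(1) poly.mult_closed monom_one_polys by blast
  then show "dvd_in (polys S) q a" using w(1)
  proof (induction k arbitrary: w)
    case 0
    then show ?case by (auto simp: dvd_in_def monom_0 one_pCons[symmetric])
  next
    case (Suc k)
    obtain c w' where w: "w = pCons c w'" by (cases w)
    have cw: "c \<in> S" "w' \<in> polys S"
      using Suc.prems(2) unfolding w by (simp_all add: pCons_in_polys_iff)
    have "coeff (q * w) 0 = 0"
      using arg_cong[OF Suc.prems(1), of "\<lambda>p. coeff p 0"] by (simp add: monom_Suc)
    then have "coeff q 0 * c = 0" by (simp add: w coeff_mult_0 mult.commute)
    then have "c = 0" using no_zero_div[OF coeff_closed[OF q(1)] cw(1)] q(2) by blast
    then have "pCons 0 (monom 1 k * a) = pCons 0 (q * w')"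
      using Suc.prems(1) by (simp add: w monom_Suc)
    then show ?case using Suc.IH[OF _ cw(2)] by simp
  qed
qed

lemma dvd_in_unit_mult:
  assumes "unit_in L u" "a \<in> L" "b \<in> L"
  shows "dvd_in L a (u * b) \<longleftrightarrow> dvd_in L a b" and "dvd_in L (u * a) b \<longleftrightarrow> dvd_in L a b"
proof -
  obtain v where v: "u \<in> L" "v \<in> L" "u * v = 1" using assms(1) by (auto simp: unit_in_def)
  have vu: "v * (u * c) = c" for c using v(3) by (simp add: mult.assoc[symmetric] mult.commute[of v])
  show "dvd_in L a (u * b) \<longleftrightarrow> dvd_in L a b"
    using ext.dvd_in_mult_left[OF _ v(1), of a b] ext.dvd_in_mult_left[OF _ v(2), of a "u * b"]
    unfolding vu by blast
  have "dvd_in L (u * a) b" if "dvd_in L a b"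
  proof -
    obtain c where c: "c \<in> L" "b = a * c" using \<open>dvd_in L a b\<close> by (auto simp: dvd_in_def)
    have "b = v * (u * (a * c))" using c vu by simp
    then have "b = (u * a) * (v * c)" by (simp add: mult_ac)
    then show ?thesis unfolding dvd_in_def using ext.mult_closed[OF v(2) c(1)] by blast
  qed
  moreover have "dvd_in L a (u * a)"
    using ext.dvd_in_mult_left[OF ext.dvd_in_self v(1)] .
  ultimately show "dvd_in L (u * a) b \<longleftrightarrow> dvd_in L a b"
    using ext.dvd_in_trans by blast
qed

text \<open>Localization at the powers of \<open>x\<close> keeps a prime prime unless it becomes a
  unit. The latter happens when \<open>q\<close> is divisible by the variable.\<close>

lemma prime_in_extension:
  assumes "prime_in (polys S) q"
  shows "unit_in L (poly q x) \<or> prime_in L (poly q x)"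
proof -
  have q: "q \<in> polys S" "q \<noteq> 0" "\<not> unit_in (polys S) q"
    and prime: "\<And>a b. a \<in> polys S \<Longrightarrow> b \<in> polys S \<Longrightarrow> dvd_in (polys S) q (a * b) \<Longrightarrow>
      dvd_in (polys S) q a \<or> dvd_in (polys S) q b"
    using assms by (auto simp: prime_in_def)
  have one: "1 \<in> polys S" by (rule poly.one_closed)
  show ?thesis
  proof (cases "coeff q 0 = 0")
    case True
    then obtain q' where q': "q = pCons 0 q'" by (metis coeff_pCons_0 pCons_cases)
    have q'S: "q' \<in> polys S"
      using q(1) unfolding q' by (simp_all add: pCons_in_polys_iff)
    have X: "monom 1 1 \<in> polys S" by (rule monom_one_polys)
    have qX: "q = monom 1 1 * q'" using q' by (simp add: monom_Suc monom_0 one_pCons)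
    then have "dvd_in (polys S) q (monom 1 1) \<or> dvd_in (polys S) q q'"
      using prime[OF X q'S] poly.dvd_in_self by metis
    then show ?thesis
    proof
      assume "dvd_in (polys S) q (monom 1 1)"
      then obtain c where c: "c \<in> polys S" "monom 1 1 = q * c" by (auto simp: dvd_in_def)
      have "x = poly q x * poly c x" using arg_cong[OF c(2), of "\<lambda>p. poly p x"] by (simp add: poly_monom)
      then have "unit_in L (poly q x)"
        using ext.unit_in_cofactor[of "poly q x" "poly c x"] unit_in_x_power[of 1]
          poly_in_extension q(1) c(1) by simp
      then show ?thesis ..
    next
      \<comment> \<open>As \<open>q\<close> is the variable times \<open>q'\<close>, this would make
        the variable invertible among polynomials; comparing constant coefficients refutes
        it.\<close>
      assume "dvd_in (polys S) q q'"
      then obtain c where c: "c \<in> polys S" "q' = q * c" by (auto simp: dvd_in_def)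
      have "q * (monom 1 1 * c) = monom 1 1 * (q * c)" by (rule mult.left_commute)
      also have "\<dots> = q * 1" using c(2) qX by simp
      finally have "q * (monom 1 1 * c) = q * 1" .
      then have "monom 1 1 * c = 1"
        using poly.cancel_left[OF q(1) one poly.mult_closed[OF X c(1)] q(2)] by simp
      then have "coeff (monom 1 1 * c) 0 = 1" by simp
      then have "(1::'a) = 0" by (simp add: coeff_mult_0)
      then have "(1::'a poly) = 0" by (simp add: one_pCons)
      then have "q = 0" by (metis mult_1_right mult_zero_right)
      then show ?thesis using q(2) by blast
    qed
  next
    case False
    have pq: "poly q x \<in> L" using q poly_in_extension by blast
    have "\<not> unit_in L (poly q x)"
    proof
      assume "unit_in L (poly q x)"
      then obtain c where "c \<in> L" "poly q x * c = 1" unfolding unit_in_def by blast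
      then have "dvd_in L (poly q x) (poly 1 x)"
        unfolding dvd_in_def by (intro bexI[of _ c]) simp_all
      then have "dvd_in (polys S) q 1" using dvd_in_extension_iff[OF q(1) False one] by blast
      then obtain c where "c \<in> polys S" "1 = q * c" unfolding dvd_in_def by blast
      then have "\<exists>c\<in>polys S. q * c = 1" by (intro bexI[of _ c]) (rule sym)
      then show False using q unfolding unit_in_def by blast
    qed
    moreover have "dvd_in L (poly q x) a \<or> dvd_in L (poly q x) b"
      if "a \<in> L" "b \<in> L" "dvd_in L (poly q x) (a * b)" for a b
    proof -
      obtain p k where a: "p \<in> polys S" "a = y ^ k * poly p x"
        using \<open>a \<in> L\<close> unfolding laurent_extension_def mult.commute[of "y ^ _"] by blast
      obtain p' l where b: "p' \<in> polys S" "b = y ^ l * poly p' x"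
        using \<open>b \<in> L\<close> unfolding laurent_extension_def mult.commute[of "y ^ _"] by blast
      have "a * b = y ^ (k + l) * poly (p * p') x" unfolding a b by (simp add: power_add mult_ac)
      then have "dvd_in L (poly q x) (poly (p * p') x)"
        using that(3) dvd_in_unit_mult(1)[OF unit_in_y_power pq
            poly_in_extension[OF poly.mult_closed[OF a(1) b(1)]]] by simp
      then have "dvd_in (polys S) q (p * p')"
        using dvd_in_extension_iff[OF q(1) False poly.mult_closed[OF a(1) b(1)]] by blast
      then have "dvd_in (polys S) q p \<or> dvd_in (polys S) q p'" using prime a(1) b(1) by blast
      then have "dvd_in L (poly q x) (poly p x) \<or> dvd_in L (poly q x) (poly p' x)"
        using dvd_in_extension_iff[OF q(1) False] a(1) b(1) by blast
      then show ?thesis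
        unfolding a b using ext.dvd_in_mult_left[OF _ y_power_in_extension] by blast
    qed
    moreover have "poly q x \<noteq> 0" using transcendental q by blast
    ultimately show ?thesis unfolding prime_in_def using pq by blast
  qed
qed

text \<open>Elimination of \<open>x\<close>: the ideal generated by \<open>q\<close> and
  \<open>b\<close> contains a nonzero \<open>c\<close> free of \<open>x\<close>. Geometrically,
  \<open>q\<close> and \<open>b\<close> have no common zero on a fibre over a point where
  \<open>c\<close> does not vanish.\<close>

lemma bezout_extension:
  assumes q: "prime_in L q" "q = u * poly p x" "unit_in L u" "p \<in> polys S" "coeff p 0 \<noteq> 0" "degree p > 0"
    and b: "b \<in> L" "\<not> dvd_in L q b"
  obtains v w c where "v \<in> L" "w \<in> L" "c \<in> S" "c \<noteq> 0" "v * q + w * b = c"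
proof -
  have px: "poly p x \<in> L" using q poly_in_extension by blast
  have qp: "dvd_in L q a \<longleftrightarrow> dvd_in L (poly p x) a" if "a \<in> L" for a
    unfolding q(2) using dvd_in_unit_mult(2)[OF q(3) px that] .
  have prime: "dvd_in (polys S) p a \<or> dvd_in (polys S) p a'"
    if "a \<in> polys S" "a' \<in> polys S" "dvd_in (polys S) p (a * a')" for a a'
  proof -
    have aa': "a * a' \<in> polys S" using that poly.mult_closed by blast
    have "dvd_in L q (poly (a * a') x)"
      using that(3) dvd_in_extension_iff[OF q(4,5) aa'] qp[OF poly_in_extension[OF aa']] by blast
    then have "dvd_in L q (poly a x * poly a' x)" by simp
    then have "dvd_in L q (poly a x) \<or> dvd_in L q (poly a' x)"
      using q(1) poly_in_extension that unfolding prime_in_def by blast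
    then show ?thesis
      using that dvd_in_extension_iff[OF q(4,5)] qp[OF poly_in_extension] by blast
  qed
  have "b \<noteq> 0" using b(2) ext.dvd_in_zero by blast
  then obtain p' u' where p': "p' \<in> polys S" "coeff p' 0 \<noteq> 0" "b = u' * poly p' x" "unit_in L u'"
    using extension_normal_form[OF b(1)] by metis
  have "u' \<in> L" using p'(4) by (simp add: unit_in_def)
  then have "\<not> dvd_in L q (poly p' x)"
    using b(2) ext.dvd_in_mult_left[of q "poly p' x" u'] p'(3) by blast
  then have np: "\<not> dvd_in (polys S) p p'"
    using dvd_in_extension_iff[OF q(4,5) p'(1)] qp[OF poly_in_extension[OF p'(1)]] by blast
  have "\<exists>v\<in>polys S. \<exists>w\<in>polys S. \<exists>c\<in>S. c \<noteq> 0 \<and> v * p + w * p' = [:c:]" (is ?ex)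
  proof (rule bezout_constant[OF q(4,6) _ p'(1) np])
    fix v w c assume "v \<in> polys S" "w \<in> polys S" "c \<in> S" "c \<noteq> 0" "v * p + w * p' = [:c:]"
    then show ?ex by blast
  next
    fix a b assume "a \<in> polys S" "b \<in> polys S" "dvd_in (polys S) p (a * b)"
    then show "dvd_in (polys S) p a \<or> dvd_in (polys S) p b" by (rule prime)
  qed
  then obtain v w c where vw: "v \<in> polys S" "w \<in> polys S" "c \<in> S" "c \<noteq> 0" "v * p + w * p' = [:c:]"
    by blast
  obtain i where i: "i \<in> L" "u * i = 1" using q(3) by (auto simp: unit_in_def)
  obtain i' where i': "i' \<in> L" "u' * i' = 1" using p'(4) by (auto simp: unit_in_def)
  have "i * q = (u * i) * poly p x" "i' * b = (u' * i') * poly p' x"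
    unfolding q(2) p'(3) by (simp_all only: mult_ac)
  then have "i * q = poly p x" "i' * b = poly p' x"
    using i i' by simp_all
  moreover have "poly v x * poly p x + poly w x * poly p' x = c"
    using arg_cong[OF vw(5), of "\<lambda>p. poly p x"] by simp
  ultimately have "(poly v x * i) * q + (poly w x * i') * b = c" by (simp only: mult.assoc)
  then show thesis
    using that vw i i' ext.mult_closed poly_in_extension by blast
qed

end

text \<open>The numerator is a product of primes among polynomials; each of them stays prime or
  becomes a unit, and the denominator is a unit.\<close>

lemma factorial_subdomain_extension:
  assumes "factorial_subdomain S" "laurent S x y"
  shows "factorial_subdomain (laurent_extension S x y)"
proof -
  interpret factorial_subdomain S by fact
  interpret laurent S x y by fact
  interpret poly: factorial_subdomain "polys S" by (rule factorial_subdomain_polys)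
  interpret ext: subdomain "laurent_extension S x y" by (rule subdomain_extension)
  show ?thesis
  proof
    fix a assume a: "a \<in> L" "a \<noteq> 0"
    then obtain p k where p: "p \<in> polys S" "a = poly p x * y ^ k"
      by (auto simp: laurent_extension_def)
    then have "p \<noteq> 0" using a by auto
    then have "p \<in> prime_products (polys S)" using poly.factorial p by blast
    then have "poly p x \<in> prime_products L"
    proof (induction rule: prime_products.induct)
      case (unit u)
      then obtain v where "u \<in> polys S" "v \<in> polys S" "u * v = 1" by (auto simp: unit_in_def)
      then have "unit_in L (poly u x)"
        unfolding unit_in_def using poly_in_extension poly_mult[of u v x] by auto
      then show ?case by (rule prime_products.unit)
    next
      case (prime q a)
      have "poly q x * poly a x \<in> prime_products L"
        using prime_in_extension[OF prime.hyps(1)]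
      proof
        assume "unit_in L (poly q x)"
        then show ?thesis using ext.prime_products_mult[OF prime_products.unit] prime.IH by blast
      qed (use prime.IH prime_products.prime in blast)
      then show ?case by simp
    qed
    then show "a \<in> prime_products L"
      unfolding p(2) using unit_in_y_power prime_products.unit ext.prime_products_mult by blast
  qed
qed

section \<open>Group rings of lattices\<close>

lemma poly_mapping_sum_single: "a = (\<Sum>u\<in>Poly_Mapping.keys a. Poly_Mapping.single u (Poly_Mapping.lookup a u))"
proof (rule poly_mapping_eqI)
  fix k
  have "(\<Sum>u\<in>Poly_Mapping.keys a. Poly_Mapping.lookup (Poly_Mapping.single u (Poly_Mapping.lookup a u)) k)
    = (\<Sum>u\<in>Poly_Mapping.keys a. if u = k then Poly_Mapping.lookup a u else 0)"
    by (intro sum.cong) (auto simp: lookup_single when_def)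
  also have "\<dots> = Poly_Mapping.lookup a k" by (simp add: in_keys_iff)
  finally show "Poly_Mapping.lookup a k =
    Poly_Mapping.lookup (\<Sum>u\<in>Poly_Mapping.keys a. Poly_Mapping.single u (Poly_Mapping.lookup a u)) k"
    by (simp add: lookup_sum)
qed

lemma poly_mapping_single_induct [case_names single add]:
  fixes a :: "'a \<Rightarrow>\<^sub>0 'b::comm_monoid_add"
  assumes single: "\<And>u c. P (Poly_Mapping.single u c)" and add: "\<And>a b. P a \<Longrightarrow> P b \<Longrightarrow> P (a + b)"
  shows "P a"
proof -
  have "P (\<Sum>u\<in>K. Poly_Mapping.single u (Poly_Mapping.lookup a u))" if "finite K" for K
    using that
  proof (induction K)
    case empty
    then show ?case using single[of undefined 0] by simp
  qed (simp add: add single)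
  from this[OF finite_keys] show ?thesis using poly_mapping_sum_single[of a] by metis
qed

text \<open>A common form for several maps: \<open>h\<close> acts on coefficients and
  \<open>\<psi>\<close> on basis elements. With multiplicative \<open>\<psi>\<close> it gives
  \<open>eval_char\<close> and the germs along a line; with other \<open>\<psi>\<close> it gives
  \<open>bar_d1\<close> and the linear extension of a crossed homomorphism.\<close>

definition pm_eval :: "('b::zero \<Rightarrow> 'c::comm_semiring_1) \<Rightarrow> ('a \<Rightarrow> 'c) \<Rightarrow> ('a \<Rightarrow>\<^sub>0 'b) \<Rightarrow> 'c" where
  "pm_eval h \<psi> f = (\<Sum>u\<in>Poly_Mapping.keys f. h (Poly_Mapping.lookup f u) * \<psi> u)"

lemma pm_eval_superset:
  assumes "finite A" "Poly_Mapping.keys f \<subseteq> A" "h 0 = 0"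
  shows "pm_eval h \<psi> f = (\<Sum>u\<in>A. h (Poly_Mapping.lookup f u) * \<psi> u)"
  unfolding pm_eval_def using assms
  by (intro sum.mono_neutral_left) (auto simp: in_keys_iff)

lemma pm_eval_single: "h 0 = 0 \<Longrightarrow> pm_eval h \<psi> (Poly_Mapping.single u c) = h c * \<psi> u"
  by (simp add: pm_eval_def)

lemma pm_eval_add:
  assumes "h 0 = 0" "\<And>a b. h (a + b) = h a + h b"
  shows "pm_eval h \<psi> (f + g) = pm_eval h \<psi> f + pm_eval h \<psi> g"
proof -
  have "finite (Poly_Mapping.keys f \<union> Poly_Mapping.keys g)" by simp
  note sup = pm_eval_superset[where h = h and \<psi> = \<psi>, OF this _ assms(1)]
  show ?thesis
    using Poly_Mapping.keys_add[of f g]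
    by (simp add: sup lookup_add assms(2) distrib_right sum.distrib)
qed

lemma comm_ring_hom_pm_eval:
  fixes h :: "'b::comm_ring_1 \<Rightarrow> 'c::comm_ring_1" and \<psi> :: "'a::comm_monoid_add \<Rightarrow> 'c"
  assumes "comm_ring_hom h" "\<psi> 0 = 1" "\<And>u v. \<psi> (u + v) = \<psi> u * \<psi> v"
  shows "comm_ring_hom (pm_eval h \<psi>)"
proof -
  interpret h: comm_ring_hom h by fact
  show ?thesis
  proof
    show add: "pm_eval h \<psi> (f + g) = pm_eval h \<psi> f + pm_eval h \<psi> g" for f g
      by (simp add: pm_eval_add h.hom_add)
    show "pm_eval h \<psi> 1 = 1"
      by (simp add: pm_eval_single assms(2) flip: single_one)
    show "pm_eval h \<psi> 0 = 0" by (simp add: pm_eval_def)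
    show "pm_eval h \<psi> (f * g) = pm_eval h \<psi> f * pm_eval h \<psi> g" for f g
    proof (induction f rule: poly_mapping_single_induct)
      case (single u c)
      show ?case
      proof (induction g rule: poly_mapping_single_induct)
        case (single v d)
        then show ?case by (simp add: mult_single pm_eval_single assms(3) h.hom_mult mult_ac)
      qed (simp add: distrib_left add)
    qed (simp add: distrib_right add)
  qed
qed

lemma eval_char_eq_pm_eval: "eval_char f \<sigma> = pm_eval (\<lambda>c. c) \<sigma> f"
  by (simp add: eval_char_def pm_eval_def)

lemma characters_zero: "\<sigma> \<in> characters \<Longrightarrow> \<sigma> 0 = 1"
proof -
  assume "\<sigma> \<in> characters"
  then have "\<sigma> 0 \<noteq> 0" "\<sigma> (0 + 0) = \<sigma> 0 * \<sigma> 0" unfolding characters_def by blast+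
  then show "\<sigma> 0 = 1" by simp
qed

lemma characters_nonzero: "\<sigma> \<in> characters \<Longrightarrow> \<sigma> u \<noteq> 0"
  by (auto simp: characters_def)

lemma characters_add: "\<sigma> \<in> characters \<Longrightarrow> \<sigma> (u + v) = \<sigma> u * \<sigma> v"
  by (auto simp: characters_def)

lemma comm_ring_hom_eval_char:
  fixes \<sigma> :: "'a::comm_monoid_add \<Rightarrow> complex"
  assumes "\<sigma> \<in> characters"
  shows "comm_ring_hom (\<lambda>f. eval_char f \<sigma>)"
  unfolding eval_char_eq_pm_eval
  by (intro comm_ring_hom_pm_eval characters_zero characters_add assms) (unfold_locales, auto)

lemma lookup_complexify: "Poly_Mapping.lookup (complexify a) u = of_int (Poly_Mapping.lookup a u)"
  by (simp add: complexify_def Poly_Mapping.map.rep_eq when_def)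

lemma complexify_add: "complexify (a + b) = complexify a + complexify b"
  by (rule poly_mapping_eqI) (simp add: lookup_complexify lookup_add)

lemma complexify_single: "complexify (Poly_Mapping.single u c) = Poly_Mapping.single u (of_int c)"
  by (rule poly_mapping_eqI) (simp add: lookup_complexify lookup_single when_def)

lemma comm_ring_hom_complexify: "comm_ring_hom (complexify :: ('a::comm_monoid_add \<Rightarrow>\<^sub>0 int) \<Rightarrow> _)"
proof
  fix f g :: "'a \<Rightarrow>\<^sub>0 int"
  show "complexify (f + g) = complexify f + complexify g" by (rule complexify_add)
  show "complexify (1 :: 'a \<Rightarrow>\<^sub>0 int) = 1"
    using complexify_single[of 0 1] by simp
  show "complexify (0 :: 'a \<Rightarrow>\<^sub>0 int) = 0" by (rule poly_mapping_eqI) (simp add: lookup_complexify)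
  show "complexify (f * g) = complexify f * complexify g"
  proof (induction f rule: poly_mapping_single_induct)
    case (single u c)
    show ?case
    proof (induction g rule: poly_mapping_single_induct)
      case (single v d)
      then show ?case by (simp add: mult_single complexify_single)
    qed (simp add: distrib_left complexify_add)
  qed (simp add: distrib_right complexify_add)
qed

lemma complexify_eq_0_iff: "complexify a = 0 \<longleftrightarrow> a = 0"
  by (auto simp: poly_mapping_eq_iff lookup_complexify fun_eq_iff)

lemma keys_complexify: "Poly_Mapping.keys (complexify a) = Poly_Mapping.keys a"
  by (auto simp: in_keys_iff lookup_complexify)

lemma lookup_single_times:
  fixes b :: "'e::ab_group_add \<Rightarrow>\<^sub>0 'b::comm_ring_1"
  shows "Poly_Mapping.lookup (Poly_Mapping.single v c * b) u = c * Poly_Mapping.lookup b (u - v)"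
proof (induction b rule: poly_mapping_single_induct)
  case (single w d)
  show ?case by (auto simp: mult_single lookup_single when_def algebra_simps)
qed (simp add: distrib_left lookup_add)

section \<open>Factoriality of Laurent polynomial rings over int and complex\<close>

lemma prime_products_UNIV_int:
  assumes "(a::int) \<noteq> 0"
  shows "a \<in> prime_products UNIV"
  using assms
proof (induction a rule: prime_divisors_induct)
  case (unit x)
  then show ?case by (intro prime_products.unit) simp
next
  case (factor p x)
  then have "prime_in UNIV p"
    by (auto simp: prime_in_def prime_dvd_mult_iff)
  then show ?case using factor by (intro prime_products.prime) auto
qed simp

lemma factorial_subdomain_UNIV_int: "factorial_subdomain (UNIV :: int set)"
  by standard (auto intro: prime_products_UNIV_int)

lemma factorial_subdomain_UNIV_field: "factorial_subdomain (UNIV :: 'a::field set)"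
  by standard (auto intro!: prime_products.unit simp: dvd_field_iff)

text \<open>\<open>\<phi>\<close> identifies the group with \<open>\<int>\<^sup>n\<close>, and \<open>e\<close> is the standard basis.\<close>
locale lattice_coordinates =
  fixes \<phi> :: "'e::ab_group_add \<Rightarrow> nat \<Rightarrow> int" and n :: nat and e :: "nat \<Rightarrow> 'e"
  assumes coord_add: "i < n \<Longrightarrow> \<phi> (u + v) i = \<phi> u i + \<phi> v i"
    and coord_basis: "i < n \<Longrightarrow> j < n \<Longrightarrow> \<phi> (e i) j = (if i = j then 1 else 0)"
    and coord_inject: "(\<And>i. i < n \<Longrightarrow> \<phi> u i = \<phi> v i) \<Longrightarrow> u = v"
begin

lemma coord_zero: "i < n \<Longrightarrow> \<phi> 0 i = 0"
  using coord_add[of i 0 0] by simp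

lemma coord_uminus: "i < n \<Longrightarrow> \<phi> (- u) i = - \<phi> u i"
  using coord_add[of i u "- u"] coord_zero by simp

lemma coord_diff: "i < n \<Longrightarrow> \<phi> (u - v) i = \<phi> u i - \<phi> v i"
  using coord_add[of i u "- v"] coord_uminus by simp

text \<open>The exponents that involve only the variables with index in \<open>I\<close>;
  \<open>subring I\<close> is then the Laurent polynomial ring in these variables.\<close>

definition sublattice :: "nat set \<Rightarrow> 'e set" where
  "sublattice I = {u. \<forall>j<n. j \<notin> I \<longrightarrow> \<phi> u j = 0}"

definition subring :: "nat set \<Rightarrow> ('e \<Rightarrow>\<^sub>0 'b::comm_ring_1) set" where
  "subring I = {a. Poly_Mapping.keys a \<subseteq> sublattice I}"

lemma single_in_subring: "u \<in> sublattice I \<Longrightarrow> Poly_Mapping.single u c \<in> subring I"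
  by (auto simp: subring_def)

lemma zero_in_sublattice: "0 \<in> sublattice I"
  by (simp add: sublattice_def coord_zero)

lemma subring_full: "subring {..<n} = UNIV"
  by (auto simp: subring_def sublattice_def)

lemma subring_ring:
  "(1 :: 'e \<Rightarrow>\<^sub>0 'b::comm_ring_1) \<in> subring I"
  "(a :: 'e \<Rightarrow>\<^sub>0 'b) \<in> subring I \<Longrightarrow> b \<in> subring I \<Longrightarrow> a + b \<in> subring I"
  "a \<in> subring I \<Longrightarrow> b \<in> subring I \<Longrightarrow> a * b \<in> subring I"
  "a \<in> subring I \<Longrightarrow> - a \<in> subring I"
proof -
  show "(1 :: 'e \<Rightarrow>\<^sub>0 'b) \<in> subring I"
    using single_in_subring[OF zero_in_sublattice, of 1] by simp
  show "a + b \<in> subring I" if "a \<in> subring I" "b \<in> subring I"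
    using that Poly_Mapping.keys_add[of a b] by (auto simp: subring_def)
  show "- a \<in> subring I" if "a \<in> subring I"
    using that by (auto simp: subring_def in_keys_iff)
  have "u + v \<in> sublattice I" if "u \<in> sublattice I" "v \<in> sublattice I" for u v
    using that by (auto simp: sublattice_def coord_add)
  then show "a * b \<in> subring I" if "a \<in> subring I" "b \<in> subring I"
    using that keys_mult[of a b] unfolding subring_def by blast
qed

lemma sublattice_induct:
  assumes "i < n" "u \<in> sublattice (insert i I)" "\<And>u. u \<in> sublattice I \<Longrightarrow> P u"
    and up: "\<And>u. P u \<Longrightarrow> P (u + e i)" and down: "\<And>u. P u \<Longrightarrow> P (u - e i)"
  shows "P u"
proof -
  have "\<forall>u\<in>sublattice (insert i I). \<phi> u i = l \<longrightarrow> P u" for l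
  proof (induction l rule: int_induct[of _ 0])
    case base
    have "u \<in> sublattice I" if "u \<in> sublattice (insert i I)" "\<phi> u i = 0" for u
      using that by (auto simp: sublattice_def)
    then show ?case using assms(3) by blast
  next
    case (step1 l)
    show ?case
    proof (intro ballI impI)
      fix u assume u: "u \<in> sublattice (insert i I)" "\<phi> u i = l + 1"
      then have "u - e i \<in> sublattice (insert i I)" "\<phi> (u - e i) i = l"
        using assms(1) by (auto simp: sublattice_def coord_diff coord_basis)
      then have "P (u - e i)" using step1.IH by blast
      from up[OF this] show "P u" by simp
    qed
  next
    case (step2 l)
    show ?case
    proof (intro ballI impI)
      fix u assume u: "u \<in> sublattice (insert i I)" "\<phi> u i = l - 1"
      then have "u + e i \<in> sublattice (insert i I)" "\<phi> (u + e i) i = l"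
        using assms(1) by (auto simp: sublattice_def coord_add coord_basis)
      then have "P (u + e i)" using step2.IH by blast
      from down[OF this] show "P u" by simp
    qed
  qed
  then show ?thesis using assms(2) by blast
qed

lemma lattice_induct:
  assumes "P 0" "\<And>u i. i < n \<Longrightarrow> P u \<Longrightarrow> P (u + e i)" "\<And>u i. i < n \<Longrightarrow> P u \<Longrightarrow> P (u - e i)"
  shows "P u"
proof -
  have *: "\<forall>u\<in>sublattice I. P u" if "finite I" "I \<subseteq> {..<n}" for I
    using that
  proof (induction I)
    case empty
    have "u = 0" if "u \<in> sublattice {}" for u
      using that coord_inject[of u 0] by (simp add: sublattice_def coord_zero)
    then show ?case using assms(1) by blast
  next
    case (insert i I)
    then have "i < n" "\<And>u. u \<in> sublattice I \<Longrightarrow> P u" by auto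
    then show ?case using sublattice_induct[of i _ I P] assms(2,3) by blast
  qed
  show ?thesis using *[of "{..<n}"] by (simp add: sublattice_def)
qed

definition X :: "nat \<Rightarrow> 'e \<Rightarrow>\<^sub>0 'b::comm_ring_1" where "X i = Poly_Mapping.single (e i) 1"
definition Y :: "nat \<Rightarrow> 'e \<Rightarrow>\<^sub>0 'b::comm_ring_1" where "Y i = Poly_Mapping.single (- e i) 1"

lemma XY: "X i * Y i = 1"
  by (simp add: X_def Y_def mult_single)

lemma subring_empty: "(subring {} :: ('e \<Rightarrow>\<^sub>0 'b::comm_ring_1) set) = range (Poly_Mapping.single 0)"
proof -
  have sub: "sublattice {} = {0}"
    unfolding sublattice_def using coord_inject[of _ 0] by (auto simp: coord_zero)
  show ?thesis
  proof (intro equalityI subsetI)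
    fix a :: "'e \<Rightarrow>\<^sub>0 'b" assume "a \<in> subring {}"
    then have "Poly_Mapping.keys a \<subseteq> {0}" by (simp add: subring_def sub)
    then have "a = Poly_Mapping.single 0 (Poly_Mapping.lookup a 0)"
      by (intro poly_mapping_eqI) (auto simp: lookup_single when_def in_keys_iff)
    then show "a \<in> range (Poly_Mapping.single 0)" by (rule range_eqI)
  next
    fix a :: "'e \<Rightarrow>\<^sub>0 'b" assume "a \<in> range (Poly_Mapping.single 0)"
    then obtain c where "a = Poly_Mapping.single 0 c" by (elim rangeE)
    then show "a \<in> subring {}" using single_in_subring[OF zero_in_sublattice] by simp
  qed
qed

text \<open>Start of the induction on the number of variables: the group ring of the trivial lattice
  is a copy of the coefficient ring, and primes correspond to primes.\<close>

lemma factorial_subdomain_empty: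
  assumes "factorial_subdomain (UNIV :: 'b::comm_ring_1 set)"
  shows "factorial_subdomain (subring {} :: ('e \<Rightarrow>\<^sub>0 'b) set)"
proof -
  interpret factorial_subdomain "UNIV :: 'b set" by fact
  let ?c = "Poly_Mapping.single (0::'e) :: 'b \<Rightarrow> _"
  have mult: "?c a * ?c b = ?c (a * b)" for a b by (simp add: mult_single)
  have inj: "?c a = ?c b \<longleftrightarrow> a = b" for a b by (metis lookup_single_eq)
  have one: "?c 1 = 1" by simp
  interpret sub: subdomain "range ?c"
  proof
    show "1 \<in> range ?c" using one by (metis rangeI)
    show "a = 0 \<or> b = 0" if "a \<in> range ?c" "b \<in> range ?c" "a * b = 0" for a b
    proof -
      obtain c d where cd: "a = ?c c" "b = ?c d" using \<open>a \<in> range ?c\<close> \<open>b \<in> range ?c\<close> by (elim rangeE)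
      then have "c * d = 0" using \<open>a * b = 0\<close> inj[of "c * d" 0] by (simp add: mult)
      then show ?thesis using no_zero_div[of c d] cd by auto
    qed
  qed (auto simp: mult simp flip: single_add single_uminus)
  have dvd: "dvd_in (range ?c) (?c a) (?c b) \<longleftrightarrow> a dvd b" for a b
    by (auto simp: dvd_in_def dvd_def mult inj)
  have unit_c: "unit_in (range ?c) (?c a) \<longleftrightarrow> a dvd 1" for a
    unfolding unit_in_def using inj[of _ 1] by (auto simp: mult dvd_def one)
  have prime_c: "prime_in (range ?c) (?c p)" if "prime_in UNIV p" for p
  proof -
    have "dvd_in (range ?c) (?c p) x \<or> dvd_in (range ?c) (?c p) y"
      if x: "x \<in> range ?c" and y: "y \<in> range ?c" and xy: "dvd_in (range ?c) (?c p) (x * y)" for x y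
    proof -
      obtain a b where ab: "x = ?c a" "y = ?c b" using x y by (elim rangeE)
      then have "p dvd a * b" using xy by (simp only: mult dvd)
      then have "p dvd a \<or> p dvd b" using \<open>prime_in UNIV p\<close> by (simp add: prime_in_def)
      then show ?thesis by (simp only: ab dvd)
    qed
    moreover have "?c p \<noteq> 0" "\<not> unit_in (range ?c) (?c p)"
      using \<open>prime_in UNIV p\<close> inj[of p 0] unfolding unit_c by (simp_all add: prime_in_def)
    ultimately show ?thesis unfolding prime_in_def by blast
  qed
  have "?c a \<in> prime_products (range ?c)" if "a \<noteq> 0" for a
    using factorial[OF UNIV_I that]
  proof (induction rule: prime_products.induct)
    case (unit u)
    then show ?case by (intro prime_products.unit) (simp add: unit_c)
  next
    case (prime p a)
    then show ?case
      using prime_products.prime[OF prime_c[OF prime.hyps(1)], of "?c a"] by (simp add: mult)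
  qed
  then show ?thesis
    unfolding subring_empty by (unfold_locales) (use inj[of _ 0] in auto)
qed

lemma laurent_subring:
  assumes "subdomain (subring I :: ('e \<Rightarrow>\<^sub>0 'b::comm_ring_1) set)" "i < n" "i \<notin> I"
  shows "laurent (subring I :: ('e \<Rightarrow>\<^sub>0 'b) set) (X i) (Y i)"
proof -
  interpret subdomain "subring I :: ('e \<Rightarrow>\<^sub>0 'b) set" by fact
  show ?thesis
  proof
    show "X i * Y i = (1 :: 'e \<Rightarrow>\<^sub>0 'b)" by (rule XY)
    \<comment> \<open>A polynomial in \<open>X i\<close> has no negative exponents in direction
      \<open>i\<close>. In \<open>a + X i * poly p (X i) = 0\<close> the exponents of
      \<open>a\<close> in that direction are 0 and those of the other summand at least 1, so nothing
      can cancel.\<close>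
    have nonneg: "\<phi> u i \<ge> 0"
      if "p \<in> polys (subring I)" "u \<in> Poly_Mapping.keys (poly p (X i))" for u and p :: "('e \<Rightarrow>\<^sub>0 'b) poly"
      using that
    proof (induction p arbitrary: u)
      case (pCons a p)
      have aS: "a \<in> subring I" and pS: "p \<in> polys (subring I)"
        using pCons.prems(1) by (simp_all add: pCons_in_polys_iff)
      have "Poly_Mapping.keys (poly (pCons a p) (X i)) \<subseteq> 
        Poly_Mapping.keys a \<union> Poly_Mapping.keys (X i * poly p (X i))"
        using Poly_Mapping.keys_add by simp
      then consider "u \<in> Poly_Mapping.keys a" | "u \<in> Poly_Mapping.keys (X i * poly p (X i))"
        using pCons.prems(2) by blast
      then show ?case
      proof cases
        case 1
        then show ?thesis using aS assms by (auto simp: subring_def sublattice_def)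
      next
        case 2
        then have "u - e i \<in> Poly_Mapping.keys (poly p (X i))"
          by (simp add: in_keys_iff X_def lookup_single_times)
        then have "\<phi> (u - e i) i \<ge> 0" using pCons.IH[OF pS] by blast
        then show ?thesis using assms by (simp add: coord_diff coord_basis)
      qed
    qed simp
    show "p = 0" if "p \<in> polys (subring I)" "poly p (X i) = 0" for p :: "('e \<Rightarrow>\<^sub>0 'b) poly"
      using that
    proof (induction p)
      case (pCons a p)
      have aS: "a \<in> subring I" and pS: "p \<in> polys (subring I)"
        using pCons.prems(1) by (simp_all add: pCons_in_polys_iff)
      have eq: "a + X i * poly p (X i) = 0" using pCons.prems(2) by simp
      have "Poly_Mapping.lookup a u = 0" for u
      proof (rule ccontr)
        assume *: "Poly_Mapping.lookup a u \<noteq> 0"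
        then have "\<phi> u i = 0" using aS assms by (auto simp: subring_def sublattice_def in_keys_iff)
        then have "\<phi> (u - e i) i < 0" using assms by (simp add: coord_diff coord_basis)
        then have "Poly_Mapping.lookup (poly p (X i)) (u - e i) = 0"
          using nonneg[OF pS, of "u - e i"] by (auto simp: in_keys_iff)
        then show False
          using * arg_cong[OF eq, of "\<lambda>f. Poly_Mapping.lookup f u"]
          by (simp add: lookup_add X_def lookup_single_times)
      qed
      then have a: "a = 0" by (intro poly_mapping_eqI) simp
      then have "X i * poly p (X i) = 0" using eq by simp
      moreover have "(X i * Y i) * poly p (X i) = Y i * (X i * poly p (X i))" by (simp only: mult_ac)
      ultimately have "poly p (X i) = 0" by (simp add: XY)
      then show ?case using pCons.IH[OF pS] a by simp
    qed simp
  qed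
qed

lemma subring_insert:
  assumes "subdomain (subring I :: ('e \<Rightarrow>\<^sub>0 'b::comm_ring_1) set)" "i < n" "i \<notin> I"
  shows "subring (insert i I) = laurent_extension (subring I :: ('e \<Rightarrow>\<^sub>0 'b) set) (X i) (Y i)"
proof -
  interpret laurent "subring I :: ('e \<Rightarrow>\<^sub>0 'b) set" "X i" "Y i" by (rule laurent_subring) fact+
  interpret ext: subdomain L by (rule subdomain_extension)
  have "Poly_Mapping.single u c \<in> L" if "u \<in> sublattice (insert i I)" for u and c :: 'b
    using assms(2) that
  proof (rule sublattice_induct)
    show "Poly_Mapping.single u c \<in> L" if "u \<in> sublattice I" for u
      using that single_in_subring const_in_extension by blast
    show "Poly_Mapping.single (u + e i) c \<in> L" if "Poly_Mapping.single u c \<in> L" for u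
      using ext.mult_closed[OF that, of "X i"] x_power_in_extension[of 1] by (simp add: X_def mult_single)
    show "Poly_Mapping.single (u - e i) c \<in> L" if "Poly_Mapping.single u c \<in> L" for u
      using ext.mult_closed[OF that, of "Y i"] y_power_in_extension[of 1] by (simp add: Y_def mult_single)
  qed
  then have sub1: "a \<in> L" if "a \<in> subring (insert i I)" for a :: "'e \<Rightarrow>\<^sub>0 'b"
  proof -
    have "(\<Sum>u\<in>Poly_Mapping.keys a. Poly_Mapping.single u (Poly_Mapping.lookup a u)) \<in> L"
      using that \<open>\<And>u c. u \<in> sublattice (insert i I) \<Longrightarrow> Poly_Mapping.single u c \<in> L\<close>
      by (intro ext.sum_closed) (auto simp: subring_def)
    then show ?thesis using poly_mapping_sum_single[of a] by simp
  qed
  have sub2: "a \<in> subring (insert i I)" if "a \<in> L" for a :: "'e \<Rightarrow>\<^sub>0 'b"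
  proof -
    have X: "(X i :: 'e \<Rightarrow>\<^sub>0 'b) \<in> subring (insert i I)"
      and Y: "(Y i :: 'e \<Rightarrow>\<^sub>0 'b) \<in> subring (insert i I)"
      unfolding X_def Y_def using assms
      by (auto intro!: single_in_subring simp: sublattice_def coord_basis coord_uminus)
    have sub: "c \<in> subring (insert i I)" if "c \<in> subring I" for c :: "'e \<Rightarrow>\<^sub>0 'b"
      using that by (auto simp: subring_def sublattice_def)
    have P: "poly p (X i) \<in> subring (insert i I)" if "p \<in> polys (subring I)" for p :: "('e \<Rightarrow>\<^sub>0 'b) poly"
      using that
    proof (induction p)
      case 0
      then show ?case by (simp add: subring_def)
    next
      case (pCons a p)
      then have "a \<in> subring I" "p \<in> polys (subring I)"
        by (simp_all add: pCons_in_polys_iff)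
      then show ?case using pCons.IH X sub by (auto intro!: subring_ring)
    qed
    have Yk: "(Y i :: 'e \<Rightarrow>\<^sub>0 'b) ^ k \<in> subring (insert i I)" for k
      by (induction k) (auto intro: subring_ring Y)
    obtain p k where p: "p \<in> polys (subring I)" "a = poly p (X i) * Y i ^ k"
      using \<open>a \<in> L\<close> unfolding laurent_extension_def by blast
    show ?thesis unfolding p(2) by (intro subring_ring(3) P Yk p(1))
  qed
  show ?thesis by (rule equalityI; rule subsetI) (fact sub1, fact sub2)
qed

lemma factorial_subdomain_subring:
  assumes "factorial_subdomain (UNIV :: 'b::comm_ring_1 set)" "I \<subseteq> {..<n}"
  shows "factorial_subdomain (subring I :: ('e \<Rightarrow>\<^sub>0 'b) set)"
proof -
  have "finite I" using assms(2) finite_subset by blast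
  then show ?thesis using assms(2)
  proof (induction I)
    case empty
    then show ?case using factorial_subdomain_empty assms(1) by blast
  next
    case (insert i I)
    then interpret factorial_subdomain "subring I :: ('e \<Rightarrow>\<^sub>0 'b) set" by simp
    have i: "i < n" "i \<notin> I" using insert by auto
    show ?case
      unfolding subring_insert[OF subdomain_axioms i]
      by (rule factorial_subdomain_extension[OF factorial_subdomain_axioms laurent_subring[OF subdomain_axioms i]])
  qed
qed

end

section \<open>Zeros of irreducible Laurent polynomials\<close>

text \<open>In a product of primes equal to an irreducible element, everything beyond the first
  prime is a unit, so the element is associate to that prime.\<close>

lemma irreducible_imp_prime_in_UNIV:
  fixes f :: "'a::comm_ring_1"
  assumes "factorial_subdomain (UNIV :: 'a set)" "Factorial_Ring.irreducible f"
  shows "prime_in UNIV f"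
proof -
  interpret factorial_subdomain "UNIV :: 'a set" by fact
  have f: "f \<noteq> 0" "\<not> f dvd 1" and irr: "\<And>a b. f = a * b \<Longrightarrow> a dvd 1 \<or> b dvd 1"
    using assms(2) by (auto simp: Factorial_Ring.irreducible_def)
  have "f \<in> prime_products UNIV" using factorial f by blast
  then show ?thesis
  proof cases
    case unit
    then show ?thesis using f by simp
  next
    case (prime p a)
    have "\<not> p dvd 1" using prime(2) by (simp add: prime_in_def)
    then have "a dvd 1" using irr[OF prime(1)] by blast
    then obtain b where b: "a * b = 1" by (metis dvdE)
    have "p = f * b" using b prime(1) by (simp add: mult.assoc)
    then have "f dvd x" if "p dvd x" for x using that prime(1) b
      by (metis dvd_mult_left mult.commute mult.left_commute)
    moreover have "p dvd f" using prime(1) by simp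
    ultimately show ?thesis
      using prime(2) f unfolding prime_in_def by (metis UNIV_I dvd_in_UNIV dvd_trans unit_in_UNIV)
  qed
qed

section \<open>Derivations, and points moving along a coordinate fibre\<close>

context lattice_coordinates
begin

text \<open>The logarithmic derivation \<open>t_i d/dt_i\<close>. It preserves exponents, and at a
  point of the torus it vanishes exactly when the ordinary partial derivative does.\<close>

definition partial :: "nat \<Rightarrow> ('e \<Rightarrow>\<^sub>0 'b::comm_ring_1) \<Rightarrow> ('e \<Rightarrow>\<^sub>0 'b)" where
  "partial i = Poly_Mapping.mapp (\<lambda>u c. of_int (\<phi> u i) * c)"

lemma lookup_partial: "Poly_Mapping.lookup (partial i f) u = of_int (\<phi> u i) * Poly_Mapping.lookup f u"
  by (simp add: partial_def lookup_mapp in_keys_iff when_def)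

lemma partial_add: "partial i (f + g) = partial i f + partial i g"
  by (rule poly_mapping_eqI) (simp add: lookup_partial lookup_add distrib_left)

lemma partial_single: "partial i (Poly_Mapping.single u c) = Poly_Mapping.single u (of_int (\<phi> u i) * c)"
  by (rule poly_mapping_eqI) (simp add: lookup_partial lookup_single when_def)

lemma partial_mult:
  assumes "i < n"
  shows "partial i (f * g) = partial i f * g + f * partial i g"
proof (induction f rule: poly_mapping_single_induct)
  case (single u c)
  show ?case
  proof (induction g rule: poly_mapping_single_induct)
    case (single v d)
    show ?case
      using assms
      by (simp add: mult_single partial_single coord_add algebra_simps flip: single_add)
  qed (simp add: partial_add algebra_simps)
qed (simp add: partial_add algebra_simps)

lemma partial_subring: "a \<in> subring I \<Longrightarrow> i < n \<Longrightarrow> i \<notin> I \<Longrightarrow> partial i a = 0"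
proof (rule poly_mapping_eqI)
  fix u assume "a \<in> subring I" "i < n" "i \<notin> I"
  then have "u \<in> Poly_Mapping.keys a \<longrightarrow> \<phi> u i = 0"
    unfolding subring_def sublattice_def by blast
  then have "\<phi> u i = 0 \<or> Poly_Mapping.lookup a u = 0" by (auto simp: in_keys_iff)
  then show "Poly_Mapping.lookup (partial i a) u = Poly_Mapping.lookup 0 u"
    by (auto simp: lookup_partial)
qed

lemma partial_X: "i < n \<Longrightarrow> partial i (X i) = X i"
  by (simp add: X_def partial_single coord_basis)

text \<open>The operator \<open>x d/dx\<close> on polynomials, the counterpart of
  \<open>partial i\<close> under the substitution \<open>x = X i\<close>.\<close>

definition euler :: "'b::comm_ring_1 poly \<Rightarrow> 'b poly" where
  "euler p = (\<Sum>k\<le>degree p. monom (of_nat k * coeff p k) k)"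

lemma coeff_euler: "coeff (euler p) k = of_nat k * coeff p k"
  by (simp add: euler_def coeff_sum coeff_eq_0)

lemma partial_X_power: "i < n \<Longrightarrow> partial i (X i ^ k) = of_nat k * X i ^ k"
proof (induction k)
  case 0
  show ?case
    using 0 partial_subring[OF subring_ring(1), of i "{}"] by simp
next
  case (Suc k)
  then show ?case by (simp add: partial_mult partial_X algebra_simps)
qed

lemma partial_poly:
  assumes "i < n" "i \<notin> I" "p \<in> polys (subring I)"
  shows "partial i (poly p (X i)) = poly (euler p) (X i)"
proof -
  have zero: "partial i 0 = 0" by (rule poly_mapping_eqI) (simp add: lookup_partial)
  have sum: "partial i (\<Sum>k\<in>K. a k) = (\<Sum>k\<in>K. partial i (a k))" for K :: "nat set" and a
    by (induction K rule: infinite_finite_induct) (simp_all add: partial_add zero)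
  have "partial i (coeff p k * X i ^ k) = of_nat k * coeff p k * X i ^ k" for k
    using assms partial_subring[of "coeff p k" I i]
    by (simp add: polys_def partial_mult partial_X_power mult_ac)
  then show ?thesis
    by (simp add: poly_altdef[of p] sum euler_def poly_sum poly_monom)
qed

text \<open>The point obtained from \<open>\<tau>\<close> by setting the \<open>i\<close>-th
  coordinate to \<open>t\<close> and keeping the others. As \<open>t\<close> varies over nonzero
  numbers it runs through the fibre of the projection along \<open>e i\<close>.\<close>

definition twist :: "('e \<Rightarrow> complex) \<Rightarrow> nat \<Rightarrow> complex \<Rightarrow> 'e \<Rightarrow> complex" where
  "twist \<tau> i t u = \<tau> u * power_int (t / \<tau> (e i)) (\<phi> u i)"

lemma twist_character:
  assumes "\<tau> \<in> characters" "i < n" "t \<noteq> 0"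
  shows "twist \<tau> i t \<in> characters"
  using assms characters_nonzero[OF assms(1)] unfolding characters_def twist_def
  by (auto simp: coord_add power_int_add)

lemma twist_basis:
  assumes "\<tau> \<in> characters" "i < n"
  shows "twist \<tau> i t (e i) = t"
  using assms characters_nonzero[OF assms(1)] by (simp add: twist_def coord_basis)

lemma twist_sublattice: "i < n \<Longrightarrow> i \<notin> I \<Longrightarrow> u \<in> sublattice I \<Longrightarrow> twist \<tau> i t u = \<tau> u"
  by (simp add: twist_def sublattice_def)

lemma eval_twist_subring:
  assumes "i < n" "i \<notin> I" "a \<in> subring I"
  shows "eval_char a (twist \<tau> i t) = eval_char a \<tau>"
  unfolding eval_char_def
  by (intro sum.cong) (use assms twist_sublattice in \<open>auto simp: subring_def\<close>)

lemma eval_char_X: "eval_char (X i) \<sigma> = \<sigma> (e i)"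
  by (simp add: eval_char_eq_pm_eval X_def pm_eval_single)

lemma eval_twist_poly:
  assumes "i < n" "i \<notin> I" "\<tau> \<in> characters" "t \<noteq> 0" "p \<in> polys (subring I)"
  shows "eval_char (poly p (X i)) (twist \<tau> i t) = poly (map_poly (\<lambda>a. eval_char a \<tau>) p) t"
proof -
  interpret s: comm_ring_hom "\<lambda>f. eval_char f (twist \<tau> i t)"
    by (intro comm_ring_hom_eval_char twist_character assms)
  interpret \<tau>: comm_ring_hom "\<lambda>f. eval_char f \<tau>"
    by (intro comm_ring_hom_eval_char assms)
  show ?thesis using assms(5)
  proof (induction p)
    case (pCons a p)
    have "a \<in> subring I" "p \<in> polys (subring I)"
      using pCons.prems by (simp_all add: pCons_in_polys_iff)
    then show ?case
      using pCons.IH assms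
      by (simp add: s.hom_add s.hom_mult eval_char_X twist_basis eval_twist_subring map_poly_pCons)
  qed simp
qed

lemma factorial_complex_subring:
  "I \<subseteq> {..<n} \<Longrightarrow> factorial_subdomain (subring I :: ('e \<Rightarrow>\<^sub>0 complex) set)"
  by (intro factorial_subdomain_subring factorial_subdomain_UNIV_field)

lemma factorial_int_subring:
  "I \<subseteq> {..<n} \<Longrightarrow> factorial_subdomain (subring I :: ('e \<Rightarrow>\<^sub>0 int) set)"
  by (intro factorial_subdomain_subring factorial_subdomain_UNIV_int)

text \<open>Induction on the number of variables: choose the other coordinates such that the
  constant coefficient of the numerator does not vanish. The last coordinate then has to avoid 0 and
  finitely many roots.\<close>

lemma exists_character_nonzero:
  fixes g :: "'e \<Rightarrow>\<^sub>0 complex"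
  assumes "g \<noteq> 0"
  shows "\<exists>\<tau>\<in>characters. eval_char g \<tau> \<noteq> 0"
proof -
  have "\<exists>\<tau>\<in>characters. eval_char g \<tau> \<noteq> 0" if "I \<subseteq> {..<n}" "g \<in> subring I" "g \<noteq> 0" for I and g :: "'e \<Rightarrow>\<^sub>0 complex"
  proof -
    have "finite I" using that finite_subset by blast
    then show ?thesis using that
    proof (induction I arbitrary: g)
      case empty
      then obtain c where "g = Poly_Mapping.single 0 c" unfolding subring_empty by blast
      moreover have "(\<lambda>_. 1) \<in> (characters :: ('e \<Rightarrow> complex) set)" by (simp add: characters_def)
      ultimately show ?case
        using empty by (intro bexI[of _ "\<lambda>_. 1"]) (auto simp: eval_char_eq_pm_eval pm_eval_single)
    next
      case (insert i I)
      have i: "i < n" "i \<notin> I" "I \<subseteq> {..<n}" using insert by auto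
      interpret factorial_subdomain "subring I :: ('e \<Rightarrow>\<^sub>0 complex) set"
        by (rule factorial_complex_subring) fact
      interpret laurent "subring I :: ('e \<Rightarrow>\<^sub>0 complex) set" "X i" "Y i"
        by (intro laurent_subring subdomain_axioms i)
      have "g \<in> L" using insert.prems subring_insert[OF subdomain_axioms i(1,2)] by simp
      then obtain p u where p: "p \<in> polys (subring I)" "coeff p 0 \<noteq> 0" "g = u * poly p (X i)" "unit_in L u"
        using extension_normal_form insert.prems(3) by metis
      obtain \<tau> where \<tau>: "\<tau> \<in> characters" "eval_char (coeff p 0) \<tau> \<noteq> 0"
        using insert.IH[OF i(3) coeff_closed[OF p(1)] p(2)] by blast
      define q where "q = map_poly (\<lambda>a. eval_char a \<tau>) p"
      have "coeff q 0 \<noteq> 0"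
        using \<tau>(2) by (simp add: q_def coeff_map_poly eval_char_def)
      then have "q \<noteq> 0" by auto
      then have "finite (insert 0 {t. poly q t = 0})" by (simp add: poly_roots_finite)
      then obtain t where t: "t \<noteq> 0" "poly q t \<noteq> 0"
        using ex_new_if_finite[OF infinite_UNIV_char_0] by blast
      have \<sigma>: "twist \<tau> i t \<in> characters" using twist_character[OF \<tau>(1) i(1) t(1)] .
      interpret s: comm_ring_hom "\<lambda>f. eval_char f (twist \<tau> i t)"
        by (rule comm_ring_hom_eval_char) fact
      obtain v where "u * v = 1" using p(4) by (auto simp: unit_in_def)
      then have "eval_char u (twist \<tau> i t) * eval_char v (twist \<tau> i t) = 1"
        by (metis s.hom_mult s.hom_one)
      then have "eval_char u (twist \<tau> i t) \<noteq> 0" by auto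
      then have "eval_char g (twist \<tau> i t) \<noteq> 0"
        using t eval_twist_poly[OF i(1,2) \<tau>(1) t(1) p(1)] by (simp add: p(3) s.hom_mult q_def)
      then show ?case using \<sigma> by blast
    qed
  qed
  from this[of "{..<n}" g] show ?thesis using assms by (simp add: subring_full)
qed

lemma laurent_extension_full:
  assumes "subdomain (subring I :: ('e \<Rightarrow>\<^sub>0 'b::comm_ring_1) set)" "i < n" "I = {..<n} - {i}"
  shows "laurent_extension (subring I :: ('e \<Rightarrow>\<^sub>0 'b) set) (X i) (Y i) = UNIV"
proof -
  have I: "i \<notin> I" "insert i I = {..<n}" using assms by auto
  show ?thesis
    using subring_insert[OF assms(1,2) I(1)] unfolding I(2) subring_full by (rule sym)
qed

text \<open>An irreducible Laurent polynomial is not a monomial, hence has positive degree in some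
  coordinate direction.\<close>
lemma irreducible_normal_form:
  fixes f :: "'e \<Rightarrow>\<^sub>0 complex"
  assumes "Factorial_Ring.irreducible f"
  obtains i p u where "i < n" "p \<in> polys (subring ({..<n} - {i}))" "coeff p 0 \<noteq> 0" "degree p > 0"
    "f = u * poly p (X i)" "u dvd 1"
proof -
  have f: "f \<noteq> 0" "\<not> f dvd 1" using assms by (auto simp: Factorial_Ring.irreducible_def)
  have "\<exists>i<n. \<exists>v\<in>Poly_Mapping.keys f. \<exists>w\<in>Poly_Mapping.keys f. \<phi> v i \<noteq> \<phi> w i"
  proof (rule ccontr)
    assume "\<not> ?thesis"
    then have eq: "v = w" if "v \<in> Poly_Mapping.keys f" "w \<in> Poly_Mapping.keys f" for v w
      using that coord_inject[of v w] by blast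
    have "Poly_Mapping.keys f \<noteq> {}" using f(1) poly_mapping_sum_single[of f] by auto
    then obtain v where v: "v \<in> Poly_Mapping.keys f" by blast
    define c where "c = Poly_Mapping.lookup f v"
    have "c \<noteq> 0" using v by (simp add: c_def in_keys_iff)
    have "f = Poly_Mapping.single v c"
      using eq v by (intro poly_mapping_eqI) (auto simp: lookup_single when_def c_def in_keys_iff)
    then have "f * Poly_Mapping.single (- v) (1 / c) = 1"
      using \<open>c \<noteq> 0\<close> by (simp add: mult_single)
    then show False using f(2) by (metis dvdI)
  qed
  then obtain i v w where i: "i < n" and vw: "v \<in> Poly_Mapping.keys f" "w \<in> Poly_Mapping.keys f" "\<phi> v i \<noteq> \<phi> w i"
    by blast
  define I where "I = {..<n} - {i}"
  have I: "I \<subseteq> {..<n}" "i \<notin> I" "insert i I = {..<n}" using i by (auto simp: I_def)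
  interpret factorial_subdomain "subring I :: ('e \<Rightarrow>\<^sub>0 complex) set"
    by (rule factorial_complex_subring) fact
  interpret laurent "subring I :: ('e \<Rightarrow>\<^sub>0 complex) set" "X i" "Y i"
    by (intro laurent_subring subdomain_axioms i I)
  have full: "L = UNIV" by (rule laurent_extension_full[OF subdomain_axioms i I_def])
  obtain p u where p: "p \<in> polys (subring I)" "coeff p 0 \<noteq> 0" "f = u * poly p (X i)" "unit_in L u"
    and u: "\<exists>j k. u = X i ^ j * Y i ^ k"
    using extension_normal_form[of f] f(1) full by (metis UNIV_I)
  \<comment> \<open>If \<open>p\<close> were constant, \<open>f\<close> would be a monomial times an
    element free of the \<open>i\<close>-th variable. All its exponents would have the same
    \<open>i\<close>-th coordinate, against the choice of \<open>v\<close> and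
    \<open>w\<close>.\<close>
  have "degree p > 0"
  proof (rule ccontr)
    assume "\<not> degree p > 0"
    then obtain a where a: "p = [:a:]" using degree_eq_zeroE by blast
    then have aS: "a \<in> subring I" using coeff_closed[OF p(1), of 0] by simp
    have pow: "\<exists>y. Poly_Mapping.single x (1::complex) ^ k = Poly_Mapping.single y 1" for x :: 'e and k
    proof (induction k)
      case 0
      show ?case by (intro exI[of _ 0]) simp
    next
      case (Suc k)
      then show ?case by (auto simp: mult_single)
    qed
    obtain j k where "u = X i ^ j * Y i ^ k" using u by blast
    then obtain x where x: "u = Poly_Mapping.single x 1"
      using pow[of "e i" j] pow[of "- e i" k] by (auto simp: X_def Y_def mult_single)
    have "\<phi> y i = \<phi> x i" if "y \<in> Poly_Mapping.keys f" for y
    proof -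
      have "y - x \<in> Poly_Mapping.keys a"
        using that by (simp add: p(3) a x in_keys_iff lookup_single_times)
      then have "\<phi> (y - x) i = 0" using aS i I by (auto simp: subring_def sublattice_def)
      then show ?thesis using i by (simp add: coord_diff)
    qed
    then show False using vw by simp
  qed
  then show thesis using that[of i p u] i p full by (simp add: I_def)
qed

lemma dvd_poly_iff:
  fixes p :: "('e \<Rightarrow>\<^sub>0 complex) poly"
  assumes "i < n" "I = {..<n} - {i}" "p \<in> polys (subring I)" "coeff p 0 \<noteq> 0" "a \<in> polys (subring I)"
  shows "poly p (X i) dvd poly a (X i) \<longleftrightarrow> dvd_in (polys (subring I)) p a"
proof -
  have I: "I \<subseteq> {..<n}" "i \<notin> I" "insert i I = {..<n}" using assms by auto
  interpret factorial_subdomain "subring I :: ('e \<Rightarrow>\<^sub>0 complex) set"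
    by (rule factorial_complex_subring) fact
  interpret laurent "subring I :: ('e \<Rightarrow>\<^sub>0 complex) set" "X i" "Y i"
    by (intro laurent_subring subdomain_axioms assms I)
  have "L = UNIV" by (rule laurent_extension_full[OF subdomain_axioms assms(1,2)])
  then show ?thesis using dvd_in_extension_iff[OF assms(3-5)] by simp
qed

lemma positive_degree_not_dvd_const:
  fixes p :: "('e \<Rightarrow>\<^sub>0 complex) poly"
  assumes "i < n" "p \<in> polys (subring ({..<n} - {i}))" "coeff p 0 \<noteq> 0" "degree p > 0"
    and c: "c \<in> subring ({..<n} - {i})" "poly p (X i) dvd c"
  shows "c = 0"
proof (rule ccontr)
  assume "c \<noteq> 0"
  interpret factorial_subdomain "subring ({..<n} - {i}) :: ('e \<Rightarrow>\<^sub>0 complex) set"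
    by (rule factorial_complex_subring) simp
  have "dvd_in (polys (subring ({..<n} - {i}))) p [:c:]"
    using dvd_poly_iff[OF assms(1) refl assms(2,3) const_polys[OF c(1)]] c(2) by simp
  then obtain q where q: "q \<in> polys (subring ({..<n} - {i}))" "[:c:] = p * q" by (auto simp: dvd_in_def)
  moreover have "p \<noteq> 0" "q \<noteq> 0" using assms \<open>c \<noteq> 0\<close> q by auto
  ultimately show False using polys_mult_nonzero(2)[OF assms(2) q(1)] assms(4)
    by (auto dest: arg_cong[of _ _ degree])
qed

lemma of_nat_mult_eq_0:
  fixes a :: "'e \<Rightarrow>\<^sub>0 complex"
  assumes "of_nat d * a = 0" "d > 0"
  shows "a = 0"
proof (rule poly_mapping_eqI)
  fix u
  have "Poly_Mapping.lookup (Poly_Mapping.single 0 (of_nat d) * a) u = 0"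
    using assms(1) by simp
  then show "Poly_Mapping.lookup a u = Poly_Mapping.lookup 0 u"
    using assms(2) by (simp add: lookup_single_times del: single_of_nat)
qed

text \<open>The zero is found on a fibre of the projection along \<open>e i\<close>: over a point where the Bezout
  constant does not vanish, every root of \<open>f\<close> avoids \<open>h\<close> and \<open>\<partial>f\<close>.\<close>
theorem generic_zero:
  fixes f h :: "'e \<Rightarrow>\<^sub>0 complex"
  assumes irr: "Factorial_Ring.irreducible f" and h: "\<not> f dvd h"
  obtains i \<sigma> where "i < n" "\<sigma> \<in> characters" "eval_char f \<sigma> = 0" "eval_char h \<sigma> \<noteq> 0"
    "eval_char (partial i f) \<sigma> \<noteq> 0" "n \<ge> 2 \<Longrightarrow> \<sigma> \<noteq> (\<lambda>_. 1)"
proof -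
  obtain i p u where i: "i < n" and p: "p \<in> polys (subring ({..<n} - {i}))" "coeff p 0 \<noteq> 0" "degree p > 0"
    and f: "f = u * poly p (X i)" "u dvd 1"
    using irreducible_normal_form[OF irr] by metis
  define I where "I = {..<n} - {i}"
  have I: "I \<subseteq> {..<n}" "i \<notin> I" "insert i I = {..<n}" using i by (auto simp: I_def)
  interpret factorial_subdomain "subring I :: ('e \<Rightarrow>\<^sub>0 complex) set"
    by (rule factorial_complex_subring) fact
  interpret laurent "subring I :: ('e \<Rightarrow>\<^sub>0 complex) set" "X i" "Y i"
    by (intro laurent_subring subdomain_axioms i I)
  have full: "L = UNIV" by (rule laurent_extension_full[OF subdomain_axioms i I_def])
  have pI: "p \<in> polys (subring I)" using p(1) by (simp add: I_def)
  have prime: "prime_in UNIV f"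
    using irreducible_imp_prime_in_UNIV[OF _ irr] factorial_complex_subring[of "{..<n}"]
    by (simp add: subring_full)
  have f_dvd: "f dvd a \<longleftrightarrow> poly p (X i) dvd a" for a
    unfolding f(1) using f(2) by (metis dvd_mult dvd_mult_cancel_left dvd_trans dvd_triv_right mult_dvd_mono mult_1)
  \<comment> \<open>Otherwise \<open>p\<close> divides \<open>euler p\<close>, which has no larger
    degree, so the quotient is a constant. Comparing constant coefficients makes it 0, whereas the
    top coefficient of \<open>euler p\<close> is nonzero in characteristic 0.\<close>
  have "\<not> f dvd partial i f"
  proof
    assume *: "f dvd partial i f"
    obtain u' where u': "u * u' = 1" using f(2) by (metis dvdE)
    have "partial i f = partial i u * poly p (X i) + u * poly (euler p) (X i)"
      unfolding f(1) partial_mult[OF i] partial_poly[OF i I(2) pI] ..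
    then have "poly p (X i) dvd u * poly (euler p) (X i)"
      using * f_dvd by (metis dvd_add_right_iff dvd_triv_right)
    then have "poly p (X i) dvd u' * (u * poly (euler p) (X i))" by (rule dvd_mult)
    also have "\<dots> = (u * u') * poly (euler p) (X i)" by (simp only: mult_ac)
    finally have dvd: "poly p (X i) dvd poly (euler p) (X i)" using u' by simp
    have of_nat: "of_nat k * a \<in> subring I" if "a \<in> subring I" for k and a :: "'e \<Rightarrow>\<^sub>0 complex"
      using that by (induction k) (auto simp: distrib_right zero_closed intro: add_closed)
    have pd: "euler p \<in> polys (subring I)"
      by (simp add: polys_def coeff_euler of_nat coeff_closed[OF pI])
    obtain w where w: "w \<in> polys (subring I)" "euler p = p * w"
      using dvd_poly_iff[OF i I_def pI p(2) pd] dvd by (auto simp: dvd_in_def)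
    have "p \<noteq> 0" using p by auto
    have "coeff (euler p) (degree p) = of_nat (degree p) * lead_coeff p" by (simp add: coeff_euler)
    then have "coeff (euler p) (degree p) \<noteq> 0"
      using of_nat_mult_eq_0[of "degree p" "lead_coeff p"] \<open>p \<noteq> 0\<close> p(3) by auto
    then have "w \<noteq> 0" using w by auto
    then have "degree (euler p) = degree p + degree w"
      using polys_mult_nonzero(2)[OF pI w(1) \<open>p \<noteq> 0\<close>] w(2) by simp
    moreover have "degree (euler p) \<le> degree p"
      by (rule degree_le) (simp add: coeff_euler coeff_eq_0)
    ultimately obtain c where c: "w = [:c:]" using degree_eq_zeroE by auto
    have "coeff p 0 * c = 0"
      using arg_cong[OF w(2), of "\<lambda>p. coeff p 0"] by (simp add: coeff_euler c mult.commute)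
    then have "c = 0"
      using no_zero_div[OF coeff_closed[OF pI] , of c 0] coeff_closed[OF w(1), of 0] p(2) c by simp
    then show False using \<open>w \<noteq> 0\<close> c by simp
  qed
  then have "\<not> f dvd h * partial i f" using prime h by (auto simp: prime_in_def)
  moreover have "prime_in L f" "unit_in L u" using prime f full by simp_all
  ultimately obtain v w c where c: "c \<in> subring I" "c \<noteq> 0" "v * f + w * (h * partial i f) = c"
    using bezout_extension[of f u p "h * partial i f"] f(1) pI p full by (metis UNIV_I dvd_in_UNIV)
  \<comment> \<open>Used to keep the zero away from the trivial character: for
    \<open>n \<ge> 2\<close> it is \<open>t_j - 1\<close> for some \<open>j \<noteq> i\<close>, and
    moving along the \<open>i\<close>-th fibre does not change its value.\<close>
  define g where "g = (if n \<ge> 2 then X (if i = 0 then 1 else 0) - 1 else (1 :: 'e \<Rightarrow>\<^sub>0 complex))"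
  have g: "g \<in> subring I \<and> g \<noteq> 0"
  proof (cases "n \<ge> 2")
    case True
    define j where "j = (if i = 0 then 1 else 0 :: nat)"
    have j: "j < n" "j \<noteq> i" using True by (auto simp: j_def)
    have "e j \<noteq> 0" using coord_basis[OF j(1) j(1)] coord_zero[OF j(1)] by auto
    have gj: "g = X j - 1" using True by (simp add: g_def j_def)
    have "Poly_Mapping.lookup g (e j) = 1"
      using \<open>e j \<noteq> 0\<close> by (simp add: gj X_def lookup_minus lookup_one when_def)
    moreover have "X j \<in> subring I"
      unfolding X_def using j i by (intro single_in_subring) (auto simp: sublattice_def coord_basis I_def)
    ultimately show ?thesis unfolding gj using diff_closed one_closed by auto
  qed (use one_closed in \<open>auto simp: g_def\<close>)
  have "p \<noteq> 0" using p by auto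
  have nzd: "a \<in> subring I \<and> a \<noteq> 0 \<Longrightarrow> b \<in> subring I \<and> b \<noteq> 0 \<Longrightarrow> a * b \<in> subring I \<and> a * b \<noteq> 0"
    for a b :: "'e \<Rightarrow>\<^sub>0 complex" using no_zero_div mult_closed by blast
  \<comment> \<open>One factor for each requirement on the base point: \<open>c\<close> for the
    Bezout identity, the leading coefficient so that the degree does not drop, the constant
    coefficient so that the root is nonzero, and \<open>g\<close> for nontriviality.\<close>
  have "c * (lead_coeff p * (coeff p 0 * g)) \<in> subring I \<and> c * (lead_coeff p * (coeff p 0 * g)) \<noteq> 0"
    by (intro nzd) (use c(1,2) g p(2) \<open>p \<noteq> 0\<close> coeff_closed[OF pI] in auto)
  then obtain \<tau> where \<tau>: "\<tau> \<in> characters" "eval_char (c * (lead_coeff p * (coeff p 0 * g))) \<tau> \<noteq> 0"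
    using exists_character_nonzero by blast
  interpret \<tau>: comm_ring_hom "\<lambda>f. eval_char f \<tau>" by (rule comm_ring_hom_eval_char) fact
  have nz: "eval_char c \<tau> \<noteq> 0" "eval_char (lead_coeff p) \<tau> \<noteq> 0" "eval_char (coeff p 0) \<tau> \<noteq> 0" "eval_char g \<tau> \<noteq> 0"
    using \<tau>(2) by (auto simp: \<tau>.hom_mult)
  define q where "q = map_poly (\<lambda>a. eval_char a \<tau>) p"
  have cq: "coeff q k = eval_char (coeff p k) \<tau>" for k
    by (simp add: q_def coeff_map_poly)
  have "degree q \<ge> degree p" by (rule le_degree) (use nz cq in simp)
  then have "\<not> constant (poly q)" using p(3) by (simp add: constant_degree)
  then obtain t where t: "poly q t = 0" using fundamental_theorem_of_algebra by blast
  have "poly q 0 \<noteq> 0" using nz(3) cq by (simp add: poly_0_coeff_0)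
  then have "t \<noteq> 0" using t by auto
  define \<sigma> where "\<sigma> = twist \<tau> i t"
  have \<sigma>: "\<sigma> \<in> characters" unfolding \<sigma>_def by (intro twist_character \<tau> i) fact
  interpret s: comm_ring_hom "\<lambda>f. eval_char f \<sigma>" by (rule comm_ring_hom_eval_char) fact
  have "eval_char (poly p (X i)) \<sigma> = 0"
    using t eval_twist_poly[OF i I(2) \<tau>(1) \<open>t \<noteq> 0\<close> pI] by (simp add: \<sigma>_def q_def)
  then have fs: "eval_char f \<sigma> = 0" by (simp add: f(1) s.hom_mult)
  have "eval_char (v * f + w * (h * partial i f)) \<sigma> = eval_char c \<tau>"
    unfolding c(3) \<sigma>_def by (rule eval_twist_subring[OF i I(2) c(1)])
  then have "eval_char w \<sigma> * (eval_char h \<sigma> * eval_char (partial i f) \<sigma>) \<noteq> 0"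
    using fs nz(1) by (simp add: s.hom_add s.hom_mult)
  moreover have "\<sigma> \<noteq> (\<lambda>_. 1)" if "n \<ge> 2"
  proof
    assume 1: "\<sigma> = (\<lambda>_. 1)"
    have "eval_char g \<sigma> = \<sigma> (e (if i = 0 then 1 else 0)) - 1"
      using that by (simp add: g_def s.hom_minus eval_char_X)
    then have "eval_char g \<sigma> = 0" by (simp only: 1 diff_self)
    then show False using nz(4) g eval_twist_subring[OF i I(2), of g \<tau> t] by (simp add: \<sigma>_def)
  qed
  ultimately show thesis using that[OF i \<sigma> fs] by simp
qed

text \<open>The integral elements divisible by \<open>f\<close> form a principal prime ideal, whose generator would be a
  common divisor of the cofactors.\<close>
theorem gcd_complexify:
  fixes \<Delta> :: "'e \<Rightarrow>\<^sub>0 int" and f :: "'e \<Rightarrow>\<^sub>0 complex"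
  assumes gcd: "is_gcd_of \<Delta> E" and \<Delta>: "\<Delta> \<noteq> 0" and irr: "Factorial_Ring.irreducible f"
  shows "\<exists>a. \<Delta> * a \<in> E \<and> \<not> f dvd complexify a"
proof (rule ccontr)
  assume "\<not> ?thesis"
  then have all: "f dvd complexify a" if "\<Delta> * a \<in> E" for a using that by blast
  interpret C: comm_ring_hom "complexify :: ('e \<Rightarrow>\<^sub>0 int) \<Rightarrow> _" by (rule comm_ring_hom_complexify)
  have dvd: "\<Delta> dvd x" if "x \<in> E" for x
    using gcd that unfolding is_gcd_of_def by blast
  have greatest: "c dvd \<Delta>" if "\<And>x. x \<in> E \<Longrightarrow> c dvd x" for c
    using gcd that unfolding is_gcd_of_def by blast
  \<comment> \<open>If \<open>E\<close> contained only 0, then 0 would be a common divisor and would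
    divide \<open>\<Delta>\<close>.\<close>
  obtain x where x: "x \<in> E" "x \<noteq> 0" using greatest[of 0] \<Delta> by auto
  then obtain a0 where a0: "x = \<Delta> * a0" using dvd by (metis dvdE)
  have "a0 \<noteq> 0" using a0 x by auto
  interpret Z: factorial_subdomain "UNIV :: ('e \<Rightarrow>\<^sub>0 int) set"
    using factorial_int_subring[of "{..<n}"] by (simp add: subring_full)
  have prime: "prime_in UNIV f"
    using irreducible_imp_prime_in_UNIV[OF _ irr] factorial_complex_subring[of "{..<n}"]
    by (simp add: subring_full)
  have nunit: "\<not> f dvd complexify u" if "u dvd 1" for u
    using prime C.hom_dvd[OF that] by (metis C.hom_one dvd_trans prime_in_def unit_in_UNIV)
  \<comment> \<open>Since \<open>f\<close> is prime over complex, it divides one of the integral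
    primes in a factorization of a nonzero cofactor. This \<open>q\<close> is the integral prime
    lying over \<open>f\<close>.\<close>
  have "\<exists>q. prime_in UNIV q \<and> f dvd complexify q" if "a \<in> prime_products UNIV" "f dvd complexify a" for a
    using that
  proof (induction rule: prime_products.induct)
    case (unit u)
    then show ?case using nunit by simp
  next
    case (prime p a)
    then have "f dvd complexify p \<or> f dvd complexify a"
      using \<open>prime_in UNIV f\<close> by (simp add: C.hom_mult prime_in_def)
    then show ?case using prime by blast
  qed
  from this[OF Z.factorial[OF UNIV_I \<open>a0 \<noteq> 0\<close>]] all[of a0] x a0
  obtain q where q: "prime_in UNIV q" "f dvd complexify q" by auto
  have "q \<noteq> 0" using q by (simp add: prime_in_def)
  obtain i p u where i: "i < n" and p: "p \<in> polys (subring ({..<n} - {i}))" "coeff p 0 \<noteq> 0" "degree p > 0"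
    and f: "f = u * poly p (X i)" "u dvd 1"
    using irreducible_normal_form[OF irr] by metis
  define I where "I = {..<n} - {i}"
  have I: "I \<subseteq> {..<n}" "i \<notin> I" "insert i I = {..<n}" using i by (auto simp: I_def)
  have const: "c = 0" if "c \<in> subring I" "f dvd complexify c" for c :: "'e \<Rightarrow>\<^sub>0 int"
  proof -
    have "complexify c \<in> subring I" using that by (simp add: subring_def keys_complexify)
    moreover have "poly p (X i) dvd complexify c" using that f(1) by (metis dvd_mult_right)
    ultimately have "complexify c = 0"
      using positive_degree_not_dvd_const[OF i p] by (simp add: I_def)
    then show ?thesis by (simp add: complexify_eq_0_iff)
  qed
  interpret factorial_subdomain "subring I :: ('e \<Rightarrow>\<^sub>0 int) set"
    by (rule factorial_int_subring) fact
  interpret laurent "subring I :: ('e \<Rightarrow>\<^sub>0 int) set" "X i" "Y i"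
    by (intro laurent_subring subdomain_axioms i I)
  have full: "L = UNIV" by (rule laurent_extension_full[OF subdomain_axioms i I_def])
  obtain q' v where q': "q' \<in> polys (subring I)" "coeff q' 0 \<noteq> 0" "q = v * poly q' (X i)" "unit_in L v"
    using extension_normal_form[of q] full \<open>q \<noteq> 0\<close> by (metis UNIV_I)
  have "degree q' > 0"
  proof (rule ccontr)
    assume "\<not> degree q' > 0"
    then obtain c where c: "q' = [:c:]" using degree_eq_zeroE by blast
    then have cS: "c \<in> subring I" "c \<noteq> 0" using coeff_closed[OF q'(1), of 0] q'(2) by auto
    have "f dvd complexify v * complexify c" using q(2) q'(3) c by (simp add: C.hom_mult)
    then have "f dvd complexify v \<or> f dvd complexify c" using prime by (simp add: prime_in_def)
    then show False using const cS nunit q'(4) full by auto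
  qed
  \<comment> \<open>If \<open>q\<close> did not divide \<open>a\<close>, eliminating the
    \<open>i\<close>-th variable would give a nonzero integral element free of that variable and
    divisible by \<open>f\<close>, excluded by \<open>const\<close>.\<close>
  have "q dvd a" if a: "f dvd complexify a" for a
  proof (rule ccontr)
    assume "\<not> q dvd a"
    moreover have "prime_in L q" using q full by simp
    ultimately obtain v' w c where c: "c \<in> subring I" "c \<noteq> 0" "v' * q + w * a = c"
      using bezout_extension[of q v q' a] q' \<open>degree q' > 0\<close> full by (metis UNIV_I dvd_in_UNIV)
    have "f dvd complexify c"
      unfolding c(3)[symmetric] using a q(2) by (simp add: C.hom_add C.hom_mult)
    then show False using const c by blast
  qed
  \<comment> \<open>By assumption \<open>f\<close> divides every cofactor, hence so does
    \<open>q\<close>, and \<open>\<Delta> * q\<close> becomes a common divisor of \<open>E\<close>.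
    As it must divide the gcd, \<open>q\<close> would be a unit.\<close>
  then have "\<Delta> * q dvd x" if "x \<in> E" for x
    using that all dvd by (metis dvdE mult_dvd_mono dvd_refl)
  then have "\<Delta> * q dvd \<Delta>" by (rule greatest)
  then obtain r where "\<Delta> = \<Delta> * q * r" by (metis dvdE)
  then have "\<Delta> * (q * r) = \<Delta> * 1" by (simp add: mult.assoc)
  then have "q * r = 1" using Z.cancel_left[of \<Delta> "q * r" 1] \<Delta> by simp
  then show False using q(1) by (metis dvdI prime_in_def unit_in_UNIV)
qed

end

section \<open>Germs along lines\<close>

text \<open>The inverse of a power series is a true inverse only if the constant term is nonzero.
  The exponent laws for \<open>power_int\<close> carry this hypothesis, which at a point of the
  torus says that the coordinates do not vanish.\<close>

lemma power_int_fps_step: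
  fixes a :: "complex fps"
  assumes "fps_nth a 0 \<noteq> 0"
  shows "power_int a (k + 1) = power_int a k * a"
proof (cases "k \<ge> 0")
  case True
  then show ?thesis by (simp add: power_int_def nat_add_distrib)
next
  case False
  have a: "inverse a * a = 1" using assms by (rule inverse_mult_eq_1)
  have "nat (- k) = Suc (nat (- (k + 1)))" using False by simp
  then have "power_int a k * a = inverse a ^ nat (- (k + 1)) * (inverse a * a)"
    using False by (simp add: power_int_def mult_ac)
  also have "\<dots> = power_int a (k + 1)"
  proof (cases "k = -1")
    case True
    then show ?thesis by (simp add: a power_int_def)
  next
    case False
    then show ?thesis using \<open>\<not> k \<ge> 0\<close> by (simp add: a power_int_def)
  qed
  finally show ?thesis ..
qed

lemma power_int_fps_add:
  fixes a :: "complex fps"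
  assumes "fps_nth a 0 \<noteq> 0"
  shows "power_int a (k + l) = power_int a k * power_int a l"
proof (induction l rule: int_induct[of _ 0])
  case base
  show ?case by simp
next
  case (step1 l)
  have "power_int a (k + (l + 1)) = power_int a (k + l) * a"
    using power_int_fps_step[OF assms, of "k + l"] by (simp add: add.assoc)
  then show ?case
    using step1 power_int_fps_step[OF assms, of l] by (simp add: mult.assoc)
next
  case (step2 l)
  have a0: "a \<noteq> 0" using assms by auto
  have "power_int a (k + (l - 1)) * a = power_int a (k + l)"
    using power_int_fps_step[OF assms, of "k + (l - 1)"] by (simp add: algebra_simps)
  also have "\<dots> = power_int a k * (power_int a (l - 1) * a)"
    using step2 power_int_fps_step[OF assms, of "l - 1"] by simp
  finally show ?case using a0 by (simp add: mult.assoc[symmetric])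
qed

lemma fps_deriv_power_int:
  fixes a :: "complex fps"
  assumes "fps_nth a 0 \<noteq> 0"
  shows "a * fps_deriv (power_int a k) = of_int k * power_int a k * fps_deriv a"
proof (induction k rule: int_induct[of _ 0])
  case base
  show ?case by simp
next
  case (step1 k)
  have "a * fps_deriv (power_int a (k + 1)) = a * (a * fps_deriv (power_int a k)) + a * power_int a k * fps_deriv a"
    unfolding power_int_fps_step[OF assms] by (simp add: algebra_simps)
  also have "\<dots> = of_int (k + 1) * power_int a (k + 1) * fps_deriv a"
    unfolding step1.IH power_int_fps_step[OF assms] by (simp add: algebra_simps)
  finally show ?case .
next
  case (step2 k)
  have a0: "a \<noteq> 0" using assms by auto
  have k: "power_int a k = power_int a (k - 1) * a"
    using power_int_fps_step[OF assms, of "k - 1"] by simp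
  have "a * (a * fps_deriv (power_int a (k - 1))) = a * fps_deriv (power_int a k) - a * power_int a (k - 1) * fps_deriv a"
    unfolding k by (simp add: algebra_simps)
  also have "\<dots> = a * (of_int (k - 1) * power_int a (k - 1) * fps_deriv a)"
    unfolding step2.IH unfolding k by (simp add: algebra_simps)
  finally show ?case using a0 by simp
qed

lemma fps_nth_0_power_int:
  fixes a :: "complex fps"
  shows "fps_nth (power_int a k) 0 = power_int (fps_nth a 0) k"
  by (simp add: power_int_def fps_power_zeroth)

lemma fps_nth_0_prod:
  fixes F :: "'a \<Rightarrow> complex fps"
  shows "fps_nth (\<Prod>i\<in>I. F i) 0 = (\<Prod>i\<in>I. fps_nth (F i) 0)"
  by (induction I rule: infinite_finite_induct) simp_all

lemma has_fps_expansion_power_nat: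
  fixes F :: "complex fps"
  assumes "f has_fps_expansion F"
  shows "(\<lambda>x. f x ^ k) has_fps_expansion F ^ k"
  by (induction k) (auto intro!: fps_expansion_intros assms)

lemma has_fps_expansion_power_int:
  fixes F :: "complex fps"
  assumes "f has_fps_expansion F" "fps_nth F 0 \<noteq> 0"
  shows "(\<lambda>x. power_int (f x) k) has_fps_expansion power_int F k"
  unfolding power_int_def using assms
  by (cases "k \<ge> 0") (auto intro!: has_fps_expansion_power_nat has_fps_expansion_inverse)

definition linear_germ :: "complex \<Rightarrow> complex \<Rightarrow> complex fps" where
  "linear_germ z w = fps_const z + fps_const w * fps_X"

lemma linear_germ_nth_0 [simp]: "fps_nth (linear_germ z w) 0 = z"
  by (simp add: linear_germ_def)

text \<open>The argument \<open>x\<close> parametrizes directions, not the points of a line. A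
  Taylor coefficient depends polynomially on it, so if it is nonzero for one direction of the family
  it is zero for only finitely many.\<close>

definition coeffs_polynomial :: "(complex \<Rightarrow> complex fps) \<Rightarrow> bool" where
  "coeffs_polynomial F \<longleftrightarrow> (\<forall>k. \<exists>p. \<forall>x. fps_nth (F x) k = poly p x)"

lemma coeffs_polynomial_const: "coeffs_polynomial (\<lambda>_. c)"
  unfolding coeffs_polynomial_def
proof
  fix k show "\<exists>p. \<forall>x::complex. fps_nth c k = poly p x"
    by (intro exI[of _ "[:fps_nth c k:]"]) simp
qed

lemma coeffs_polynomial_add:
  assumes "coeffs_polynomial F" "coeffs_polynomial G"
  shows "coeffs_polynomial (\<lambda>x. F x + G x)"
  using assms unfolding coeffs_polynomial_def by (metis fps_add_nth poly_add)

lemma coeffs_polynomial_mult: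
  assumes "coeffs_polynomial F" "coeffs_polynomial G"
  shows "coeffs_polynomial (\<lambda>x. F x * G x)"
  unfolding coeffs_polynomial_def
proof
  fix k
  obtain p q where pq: "\<And>i x. fps_nth (F x) i = poly (p i) x" "\<And>i x. fps_nth (G x) i = poly (q i) x"
    using assms unfolding coeffs_polynomial_def by metis
  show "\<exists>r. \<forall>x. fps_nth (F x * G x) k = poly r x"
    by (intro exI[of _ "\<Sum>i=0..k. p i * q (k - i)"]) (simp add: fps_mult_nth pq poly_sum)
qed

lemma coeffs_polynomial_sum:
  "(\<And>i. i \<in> I \<Longrightarrow> coeffs_polynomial (F i)) \<Longrightarrow> coeffs_polynomial (\<lambda>x. \<Sum>i\<in>I. F i x)"
  by (induction I rule: infinite_finite_induct) (auto intro: coeffs_polynomial_const coeffs_polynomial_add)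

lemma coeffs_polynomial_prod:
  "(\<And>i. i \<in> I \<Longrightarrow> coeffs_polynomial (F i)) \<Longrightarrow> coeffs_polynomial (\<lambda>x. \<Prod>i\<in>I. F i x)"
  by (induction I rule: infinite_finite_induct) (auto intro: coeffs_polynomial_const coeffs_polynomial_mult)

lemma coeffs_polynomial_power:
  "coeffs_polynomial F \<Longrightarrow> coeffs_polynomial (\<lambda>x. F x ^ k)"
  by (induction k) (auto intro: coeffs_polynomial_const coeffs_polynomial_mult)

lemma coeffs_polynomial_linear_germ: "coeffs_polynomial (\<lambda>x. linear_germ z (w + x * v))"
  unfolding coeffs_polynomial_def
proof
  fix k show "\<exists>p. \<forall>x. fps_nth (linear_germ z (w + x * v)) k = poly p x"
    by (intro exI[of _ "if k = 0 then [:z:] else if k = 1 then [:w, v:] else 0"])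
       (auto simp: linear_germ_def fps_X_def)
qed

text \<open>The coefficients satisfy \<open>z * a (k + 1) + (w + x * v) * a k = 0\<close>. Only the
  constant term \<open>z\<close> is ever divided by, and it does not depend on
  \<open>x\<close>.\<close>

lemma coeffs_polynomial_inverse_linear_germ:
  assumes "z \<noteq> 0"
  shows "coeffs_polynomial (\<lambda>x. inverse (linear_germ z (w + x * v)))"
  unfolding coeffs_polynomial_def
proof
  fix k show "\<exists>p. \<forall>x. fps_nth (inverse (linear_germ z (w + x * v))) k = poly p x"
  proof (induction k)
    case 0
    show ?case by (intro exI[of _ "[:inverse z:]"]) simp
  next
    case (Suc k)
    then obtain p where p: "\<And>x. fps_nth (inverse (linear_germ z (w + x * v))) k = poly p x" by blast
    have "fps_nth (inverse (linear_germ z (w + x * v))) (Suc k) = poly (smult (- 1 / z) ([:w, v:] * p)) x" for x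
    proof -
      let ?l = "linear_germ z (w + x * v)"
      have "?l * inverse ?l = 1" using assms by (intro inverse_mult_eq_1') simp
      then have "fps_nth (?l * inverse ?l) (Suc k) = 0" by simp
      moreover have "fps_nth (?l * F) (Suc k) = z * fps_nth F (Suc k) + (w + x * v) * fps_nth F k" for F
        by (simp add: linear_germ_def distrib_right mult.assoc)
      ultimately have "z * fps_nth (inverse ?l) (Suc k) + (w + x * v) * poly p x = 0"
        by (simp only: p)
      moreover have "a = - b / z" if "z * a + b = 0" for a b
        using that assms by (simp add: field_simps eq_neg_iff_add_eq_0)
      ultimately have "fps_nth (inverse ?l) (Suc k) = - ((w + x * v) * poly p x) / z" by blast
      also have "\<dots> = poly (smult (- 1 / z) ([:w, v:] * p)) x"
        by (simp add: algebra_simps add_divide_distrib diff_divide_distrib)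
      finally show ?thesis .
    qed
    then show ?case by blast
  qed
qed

lemma coeffs_polynomial_power_int_linear_germ:
  "z \<noteq> 0 \<Longrightarrow> coeffs_polynomial (\<lambda>x. power_int (linear_germ z (w + x * v)) k)"
  unfolding power_int_def
  by (cases "k \<ge> 0")
     (auto intro: coeffs_polynomial_power coeffs_polynomial_linear_germ coeffs_polynomial_inverse_linear_germ)

lemma comm_ring_hom_fps_const: "comm_ring_hom (fps_const :: complex \<Rightarrow> complex fps)"
  by unfold_locales simp_all

section \<open>Restriction of Laurent polynomials to lines\<close>

context lattice_coordinates
begin

definition germ_char :: "(nat \<Rightarrow> complex) \<Rightarrow> (nat \<Rightarrow> complex) \<Rightarrow> 'e \<Rightarrow> complex fps" where
  "germ_char z w u = (\<Prod>i<n. power_int (linear_germ (z i) (w i)) (\<phi> u i))"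

text \<open>The Taylor series in \<open>s\<close> of a Laurent polynomial along the line \<open>z + s w\<close>.\<close>
definition germ :: "(nat \<Rightarrow> complex) \<Rightarrow> (nat \<Rightarrow> complex) \<Rightarrow> ('e \<Rightarrow>\<^sub>0 complex) \<Rightarrow> complex fps" where
  "germ z w = pm_eval fps_const (germ_char z w)"

lemma comm_ring_hom_germ:
  assumes "\<And>i. i < n \<Longrightarrow> z i \<noteq> 0"
  shows "comm_ring_hom (germ z w)"
  unfolding germ_def
proof (rule comm_ring_hom_pm_eval[OF comm_ring_hom_fps_const])
  show "germ_char z w 0 = 1" by (simp add: germ_char_def coord_zero)
  show "germ_char z w (u + v) = germ_char z w u * germ_char z w v" for u v
    using assms by (simp add: germ_char_def coord_add power_int_fps_add prod.distrib)
qed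

lemma character_coordinates:
  assumes "\<sigma> \<in> characters"
  shows "\<sigma> u = (\<Prod>i<n. power_int (\<sigma> (e i)) (\<phi> u i))"
proof (induction u rule: lattice_induct)
  case 1
  show ?case using characters_zero[OF assms] by (simp add: coord_zero)
next
  have e0: "\<sigma> (e i) \<noteq> 0" for i using assms by (rule characters_nonzero)
  have step: "(\<Prod>j<n. power_int (\<sigma> (e j)) (\<phi> (u + e i) j)) = (\<Prod>j<n. power_int (\<sigma> (e j)) (\<phi> u j)) * \<sigma> (e i)"
    if "i < n" for u i
  proof -
    have "(\<Prod>j<n. power_int (\<sigma> (e j)) (\<phi> (u + e i) j)) =
      (\<Prod>j<n. power_int (\<sigma> (e j)) (\<phi> u j) * (if i = j then \<sigma> (e i) else 1))"
      using that e0 by (intro prod.cong) (auto simp: coord_add coord_basis power_int_add)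
    then show ?thesis using that by (simp add: prod.distrib)
  qed
  {
    case (2 u i)
    then show ?case by (simp only: step[OF 2(1)] characters_add[OF assms])
  next
    case (3 u i)
    have "\<sigma> (u - e i) * \<sigma> (e i) = (\<Prod>j<n. power_int (\<sigma> (e j)) (\<phi> (u - e i) j)) * \<sigma> (e i)"
      using characters_add[OF assms, of "u - e i" "e i"] step[OF 3(1), of "u - e i"] 3(2) by simp
    then show ?case using e0[of i] by simp
  }
qed

lemma germ_nth_0:
  assumes "\<sigma> \<in> characters" "\<And>i. i < n \<Longrightarrow> z i = \<sigma> (e i)"
  shows "fps_nth (germ z w f) 0 = eval_char f \<sigma>"
proof -
  have "fps_nth (germ_char z w u) 0 = \<sigma> u" for u
    unfolding character_coordinates[OF assms(1), of u] germ_char_def fps_nth_0_prod fps_nth_0_power_int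
    using assms(2) by simp
  then show ?thesis by (simp add: germ_def pm_eval_def eval_char_def fps_sum_nth)
qed

text \<open>Along the \<open>i\<close>-th coordinate line the coordinate \<open>t_i\<close> is the
  series \<open>linear_germ (z i) 1\<close> and the others are constant. So
  \<open>t_i d/dt_i\<close> becomes multiplication by this series after differentiation in
  \<open>s\<close>.\<close>

lemma fps_deriv_germ:
  assumes "\<And>j. j < n \<Longrightarrow> z j \<noteq> 0" "i < n" "w = (\<lambda>j. if j = i then 1 else 0)"
  shows "linear_germ (z i) 1 * fps_deriv (germ z w f) = germ z w (partial i f)"
proof -
  interpret comm_ring_hom "germ z w" by (rule comm_ring_hom_germ) fact
  have u: "linear_germ (z i) 1 * fps_deriv (germ_char z w u) = of_int (\<phi> u i) * germ_char z w u" for u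
  proof -
    define c where "c = (\<Prod>j\<in>{..<n}-{i}. power_int (z j) (\<phi> u j))"
    have "power_int (linear_germ (z j) (w j)) (\<phi> u j) = fps_const (power_int (z j) (\<phi> u j))"
      if "j \<in> {..<n}-{i}" for j
      using that assms by (simp add: linear_germ_def power_int_def fps_const_power fps_const_inverse)
    then have "(\<Prod>j\<in>{..<n}-{i}. power_int (linear_germ (z j) (w j)) (\<phi> u j)) =
      (\<Prod>j\<in>{..<n}-{i}. fps_const (power_int (z j) (\<phi> u j)))" by (rule prod.cong[OF refl])
    also have "\<dots> = fps_const c"
    proof -
      interpret c: comm_ring_hom "fps_const :: complex \<Rightarrow> complex fps" by (rule comm_ring_hom_fps_const)
      show ?thesis by (simp add: c_def c.hom_prod)
    qed
    finally have g: "germ_char z w u = power_int (linear_germ (z i) 1) (\<phi> u i) * fps_const c"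
      unfolding germ_char_def using assms by (subst prod.remove[of _ i]) auto
    have "fps_deriv (linear_germ (z i) 1) = 1" by (simp add: linear_germ_def)
    then have "linear_germ (z i) 1 * fps_deriv (power_int (linear_germ (z i) 1) (\<phi> u i)) =
      of_int (\<phi> u i) * power_int (linear_germ (z i) 1) (\<phi> u i)"
      using fps_deriv_power_int[of "linear_germ (z i) 1" "\<phi> u i"] assms by simp
    then show ?thesis
      unfolding g by (simp add: fps_deriv_mult mult.assoc[symmetric])
  qed
  show ?thesis
  proof (induction f rule: poly_mapping_single_induct)
    case (single v c)
    have "linear_germ (z i) 1 * fps_deriv (germ z w (Poly_Mapping.single v c)) =
      fps_const c * (linear_germ (z i) 1 * fps_deriv (germ_char z w v))"
      by (simp add: germ_def pm_eval_single mult_ac)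
    also have "\<dots> = germ z w (partial i (Poly_Mapping.single v c))"
      unfolding u by (simp add: germ_def pm_eval_single partial_single fps_of_int mult_ac flip: fps_const_mult)
    finally show ?case .
  qed (simp add: partial_add hom_add distrib_left)
qed

lemma germ_nth_1:
  assumes "\<sigma> \<in> characters" "\<And>j. j < n \<Longrightarrow> z j = \<sigma> (e j)" "i < n" "w = (\<lambda>j. if j = i then 1 else 0)"
  shows "z i * fps_nth (germ z w f) 1 = eval_char (partial i f) \<sigma>"
proof -
  have "linear_germ (z i) 1 * fps_deriv (germ z w f) = germ z w (partial i f)"
    using assms characters_nonzero[OF assms(1)] by (intro fps_deriv_germ) auto
  from arg_cong[OF this, of "\<lambda>F. fps_nth F 0"] show ?thesis
    by (simp add: germ_nth_0[OF assms(1,2)])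
qed

text \<open>The line goes from \<open>z\<close> to a point \<open>\<tau>\<close> of the torus with
  \<open>f(\<tau>) \<noteq> 0\<close>, reached at \<open>s = 1\<close>. It may leave the torus on
  the way; multiplying by a power of each coordinate turns the germ into a polynomial, which can be
  evaluated at 1.\<close>

lemma germ_nonzero:
  assumes z: "\<And>i. i < n \<Longrightarrow> z i \<noteq> 0" and "f \<noteq> 0"
  shows "\<exists>w. germ z w f \<noteq> 0"
proof -
  obtain \<tau> where \<tau>: "\<tau> \<in> characters" "eval_char f \<tau> \<noteq> 0"
    using exists_character_nonzero[OF \<open>f \<noteq> 0\<close>] by blast
  define w where "w i = \<tau> (e i) - z i" for i
  \<comment> \<open>A bound for the absolute values of all exponents of \<open>f\<close>, so that
    multiplication by the \<open>N\<close>-th powers of the coordinates removes every negative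
    exponent.\<close>
  define N where "N = (\<Sum>u\<in>Poly_Mapping.keys f. \<Sum>i<n. nat \<bar>\<phi> u i\<bar>)"
  have N: "\<phi> u i + int N \<ge> 0" if "u \<in> Poly_Mapping.keys f" "i < n" for u i
  proof -
    have "nat \<bar>\<phi> u i\<bar> \<le> (\<Sum>i<n. nat \<bar>\<phi> u i\<bar>)" using that by (intro member_le_sum) auto
    also have "\<dots> \<le> N" unfolding N_def using that by (intro member_le_sum[where f = "\<lambda>u. \<Sum>i<n. nat \<bar>\<phi> u i\<bar>"]) auto
    finally show ?thesis by linarith
  qed
  define T where "T = (\<Sum>u\<in>Poly_Mapping.keys f. [:Poly_Mapping.lookup f u:] *
    (\<Prod>i<n. [:z i, w i:] ^ nat (\<phi> u i + int N)))"
  have l: "fps_of_poly [:a, b:] = linear_germ a b" for a b :: complex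
    by (simp add: linear_germ_def fps_of_poly_pCons fps_of_poly_const mult.commute)
  have "germ z w f * (\<Prod>i<n. linear_germ (z i) (w i) ^ N) = fps_of_poly T"
  proof -
    have "germ_char z w u * (\<Prod>i<n. linear_germ (z i) (w i) ^ N) =
      (\<Prod>i<n. linear_germ (z i) (w i) ^ nat (\<phi> u i + int N))" if "u \<in> Poly_Mapping.keys f" for u
    proof -
      have "power_int (linear_germ (z i) (w i)) (\<phi> u i) * linear_germ (z i) (w i) ^ N =
        linear_germ (z i) (w i) ^ nat (\<phi> u i + int N)" if "i < n" for i
      proof -
        have "power_int (linear_germ (z i) (w i)) (\<phi> u i) * power_int (linear_germ (z i) (w i)) (int N) =
          power_int (linear_germ (z i) (w i)) (\<phi> u i + int N)"
          using z that by (intro power_int_fps_add[symmetric]) simp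
        then show ?thesis using N[OF \<open>u \<in> _\<close> that] by (simp add: power_int_def)
      qed
      then show ?thesis by (simp add: germ_char_def flip: prod.distrib)
    qed
    then show ?thesis
      by (simp add: germ_def pm_eval_def T_def sum_distrib_right mult.assoc fps_of_poly_sum
          fps_of_poly_mult fps_of_poly_prod fps_of_poly_power fps_of_poly_smult l)
  qed
  moreover have "poly T 1 \<noteq> 0"
  proof -
    have "poly T 1 = (\<Sum>u\<in>Poly_Mapping.keys f. Poly_Mapping.lookup f u *
      (\<tau> u * (\<Prod>i<n. \<tau> (e i) ^ N)))"
      unfolding T_def poly_sum
    proof (rule sum.cong[OF refl])
      fix u assume u: "u \<in> Poly_Mapping.keys f"
      have "(\<tau> (e i)) ^ nat (\<phi> u i + int N) = power_int (\<tau> (e i)) (\<phi> u i) * \<tau> (e i) ^ N" if "i < n" for i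
        using N[OF u that] characters_nonzero[OF \<tau>(1)]
        by (simp add: power_int_add flip: power_int_of_nat)
      then have "(\<Prod>i<n. \<tau> (e i) ^ nat (\<phi> u i + int N)) = \<tau> u * (\<Prod>i<n. \<tau> (e i) ^ N)"
        unfolding character_coordinates[OF \<tau>(1), of u] by (simp flip: prod.distrib)
      then show "poly ([:Poly_Mapping.lookup f u:] * (\<Prod>i<n. [:z i, w i:] ^ nat (\<phi> u i + int N))) 1 =
        Poly_Mapping.lookup f u * (\<tau> u * (\<Prod>i<n. \<tau> (e i) ^ N))"
        by (simp add: poly_prod w_def)
    qed
    also have "\<dots> = eval_char f \<tau> * (\<Prod>i<n. \<tau> (e i) ^ N)"
      by (simp add: eval_char_def sum_distrib_right mult.assoc)
    finally show ?thesis using \<tau> characters_nonzero[OF \<tau>(1)] by simp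
  qed
  ultimately have "germ z w f \<noteq> 0" by (auto simp: fps_of_poly_eq_iff[of _ 0, simplified])
  then show ?thesis by blast
qed

lemma coeffs_polynomial_germ:
  assumes "\<And>i. i < n \<Longrightarrow> z i \<noteq> 0"
  shows "coeffs_polynomial (\<lambda>x. germ z (\<lambda>i. w i + x * v i) f)"
  unfolding germ_def pm_eval_def germ_char_def
  by (intro coeffs_polynomial_sum coeffs_polynomial_mult coeffs_polynomial_const
      coeffs_polynomial_prod coeffs_polynomial_power_int_linear_germ) (use assms in auto)

text \<open>Finitely many Taylor coefficients, none identically zero in the direction, are all nonzero
  in a common direction, since each is polynomial along every line of directions.\<close>
lemma common_direction:
  assumes z: "\<And>i. i < n \<Longrightarrow> z i \<noteq> 0" and "finite J"
    and "\<And>j. j \<in> J \<Longrightarrow> \<exists>w. fps_nth (germ z w (f j)) (k j) \<noteq> 0"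
  shows "\<exists>w. \<forall>j\<in>J. fps_nth (germ z w (f j)) (k j) \<noteq> 0"
  using assms(2,3)
proof (induction J)
  case (insert j J)
  obtain w where w: "\<And>i. i \<in> J \<Longrightarrow> fps_nth (germ z w (f i)) (k i) \<noteq> 0" using insert by blast
  obtain w' where w': "fps_nth (germ z w' (f j)) (k j) \<noteq> 0" using insert by blast
  \<comment> \<open>A line of directions from \<open>w\<close> at 0 to \<open>w'\<close> at 1. The
    polynomials belonging to \<open>J\<close> are nonzero at 0 and the new one at 1, so none is the
    zero polynomial.\<close>
  define W :: "complex \<Rightarrow> nat \<Rightarrow> complex" where "W x i = w i + x * (w' i - w i)" for x i
  have W: "W 0 = w" "W 1 = w'" by (auto simp: W_def)
  have "\<forall>i. \<exists>p. \<forall>x. fps_nth (germ z (W x) (f i)) (k i) = poly p x"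
  proof
    fix i
    have "coeffs_polynomial (\<lambda>x. germ z (\<lambda>i. w i + x * (w' i - w i)) (f i))"
      by (rule coeffs_polynomial_germ) (rule z)
    then show "\<exists>p. \<forall>x. fps_nth (germ z (W x) (f i)) (k i) = poly p x"
      unfolding coeffs_polynomial_def W_def by (rule spec)
  qed
  then obtain p where p: "\<And>i x. fps_nth (germ z (W x) (f i)) (k i) = poly (p i) x"
    by (auto dest: choice)
  have "p i \<noteq> 0" if "i \<in> insert j J" for i
    using that w w' p[of 0 i] p[of 1 j] W by auto
  then have "finite (\<Union>i\<in>insert j J. {x. poly (p i) x = 0})"
    using insert.hyps by (auto simp: poly_roots_finite)
  then obtain x where "x \<notin> (\<Union>i\<in>insert j J. {x. poly (p i) x = 0})"
    using ex_new_if_finite[OF infinite_UNIV_char_0] by blast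
  then show ?case using p by (intro exI[of _ "W x"]) auto
qed simp

end

section \<open>Minors\<close>

lemma module_times: "Modules.module ((*) :: 'r::comm_ring_1 \<Rightarrow> 'r \<Rightarrow> 'r)"
  by standard (simp_all add: algebra_simps)

lemma ideal_gen_base: "x \<in> G \<Longrightarrow> x \<in> ideal_gen G"
  unfolding ideal_gen_def by (rule Modules.module.span_base[OF module_times])

lemma ideal_gen_induct [consumes 1, case_names zero add mult base]:
  fixes x :: "'r::comm_ring_1"
  assumes "x \<in> ideal_gen G" "P 0" "\<And>x y. P x \<Longrightarrow> P y \<Longrightarrow> P (x + y)" "\<And>a x. P x \<Longrightarrow> P (a * x)"
    "\<And>x. x \<in> G \<Longrightarrow> P x"
  shows "P x"
proof -
  have "Modules.module.subspace (*) (Collect P)"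
    using assms(2-4) by (intro Modules.module.subspaceI[OF module_times]) auto
  then show ?thesis
    using Modules.module.span_induct[OF module_times, of x G P] assms(1,5) by (simp add: ideal_gen_def)
qed

lemma replace_col_carrier: "A \<in> carrier_mat n n \<Longrightarrow> replace_col A b k \<in> carrier_mat n n"
  by (simp add: replace_col_def)

lemma det_replace_col_smult:
  fixes A :: "'r::comm_ring_1 mat"
  assumes A: "A \<in> carrier_mat n n" and k: "k < n" and b: "\<And>i. i < n \<Longrightarrow> vec_index b i = x * vec_index c i"
  shows "Determinant.det (replace_col A b k) = x * Determinant.det (replace_col A c k)"
proof -
  have del: "mat_delete (replace_col A b k) i k = mat_delete (replace_col A c k) i k" for i
    using A by (intro eq_matI) (auto simp: replace_col_def mat_delete_def)
  have "Determinant.det (replace_col A b k) =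
    (\<Sum>i<n. replace_col A b k $$ (i, k) * cofactor (replace_col A b k) i k)"
    by (rule laplace_expansion_column[OF replace_col_carrier[OF A] k])
  also have "\<dots> = (\<Sum>i<n. x * (replace_col A c k $$ (i, k) * cofactor (replace_col A c k) i k))"
  proof (rule sum.cong[OF refl])
    fix i assume "i \<in> {..<n}"
    then have "replace_col A b k $$ (i, k) = x * replace_col A c k $$ (i, k)"
      using A k by (simp add: replace_col_def b)
    then show "replace_col A b k $$ (i, k) * cofactor (replace_col A b k) i k =
      x * (replace_col A c k $$ (i, k) * cofactor (replace_col A c k) i k)"
      by (simp add: cofactor_def del mult.assoc)
  qed
  also have "\<dots> = x * Determinant.det (replace_col A c k)"
    by (simp add: laplace_expansion_column[OF replace_col_carrier[OF A] k, of c] sum_distrib_left)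
  finally show ?thesis .
qed

text \<open>Replacing column \<open>t\<close> by \<open>A w\<^sub>t\<close> does not change the determinant, and a factor \<open>x\<close> comes out.\<close>
lemma power_dvd_det:
  fixes A :: "'r::comm_ring_1 mat" and w :: "nat \<Rightarrow> nat \<Rightarrow> 'r"
  assumes "finite T" "A \<in> carrier_mat n n" "T \<subseteq> {..<n}"
    and "\<And>s t. s \<in> T \<Longrightarrow> t \<in> T \<Longrightarrow> w s t = (if s = t then 1 else 0)"
    and "\<And>i t. i < n \<Longrightarrow> t \<in> T \<Longrightarrow> x dvd (\<Sum>j<n. A $$ (i, j) * w t j)"
  shows "x ^ card T dvd Determinant.det A"
  using assms
proof (induction T arbitrary: A)
  case (insert t T)
  have A: "A \<in> carrier_mat n n" and t: "t < n" using insert by auto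
  have "\<forall>i. \<exists>c. i < n \<longrightarrow> (\<Sum>j<n. A $$ (i, j) * w t j) = x * c"
    using insert.prems(4) by (meson dvdE insertI1)
  then obtain c where c: "\<And>i. i < n \<Longrightarrow> (\<Sum>j<n. A $$ (i, j) * w t j) = x * c i"
    by metis
  define A' where "A' = replace_col A (Matrix.vec n c) t"
  have A': "A' \<in> carrier_mat n n" unfolding A'_def by (rule replace_col_carrier[OF A])
  define v where "v = Matrix.vec n (w t)"
  have v: "v \<in> carrier_vec n" "vec_index v t = 1" using t insert.prems(3)[of t t] by (simp_all add: v_def)
  have Av: "vec_index (A *\<^sub>v v) i = x * vec_index (Matrix.vec n c) i" if "i < n" for i
    using that A c by (simp add: v_def scalar_prod_def lessThan_atLeast0)
  have "Determinant.det A = Determinant.det (replace_col A (A *\<^sub>v v) t)"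
    using cramer_lemma_mat[OF A v(1) t] v(2) by simp
  also have "\<dots> = x * Determinant.det A'"
    unfolding A'_def by (rule det_replace_col_smult[OF A t Av])
  finally have det: "Determinant.det A = x * Determinant.det A'" .
  have "x ^ card T dvd Determinant.det A'"
  proof (rule insert.IH[OF A'])
    show "T \<subseteq> {..<n}" using insert.prems by blast
    show "w s u = (if s = u then 1 else 0)" if "s \<in> T" "u \<in> T" for s u
      using insert.prems(3) that by blast
    fix i s assume i: "i < n" and s: "s \<in> T"
    \<comment> \<open>The replaced column is invisible to the remaining vectors, because their
      entries at \<open>t\<close> are 0; the divisibility hypothesis therefore carries over to
      \<open>A'\<close>.\<close>
    have "w s t = 0" using insert.prems(3)[of s t] insert.hyps s by auto
    then have "A' $$ (i, j) * w s j = A $$ (i, j) * w s j" if "j < n" for j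
      using that i A t by (auto simp: A'_def replace_col_def)
    then show "x dvd (\<Sum>j<n. A' $$ (i, j) * w s j)"
      using insert.prems(4)[OF i, of s] s by simp
  qed
  then show ?case using insert.hyps by (simp add: det mult_dvd_mono)
qed simp

text \<open>Row reduction: the independent vectors have an invertible square submatrix with columns
  \<open>T\<close>, and \<open>d\<close> is its inverse.\<close>

lemma dual_coordinates:
  fixes v :: "nat \<Rightarrow> nat \<Rightarrow> complex"
  assumes "\<And>c i. (\<forall>j<m. (\<Sum>i<b. c i * v i j) = 0) \<Longrightarrow> i < b \<Longrightarrow> c i = 0"
  shows "\<exists>T d. T \<subseteq> {..<m} \<and> card T = b \<and>
    (\<forall>s\<in>T. \<forall>t\<in>T. (\<Sum>i<b. d s i * v i t) = (if s = t then 1 else 0))"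
  using assms
proof (induction b)
  case 0
  show ?case by (intro exI[of _ "{}"]) simp
next
  case (Suc b)
  have indep: "c i = 0" if "\<forall>j<m. (\<Sum>i<b. c i * v i j) = 0" "i < b" for c i
    using Suc.prems[of "\<lambda>i. if i < b then c i else 0" i] that by simp
  have "\<exists>T d. T \<subseteq> {..<m} \<and> card T = b \<and>
    (\<forall>s\<in>T. \<forall>t\<in>T. (\<Sum>i<b. d s i * v i t) = (if s = t then 1 else 0))"
    by (rule Suc.IH) (rule indep)
  then obtain T d where T: "T \<subseteq> {..<m}" "card T = b"
    and d: "\<And>s t. s \<in> T \<Longrightarrow> t \<in> T \<Longrightarrow> (\<Sum>i<b. d s i * v i t) = (if s = t then 1 else 0)"
    by blast
  have fT: "finite T" using T finite_subset by blast
  \<comment> \<open>The coefficients of \<open>u\<close>, the last vector minus its expansion in the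
    previous ones along \<open>T\<close>. It vanishes on \<open>T\<close>, and by independence it
    has a nonzero entry elsewhere: the new pivot \<open>j\<close>.\<close>
  define c where "c i = (if i < b then - (\<Sum>t\<in>T. v b t * d t i) else 1)" for i
  define u where "u j = (\<Sum>i<Suc b. c i * v i j)" for j
  have u: "u j = v b j - (\<Sum>t\<in>T. v b t * (\<Sum>i<b. d t i * v i j))" for j
  proof -
    have "(\<Sum>i<b. (\<Sum>t\<in>T. v b t * d t i) * v i j) = (\<Sum>t\<in>T. v b t * (\<Sum>i<b. d t i * v i j))"
      by (simp add: sum_distrib_left sum_distrib_right mult.assoc) (rule sum.swap)
    then show ?thesis by (simp add: u_def c_def sum_negf)
  qed
  have uT: "u s = 0" if "s \<in> T" for s
    using that fT by (simp add: u d if_distrib cong: if_cong)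
  have "c b = 1" by (simp add: c_def)
  then obtain j where j: "j < m" "u j \<noteq> 0"
    using Suc.prems[of c b] by (auto simp: u_def)
  have jT: "j \<notin> T" using uT j by blast
  define w where "w s x = (\<Sum>i<b. d s i * v i x)" for s x
  \<comment> \<open>The new combination is \<open>u\<close> scaled to 1 at \<open>j\<close>; from
    each old one the multiple of \<open>u\<close> that clears its entry at \<open>j\<close> is
    subtracted. Since \<open>u\<close> is 0 on \<open>T\<close>, the old pivots are
    unaffected.\<close>
  define d' where "d' s i = (if s = j then c i / u j else (if i < b then d s i else 0) - w s j / u j * c i)" for s i
  have d'j: "(\<Sum>i<Suc b. d' j i * v i x) = u x / u j" for x
    by (simp add: d'_def u_def sum_divide_distrib add_divide_distrib)
  have d's: "(\<Sum>i<Suc b. d' s i * v i x) = w s x - w s j / u j * u x" if "s \<noteq> j" for s x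
  proof -
    have "(\<Sum>i<Suc b. d' s i * v i x) =
      (\<Sum>i<Suc b. (if i < b then d s i else 0) * v i x) - (\<Sum>i<Suc b. w s j / u j * (c i * v i x))"
      using that by (simp add: d'_def left_diff_distrib sum_subtractf mult.assoc)
    then show ?thesis by (simp add: u_def w_def sum_distrib_left del: sum.lessThan_Suc)
      (simp add: w_def)
  qed
  have "(\<Sum>i<Suc b. d' s i * v i t) = (if s = t then 1 else 0)" if "s \<in> insert j T" "t \<in> insert j T" for s t
  proof (cases "s = j")
    case True
    then show ?thesis using that uT j jT by (auto simp: d'j simp del: sum.lessThan_Suc)
  next
    case False
    then have "s \<in> T" using that by blast
    then show ?thesis
      using that False uT d[of s t] j jT by (auto simp: d's w_def simp del: sum.lessThan_Suc)
  qed
  moreover have "insert j T \<subseteq> {..<m}" "card (insert j T) = Suc b"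
    using T j jT fT by auto
  ultimately show ?case by blast
qed

text \<open>A zero entry at \<open>j0\<close> is one linear condition, so at most one of the
  \<open>b + 1\<close> combinations is lost. Either \<open>b\<close> of them satisfy it already, or
  one of them, \<open>t1\<close>, is used to clear the entries at \<open>j0\<close> of the others
  and is then given up.\<close>

lemma dual_coordinates_avoiding:
  fixes v :: "nat \<Rightarrow> nat \<Rightarrow> complex"
  assumes "\<And>c i. (\<forall>j<m. (\<Sum>i<Suc b. c i * v i j) = 0) \<Longrightarrow> i < Suc b \<Longrightarrow> c i = 0"
  shows "\<exists>T d. T \<subseteq> {..<m} - {j0} \<and> card T = b \<and>
    (\<forall>s\<in>T. \<forall>t\<in>T. (\<Sum>i<Suc b. d s i * v i t) = (if s = t then 1 else 0)) \<and>
    (\<forall>s\<in>T. (\<Sum>i<Suc b. d s i * v i j0) = 0)"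
proof -
  have "\<exists>T d. T \<subseteq> {..<m} \<and> card T = Suc b \<and>
    (\<forall>s\<in>T. \<forall>t\<in>T. (\<Sum>i<Suc b. d s i * v i t) = (if s = t then 1 else 0))"
    by (rule dual_coordinates) (rule assms)
  then obtain T d where T: "T \<subseteq> {..<m}" "card T = Suc b"
    and d: "\<And>s t. s \<in> T \<Longrightarrow> t \<in> T \<Longrightarrow> (\<Sum>i<Suc b. d s i * v i t) = (if s = t then 1 else 0)"
    by blast
  define w where "w s x = (\<Sum>i<Suc b. d s i * v i x)" for s x
  have fT: "finite T" using T finite_subset by blast
  show ?thesis
  proof (cases "\<forall>s\<in>T - {j0}. w s j0 = 0")
    case True
    have "b \<le> card (T - {j0})" using T fT by (simp add: card_Diff_singleton_if)
    then obtain T' where T': "T' \<subseteq> T - {j0}" "card T' = b" using obtain_subset_with_card_n by metis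
    have "\<forall>s\<in>T'. \<forall>t\<in>T'. (\<Sum>i<Suc b. d s i * v i t) = (if s = t then 1 else 0)"
      using T' d by blast
    moreover have "\<forall>s\<in>T'. (\<Sum>i<Suc b. d s i * v i j0) = 0"
      using True T' unfolding w_def by blast
    ultimately show ?thesis using T' T by (intro exI[of _ T'] exI[of _ d]) blast
  next
    case False
    then obtain t1 where t1: "t1 \<in> T" "t1 \<noteq> j0" "w t1 j0 \<noteq> 0" by blast
    have "j0 \<notin> T" using d[OF t1(1), of j0] t1 unfolding w_def by auto
    define d' where "d' s i = d s i - w s j0 / w t1 j0 * d t1 i" for s i
    have d': "(\<Sum>i<Suc b. d' s i * v i x) = w s x - w s j0 / w t1 j0 * w t1 x" for s x
      unfolding d'_def w_def[of s x] w_def[of t1 x]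
      by (simp add: left_diff_distrib sum_subtractf sum_distrib_left mult.assoc del: sum.lessThan_Suc)
    have "\<forall>s\<in>T - {t1}. \<forall>t\<in>T - {t1}. (\<Sum>i<Suc b. d' s i * v i t) = (if s = t then 1 else 0)"
      unfolding d' using d t1(1) unfolding w_def[symmetric] by auto
    moreover have "\<forall>s\<in>T - {t1}. (\<Sum>i<Suc b. d' s i * v i j0) = 0"
      unfolding d' using t1 by simp
    moreover have "card (T - {t1}) = b" using T fT t1 by simp
    ultimately show ?thesis
      using T \<open>j0 \<notin> T\<close> by (intro exI[of _ "T - {t1}"] exI[of _ d']) blast
  qed
qed

lemma fps_X_dvd_iff: "fps_X dvd F \<longleftrightarrow> fps_nth F 0 = 0" for F :: "complex fps"
proof
  assume "fps_nth F 0 = 0"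
  then have "F = fps_X * fps_shift 1 F" by (intro fps_ext) auto
  then show "fps_X dvd F" by (metis dvdI)
qed auto

text \<open>A minor of size \<open>m - 1\<close> omits one column \<open>j0\<close>. By
  \<open>dual_coordinates_avoiding\<close>, \<open>b\<close> of the kernel vectors can be taken with
  entry 0 at \<open>j0\<close>, and they remain in the kernel of the constant terms after deletion
  of that column. Each contributes a factor \<open>fps_X\<close>.\<close>

lemma fps_X_power_dvd_minor:
  fixes A :: "complex fps mat" and v :: "nat \<Rightarrow> nat \<Rightarrow> complex"
  assumes indep: "\<And>c i. (\<forall>j<dim_col A. (\<Sum>i<Suc b. c i * v i j) = 0) \<Longrightarrow> i < Suc b \<Longrightarrow> c i = 0"
    and ker: "\<And>r i. r < dim_row A \<Longrightarrow> i < Suc b \<Longrightarrow> (\<Sum>j<dim_col A. fps_nth (A $$ (r, j)) 0 * v i j) = 0"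
    and D: "D \<in> minors (dim_col A - 1) A"
  shows "fps_X ^ b dvd D"
proof -
  define m where "m = dim_col A"
  obtain I J where IJ: "D = Determinant.det (submatrix A I J)" "I \<subseteq> {..<dim_row A}" "J \<subseteq> {..<m}"
    "card I = m - 1" "card J = m - 1"
    using D unfolding minors_def m_def by blast
  \<comment> \<open>Without columns the independence hypothesis would force the coefficient 1 to be
    0. It follows that \<open>J\<close>, with \<open>m - 1\<close> elements, misses exactly one
    column.\<close>
  have "m > 0"
  proof (rule ccontr)
    assume "\<not> m > 0"
    then show False using indep[of "\<lambda>_. 1" 0] by (simp add: m_def)
  qed
  have "card ({..<m} - J) = 1"
    using IJ \<open>m > 0\<close> by (simp add: card_Diff_subset finite_subset[OF IJ(3)])
  then obtain j0 where "{..<m} - J = {j0}" by (metis card_1_singletonE)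
  then have j0: "j0 < m" "J = {..<m} - {j0}" using IJ(3) by auto
  have fJ: "finite J" using j0 by simp
  have "\<exists>T d. T \<subseteq> {..<m} - {j0} \<and> card T = b \<and>
    (\<forall>s\<in>T. \<forall>t\<in>T. (\<Sum>i<Suc b. d s i * v i t) = (if s = t then 1 else 0)) \<and>
    (\<forall>s\<in>T. (\<Sum>i<Suc b. d s i * v i j0) = 0)"
    by (rule dual_coordinates_avoiding) (rule indep[folded m_def])
  then obtain T d where T: "T \<subseteq> J" "card T = b"
    and d: "\<And>s t. s \<in> T \<Longrightarrow> t \<in> T \<Longrightarrow> (\<Sum>i<Suc b. d s i * v i t) = (if s = t then 1 else 0)"
    and d0: "\<And>s. s \<in> T \<Longrightarrow> (\<Sum>i<Suc b. d s i * v i j0) = 0"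
    unfolding j0(2) by blast
  define w where "w s j = (\<Sum>i<Suc b. d s i * v i j)" for s j
  define N where "N = m - 1"
  define M where "M = submatrix A I J"
  have rows: "{i. i < dim_row A \<and> i \<in> I} = I" and cols: "{j. j < dim_col A \<and> j \<in> J} = J"
    using IJ by (auto simp: m_def)
  have M: "M \<in> carrier_mat N N"
    unfolding M_def N_def using IJ by (intro carrier_matI) (simp_all add: dim_submatrix rows cols)
  have Mij: "M $$ (i, j) = A $$ (pick I i, pick J j)" if "i < N" "j < N" for i j
    unfolding M_def using that IJ by (intro submatrix_index) (simp_all add: rows cols N_def)
  have inj: "inj_on (pick J) {..<N}"
    by (rule inj_on_inverseI[where g = "\<lambda>x. card {a\<in>J. a < x}"]) (use IJ in \<open>simp add: card_pick_le N_def\<close>)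
  have im: "pick J ` {..<N} = J"
    by (rule card_subset_eq[OF fJ])
       (use inj IJ in \<open>auto simp: card_image N_def intro: pick_in_set_le\<close>)
  \<comment> \<open>The columns \<open>T\<close> renumbered as columns of the submatrix, which
    \<open>pick J\<close> enumerates in increasing order.\<close>
  define T' where "T' = {j. j < N \<and> pick J j \<in> T}"
  have "pick J ` T' = T" using im T by (auto simp: T'_def image_iff)
  moreover have injT: "inj_on (pick J) T'" by (rule inj_on_subset[OF inj]) (auto simp: T'_def)
  ultimately have cT: "card T' = b" using T(2) card_image[OF injT] by simp
  have "fps_X ^ card T' dvd Determinant.det M"
  proof (rule power_dvd_det[where w = "\<lambda>s j. fps_const (w (pick J s) (pick J j))"])
    show "finite T'" "T' \<subseteq> {..<N}" by (auto simp: T'_def)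
    show "M \<in> carrier_mat N N" by (rule M)
    show "fps_const (w (pick J s) (pick J t)) = (if s = t then 1 else 0)" if "s \<in> T'" "t \<in> T'" for s t
      using that d[of "pick J s" "pick J t"] inj_onD[OF injT] unfolding w_def by (auto simp: T'_def)
    fix i t assume i: "i < N" and t: "t \<in> T'"
    have pi: "pick I i \<in> I" using i IJ by (intro pick_in_set_le) (simp add: N_def)
    have pt: "pick J t \<in> T" using t by (simp add: T'_def)
    have "fps_nth (\<Sum>j<N. M $$ (i, j) * fps_const (w (pick J t) (pick J j))) 0 =
      (\<Sum>j<N. fps_nth (A $$ (pick I i, pick J j)) 0 * w (pick J t) (pick J j))"
      using i by (simp add: fps_sum_nth Mij)
    also have "\<dots> = (\<Sum>j\<in>J. fps_nth (A $$ (pick I i, j)) 0 * w (pick J t) j)"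
      using sum.reindex[OF inj, of "\<lambda>j. fps_nth (A $$ (pick I i, j)) 0 * w (pick J t) j"] by (simp add: im)
    \<comment> \<open>The omitted column may be added back because the vector is 0 at
      \<open>j0\<close>; only for the full row is the kernel hypothesis available.\<close>
    also have "\<dots> = (\<Sum>j<m. fps_nth (A $$ (pick I i, j)) 0 * w (pick J t) j)"
      using d0[OF pt] by (intro sum.mono_neutral_left) (auto simp: j0 w_def)
    also have "\<dots> = (\<Sum>k<Suc b. d (pick J t) k * (\<Sum>j<m. fps_nth (A $$ (pick I i, j)) 0 * v k j))"
      unfolding w_def sum_distrib_left by (subst sum.swap) (simp add: mult_ac del: sum.lessThan_Suc)
    also have "\<dots> = 0"
      using ker pi IJ(2) by (intro sum.neutral) (auto simp: m_def)
    finally show "fps_X dvd (\<Sum>j<N. M $$ (i, j) * fps_const (w (pick J t) (pick J j)))"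
      by (simp add: fps_X_dvd_iff)
  qed
  then show ?thesis by (simp add: cT IJ(1) M_def)
qed

lemma (in comm_ring_hom) hom_minors:
  "D \<in> minors k M \<Longrightarrow> hom D \<in> minors k (map_mat hom M)"
proof -
  assume "D \<in> minors k M"
  then obtain I J where IJ: "D = Determinant.det (submatrix M I J)" "I \<subseteq> {..<dim_row M}" "J \<subseteq> {..<dim_col M}"
    "card I = k" "card J = k"
    unfolding minors_def by blast
  have "map_mat hom (submatrix M I J) = submatrix (map_mat hom M) I J"
    by (intro eq_matI) (auto simp: submatrix_def pick_le)
  then have "hom D = Determinant.det (submatrix (map_mat hom M) I J)"
    using IJ(1) hom_det[of "submatrix M I J"] by simp
  then show ?thesis unfolding minors_def using IJ by auto
qed

lemma fps_X_power_dvd_ideal: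
  fixes h :: "'r::comm_ring_1 \<Rightarrow> complex fps" and M :: "'r mat"
  assumes h: "comm_ring_hom h"
    and indep: "\<And>c i. (\<forall>j<dim_col M. (\<Sum>i<Suc b. c i * v i j) = 0) \<Longrightarrow> i < Suc b \<Longrightarrow> c i = 0"
    and ker: "\<And>r i. r < dim_row M \<Longrightarrow> i < Suc b \<Longrightarrow> (\<Sum>j<dim_col M. fps_nth (h (M $$ (r, j))) 0 * v i j) = 0"
    and x: "x \<in> alexander_ideal_of M"
  shows "fps_X ^ b dvd h x"
proof -
  interpret comm_ring_hom h by fact
  show ?thesis using x unfolding alexander_ideal_of_def
  proof (induction rule: ideal_gen_induct)
    case (base D)
    have "h D \<in> minors (dim_col (map_mat h M) - 1) (map_mat h M)" using hom_minors[OF base] by simp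
    then show ?case
      by (rule fps_X_power_dvd_minor[rotated 2]) (use indep ker in auto)
  qed (simp_all add: hom_add hom_mult dvd_add dvd_mult)
qed

section \<open>Twisted first homology\<close>

interpretation cfun: vector_space_pair cscale "(*) :: complex \<Rightarrow> complex \<Rightarrow> complex"
  by standard (simp_all add: algebra_simps)

lemma cscale_single: "cscale c (Poly_Mapping.single u d) = Poly_Mapping.single u (c * d)"
  by (rule poly_mapping_eqI) (simp add: lookup_cscale lookup_single when_def)

lemma cscale_sum_right: "cscale c (\<Sum>i\<in>I. x i) = (\<Sum>i\<in>I. cscale c (x i))"
  by (induction I rule: infinite_finite_induct) (simp_all add: cscale.scale_right_distrib)

lemma bar_d1_eq_pm_eval: "bar_d1 \<rho> = pm_eval (\<lambda>c. c) (\<lambda>g. \<rho> g - 1)"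
  by (simp add: bar_d1_def pm_eval_def fun_eq_iff)

lemma bar_d1_add: "bar_d1 \<rho> (c + d) = bar_d1 \<rho> c + bar_d1 \<rho> d"
  unfolding bar_d1_eq_pm_eval by (rule pm_eval_add) simp_all

lemma bar_d1_cscale: "bar_d1 \<rho> (cscale a c) = a * bar_d1 \<rho> c"
proof -
  have "Poly_Mapping.keys (cscale a c) \<subseteq> Poly_Mapping.keys c"
    by (auto simp: in_keys_iff lookup_cscale)
  then show ?thesis
    by (simp add: bar_d1_eq_pm_eval pm_eval_superset[of "Poly_Mapping.keys c"] lookup_cscale
        sum_distrib_left mult.assoc)
qed

lemma bar_d1_single: "bar_d1 \<rho> (Poly_Mapping.single g a) = a * (\<rho> g - 1)"
  by (simp add: bar_d1_def)

lemma linear_bar_d1: "Vector_Spaces.linear cscale (*) (bar_d1 \<rho>)"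
  by unfold_locales (simp_all add: bar_d1_add bar_d1_cscale)

definition bar_relator :: "('g::group_add \<Rightarrow> complex) \<Rightarrow> 'g \<times> 'g \<Rightarrow> ('g \<Rightarrow>\<^sub>0 complex)" where
  "bar_relator \<rho> = (\<lambda>(g, h). Poly_Mapping.single h (\<rho> g) - Poly_Mapping.single (g + h) 1 + Poly_Mapping.single g 1)"

lemma bar_d2_relator:
  "bar_d2 \<rho> c = (\<Sum>x\<in>Poly_Mapping.keys c. cscale (Poly_Mapping.lookup c x) (bar_relator \<rho> x))"
  unfolding bar_d2_def bar_relator_def by (intro sum.cong) auto

text \<open>Writing the boundaries as a span reduces statements about all of them to the images of
  the basis elements \<open>[g|h]\<close>.\<close>

lemma range_bar_d2: "range (bar_d2 \<rho>) = cscale.span (range (bar_relator \<rho>))"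
proof (intro equalityI subsetI)
  fix y assume "y \<in> range (bar_d2 \<rho>)"
  then obtain c where "y = bar_d2 \<rho> c" by blast
  then show "y \<in> cscale.span (range (bar_relator \<rho>))"
    unfolding bar_d2_relator by (simp add: cscale.span_sum cscale.span_scale cscale.span_base)
next
  have sup: "bar_d2 \<rho> c = (\<Sum>x\<in>A. cscale (Poly_Mapping.lookup c x) (bar_relator \<rho> x))"
    if "finite A" "Poly_Mapping.keys c \<subseteq> A" for A c
    unfolding bar_d2_relator using that by (intro sum.mono_neutral_left) (auto simp: in_keys_iff)
  have sub: "cscale.subspace (range (bar_d2 \<rho>))"
  proof (rule cscale.subspaceI)
    show "0 \<in> range (bar_d2 \<rho>)" by (intro range_eqI[of _ _ 0]) (simp add: bar_d2_relator)
    fix x y a assume "x \<in> range (bar_d2 \<rho>)"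
    then obtain c where c: "x = bar_d2 \<rho> c" by blast
    have "Poly_Mapping.keys (cscale a c) \<subseteq> Poly_Mapping.keys c"
      by (auto simp: in_keys_iff lookup_cscale)
    then have "cscale a x = bar_d2 \<rho> (cscale a c)"
      unfolding c by (simp add: sup[of "Poly_Mapping.keys c"] cscale_sum_right lookup_cscale)
    then show "cscale a x \<in> range (bar_d2 \<rho>)" by blast
    assume "y \<in> range (bar_d2 \<rho>)"
    then obtain d where d: "y = bar_d2 \<rho> d" by blast
    have "finite (Poly_Mapping.keys c \<union> Poly_Mapping.keys d)" by simp
    note sup' = sup[OF this]
    have "x + y = bar_d2 \<rho> (c + d)"
      unfolding c d using Poly_Mapping.keys_add[of c d]
      by (simp add: sup' lookup_add cscale.scale_left_distrib sum.distrib)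
    then show "x + y \<in> range (bar_d2 \<rho>)" by blast
  qed
  have base: "range (bar_relator \<rho>) \<subseteq> range (bar_d2 \<rho>)"
  proof
    fix y assume "y \<in> range (bar_relator \<rho>)"
    then obtain x where "y = bar_relator \<rho> x" by blast
    then have "y = bar_d2 \<rho> (Poly_Mapping.single x 1)" by (simp add: bar_d2_relator)
    then show "y \<in> range (bar_d2 \<rho>)" by blast
  qed
  fix y assume "y \<in> cscale.span (range (bar_relator \<rho>))"
  then show "y \<in> range (bar_d2 \<rho>)" using cscale.span_minimal[OF base sub] by blast
qed

lemma bar_d1_range_bar_d2:
  assumes "\<rho> \<in> characters" "y \<in> range (bar_d2 \<rho>)"
  shows "bar_d1 \<rho> y = 0"
proof -
  interpret d1: Vector_Spaces.linear cscale "(*)" "bar_d1 \<rho>" by (rule linear_bar_d1)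
  have "bar_d1 \<rho> (bar_relator \<rho> x) = 0" for x
    using assms(1)
    by (cases x) (simp add: bar_relator_def d1.add d1.diff bar_d1_single characters_def algebra_simps)
  then have "range (bar_relator \<rho>) \<subseteq> {y. bar_d1 \<rho> y = 0}" by blast
  moreover have "cscale.subspace {y. bar_d1 \<rho> y = 0}"
    by (rule cscale.subspaceI) (simp_all add: d1.zero d1.add d1.scale)
  ultimately have "cscale.span (range (bar_relator \<rho>)) \<subseteq> {y. bar_d1 \<rho> y = 0}"
    by (rule cscale.span_minimal)
  then show ?thesis using assms(2) unfolding range_bar_d2 by blast
qed

text \<open>A basis of \<open>B\<close> is extended to one of \<open>Z\<close>, and the added
  vectors represent a basis of the quotient. Existence gives meaning to the choice made in
  \<open>quotient_dim\<close>.\<close>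

lemma basis_modulo_exists:
  fixes Z B :: "('a \<Rightarrow>\<^sub>0 complex) set"
  assumes Z: "cscale.subspace Z" and B: "cscale.subspace B" and "B \<subseteq> Z"
  shows "\<exists>S. basis_modulo cscale Z B S"
proof -
  obtain BB where BB: "BB \<subseteq> B" "cscale.independent BB" "B \<subseteq> cscale.span BB"
    using cscale.maximal_independent_subset by blast
  have span: "cscale.span BB = B"
    using BB B by (intro equalityI cscale.span_minimal)
  obtain D where D: "BB \<subseteq> D" "D \<subseteq> Z" "cscale.independent D" "Z \<subseteq> cscale.span D"
    using cscale.maximal_independent_subset_extend[of BB Z] BB assms(3) by blast
  define S where "S = D - BB"
  have "\<forall>z\<in>Z. \<exists>T c. finite T \<and> T \<subseteq> S \<and> z - (\<Sum>s\<in>T. cscale (c s) s) \<in> B"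
  proof
    fix z assume "z \<in> Z"
    then have "z \<in> cscale.span D" using D by blast
    then obtain t r where t: "finite t" "t \<subseteq> D" "z = (\<Sum>a\<in>t. cscale (r a) a)"
      unfolding cscale.span_explicit by blast
    have "z = (\<Sum>a\<in>t \<inter> S. cscale (r a) a) + (\<Sum>a\<in>t - S. cscale (r a) a)"
      unfolding t(3) by (rule sum.Int_Diff) (rule t(1))
    moreover have "(\<Sum>a\<in>t - S. cscale (r a) a) \<in> B"
      unfolding span[symmetric] using t(2)
      by (intro cscale.span_sum cscale.span_scale cscale.span_base) (auto simp: S_def)
    ultimately have "z - (\<Sum>a\<in>t \<inter> S. cscale (r a) a) \<in> B" by simp
    then show "\<exists>T c. finite T \<and> T \<subseteq> S \<and> z - (\<Sum>s\<in>T. cscale (c s) s) \<in> B"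
      using t by (intro exI[of _ "t \<inter> S"] exI[of _ r]) auto
  qed
  moreover have "\<forall>T c. finite T \<and> T \<subseteq> S \<and> (\<Sum>s\<in>T. cscale (c s) s) \<in> B \<longrightarrow> (\<forall>s\<in>T. c s = 0)"
  proof (intro allI impI)
    fix T and c :: "('a \<Rightarrow>\<^sub>0 complex) \<Rightarrow> complex"
    assume "finite T \<and> T \<subseteq> S \<and> (\<Sum>s\<in>T. cscale (c s) s) \<in> B"
    then have T: "finite T" "T \<subseteq> S" "(\<Sum>s\<in>T. cscale (c s) s) \<in> B" by blast+
    have "(\<Sum>s\<in>T. cscale (c s) s) \<in> cscale.span BB" using T span by simp
    then obtain t r where t: "finite t" "t \<subseteq> BB" "(\<Sum>s\<in>T. cscale (c s) s) = (\<Sum>a\<in>t. cscale (r a) a)"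
      unfolding cscale.span_explicit by blast
    define u where "u a = (if a \<in> T then c a else - r a)" for a
    have disj: "T \<inter> t = {}" using T t by (auto simp: S_def)
    have "(\<Sum>a\<in>T \<union> t. cscale (u a) a) = (\<Sum>a\<in>T. cscale (u a) a) + (\<Sum>a\<in>t. cscale (u a) a)"
      using T t disj by (intro sum.union_disjoint) auto
    also have "(\<Sum>a\<in>T. cscale (u a) a) = (\<Sum>s\<in>T. cscale (c s) s)" by (simp add: u_def)
    also have "(\<Sum>a\<in>t. cscale (u a) a) = (\<Sum>a\<in>t. - cscale (r a) a)"
      using disj by (intro sum.cong) (auto simp: u_def)
    finally have "(\<Sum>a\<in>T \<union> t. cscale (u a) a) = 0" by (simp add: t(3) sum_negf)
    moreover have "T \<union> t \<subseteq> D" using T t D by (auto simp: S_def)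
    ultimately have "\<forall>a\<in>T \<union> t. u a = 0"
      using D(3) T(1) t(1) unfolding cscale.independent_explicit_finite_subsets by (meson finite_UnI)
    then show "\<forall>s\<in>T. c s = 0" unfolding u_def by (metis UnI1)
  qed
  moreover have "S \<subseteq> Z" using D by (auto simp: S_def)
  ultimately have "basis_modulo cscale Z B S" unfolding basis_modulo_def by (intro conjI)
  then show ?thesis by (rule exI)
qed

lemma twisted_b1_basis:
  assumes "\<rho> \<in> characters"
  shows "\<exists>S. basis_modulo cscale {c. bar_d1 \<rho> c = 0} (range (bar_d2 \<rho>)) S \<and> twisted_b1 \<rho> = card S"
proof -
  interpret d1: Vector_Spaces.linear cscale "(*)" "bar_d1 \<rho>" by (rule linear_bar_d1)
  have "\<exists>S. basis_modulo cscale {c. bar_d1 \<rho> c = 0} (range (bar_d2 \<rho>)) S"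
  proof (rule basis_modulo_exists)
    show "cscale.subspace {c. bar_d1 \<rho> c = 0}"
      by (rule cscale.subspaceI) (simp_all add: d1.zero d1.add d1.scale)
    show "cscale.subspace (range (bar_d2 \<rho>))" unfolding range_bar_d2 by (rule cscale.subspace_span)
    show "range (bar_d2 \<rho>) \<subseteq> {c. bar_d1 \<rho> c = 0}" using bar_d1_range_bar_d2[OF assms] by blast
  qed
  from someI_ex[OF this] show ?thesis unfolding twisted_b1_def quotient_dim_def by blast
qed

text \<open>Vectors independent modulo \<open>B\<close> remain independent together with a basis of
  \<open>B\<close>, so a functional can be prescribed freely on this larger set.\<close>

lemma dual_functionals:
  fixes s :: "nat \<Rightarrow> 'a \<Rightarrow>\<^sub>0 complex"
  assumes B: "cscale.subspace B"
    and indep: "\<And>c i. (\<Sum>i<b. cscale (c i) (s i)) \<in> B \<Longrightarrow> i < b \<Longrightarrow> c i = 0"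
  shows "\<exists>F. \<forall>i<b. Vector_Spaces.linear cscale (*) (F i) \<and> (\<forall>x\<in>B. F i x = 0) \<and>
    (\<forall>j<b. F i (s j) = (if i = j then 1 else 0))"
proof -
  obtain BB where BB: "BB \<subseteq> B" "cscale.independent BB" "B \<subseteq> cscale.span BB"
    using cscale.maximal_independent_subset by blast
  have span: "cscale.span BB = B"
    using BB B by (intro equalityI cscale.span_minimal)
  have inj: "inj_on s {..<b}"
  proof (rule inj_onI, rule ccontr)
    fix i j assume ij: "i \<in> {..<b}" "j \<in> {..<b}" "s i = s j" "i \<noteq> j"
    define c where "c k = (if k = i then 1 else if k = j then - 1 else 0 :: complex)" for k
    have "(\<Sum>k<b. cscale (c k) (s k)) = (\<Sum>k\<in>{i, j}. cscale (c k) (s k))"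
      using ij by (intro sum.mono_neutral_right) (auto simp: c_def)
    also have "\<dots> = 0" using ij by (simp add: c_def)
    finally have "c i = 0" using indep[of c i] ij cscale.subspace_0[OF B] by simp
    then show False by (simp add: c_def)
  qed
  have sB: "s i \<notin> B" if "i < b" for i
  proof
    assume "s i \<in> B"
    define c where "c k = (if k = i then 1 else 0 :: complex)" for k
    have "(\<Sum>k<b. cscale (c k) (s k)) = (\<Sum>k\<in>{i}. cscale (c k) (s k))"
      using that by (intro sum.mono_neutral_right) (auto simp: c_def)
    then show False using indep[of c i] that \<open>s i \<in> B\<close> by (simp add: c_def)
  qed
  define D where "D = BB \<union> s ` {..<b}"
  have "cscale.independent D"
    unfolding cscale.independent_explicit_finite_subsets
  proof (intro allI impI)
    fix t u assume t: "t \<subseteq> D" "finite t" "(\<Sum>v\<in>t. cscale (u v) v) = 0"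
    define c where "c i = (if s i \<in> t then u (s i) else 0)" for i
    have split: "(\<Sum>v\<in>t. cscale (u v) v) = (\<Sum>v\<in>t \<inter> BB. cscale (u v) v) + (\<Sum>v\<in>t - BB. cscale (u v) v)"
      by (rule sum.Int_Diff) (rule t(2))
    have "t - BB = t \<inter> s ` {..<b}" using t(1) sB BB(1) by (auto simp: D_def)
    then have "(\<Sum>v\<in>t - BB. cscale (u v) v) = (\<Sum>v\<in>s ` {..<b}. if v \<in> t then cscale (u v) v else 0)"
      using sum.inter_restrict[of "s ` {..<b}" "\<lambda>v. cscale (u v) v" t] by (simp add: Int_commute)
    also have "\<dots> = (\<Sum>i<b. cscale (c i) (s i))"
      unfolding sum.reindex[OF inj] by (intro sum.cong) (auto simp: c_def)
    finally have eq: "(\<Sum>v\<in>t - BB. cscale (u v) v) = (\<Sum>i<b. cscale (c i) (s i))" .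
    have "(\<Sum>v\<in>t \<inter> BB. cscale (u v) v) \<in> B"
      unfolding span[symmetric] by (intro cscale.span_sum cscale.span_scale cscale.span_base) auto
    moreover have "(\<Sum>v\<in>t - BB. cscale (u v) v) = - (\<Sum>v\<in>t \<inter> BB. cscale (u v) v)"
      using split t(3) by (simp add: eq_neg_iff_add_eq_0 add.commute)
    ultimately have "(\<Sum>v\<in>t - BB. cscale (u v) v) \<in> B"
      by (simp add: cscale.subspace_neg[OF B])
    then have "(\<Sum>i<b. cscale (c i) (s i)) \<in> B" unfolding eq .
    then have c0: "c i = 0" if "i < b" for i using indep that by blast
    then have "(\<Sum>v\<in>t \<inter> BB. cscale (u v) v) = 0" using eq split t(3) by simp
    then have "\<forall>v\<in>t \<inter> BB. u v = 0"
      using BB(2) t(2) unfolding cscale.independent_explicit_finite_subsets by (meson Int_lower2 finite_Int)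
    moreover have "u v = 0" if "v \<in> t" "v \<in> s ` {..<b}" for v
    proof -
      obtain i where "i < b" "v = s i" using \<open>v \<in> s ` {..<b}\<close> by blast
      then show ?thesis using c0[of i] that(1) by (simp add: c_def)
    qed
    ultimately show "\<forall>v\<in>t. u v = 0" using t(1) by (auto simp: D_def)
  qed
  have "\<exists>g. Vector_Spaces.linear cscale (*) g \<and> (\<forall>x\<in>B. g x = 0) \<and>
    (\<forall>j<b. g (s j) = (if i = j then 1 else (0::complex)))" if "i < b" for i
  proof -
    obtain g where g: "Vector_Spaces.linear cscale (*) g" "\<And>x. x \<in> D \<Longrightarrow> g x = (if x = s i then 1 else (0::complex))"
      using cfun.linear_independent_extend[OF \<open>cscale.independent D\<close>, of "\<lambda>x. if x = s i then 1 else 0"] by blast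
    interpret g: Vector_Spaces.linear cscale "(*)" g by fact
    have "cscale.span BB \<subseteq> {x. g x = 0}"
    proof (rule cscale.span_minimal)
      show "BB \<subseteq> {x. g x = 0}"
      proof
        fix x assume x: "x \<in> BB"
        then have "x \<noteq> s i" using BB(1) sB[OF \<open>i < b\<close>] by blast
        then show "x \<in> {x. g x = 0}" using g(2)[of x] x by (simp add: D_def)
      qed
      show "cscale.subspace {x. g x = 0}"
        by (rule cscale.subspaceI) (simp_all add: g.zero g.add g.scale)
    qed
    then have "g x = 0" if "x \<in> B" for x using that unfolding span by blast
    moreover have "g (s j) = (if i = j then 1 else 0)" if "j < b" for j
      using g(2)[of "s j"] that \<open>i < b\<close> inj by (auto simp: D_def inj_on_def)
    ultimately show ?thesis using g(1) by blast
  qed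
  then have "\<forall>i. \<exists>g. i < b \<longrightarrow> Vector_Spaces.linear cscale (*) g \<and> (\<forall>x\<in>B. g x = 0) \<and>
    (\<forall>j<b. g (s j) = (if i = j then 1 else (0::complex)))" by blast
  then show ?thesis by (rule choice)
qed

text \<open>A 1-cocycle with values in the rank one module: the cocycle identity is the vanishing of
  a functional on the boundary of \<open>[g|h]\<close>.\<close>

definition crossed_hom :: "('g::group_add \<Rightarrow> complex) \<Rightarrow> ('g \<Rightarrow> complex) \<Rightarrow> bool" where
  "crossed_hom \<rho> \<delta> \<longleftrightarrow> (\<forall>g h. \<delta> (g + h) = \<delta> g + \<rho> g * \<delta> h)"

lemma crossed_hom_functional:
  assumes "Vector_Spaces.linear cscale (*) F" "\<And>x. x \<in> range (bar_d2 \<rho>) \<Longrightarrow> F x = 0"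
  shows "crossed_hom \<rho> (\<lambda>g. F (Poly_Mapping.single g 1))"
  unfolding crossed_hom_def
proof (intro allI)
  fix g h
  interpret F: Vector_Spaces.linear cscale "(*)" F by fact
  have "bar_relator \<rho> (g, h) \<in> range (bar_d2 \<rho>)"
    unfolding range_bar_d2 by (intro cscale.span_base) auto
  then have "F (bar_relator \<rho> (g, h)) = 0" by (rule assms(2))
  moreover have "F (Poly_Mapping.single h (\<rho> g)) = \<rho> g * F (Poly_Mapping.single h 1)"
    using F.scale[of "\<rho> g" "Poly_Mapping.single h 1"] by (simp add: cscale_single)
  ultimately show "F (Poly_Mapping.single (g + h) 1) =
    F (Poly_Mapping.single g 1) + \<rho> g * F (Poly_Mapping.single h 1)"
    by (simp add: bar_relator_def F.add F.diff algebra_simps)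
qed

lemma functional_expansion:
  assumes "Vector_Spaces.linear cscale (*) F"
  shows "F x = (\<Sum>g\<in>Poly_Mapping.keys x. Poly_Mapping.lookup x g * F (Poly_Mapping.single g 1))"
proof -
  interpret F: Vector_Spaces.linear cscale "(*)" F by fact
  have "F (Poly_Mapping.single g c) = c * F (Poly_Mapping.single g 1)" for g c
    using F.scale[of c "Poly_Mapping.single g 1"] by (simp add: cscale_single)
  then have "(\<Sum>g\<in>Poly_Mapping.keys x. F (Poly_Mapping.single g (Poly_Mapping.lookup x g))) =
    (\<Sum>g\<in>Poly_Mapping.keys x. Poly_Mapping.lookup x g * F (Poly_Mapping.single g 1))"
    by (intro sum.cong refl)
  moreover have "F x = F (\<Sum>g\<in>Poly_Mapping.keys x. Poly_Mapping.single g (Poly_Mapping.lookup x g))"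
    using poly_mapping_sum_single[of x] by (rule arg_cong)
  ultimately show ?thesis by (simp only: F.sum)
qed

text \<open>Off the trivial character \<open>\<partial>\<^sub>1\<close> is onto, so \<open>C\<^sub>1 / B\<^sub>1\<close> has dimension \<open>b\<^sub>1(G, \<rho>) + 1\<close>, and its dual
  is the space of crossed homomorphisms.\<close>
lemma crossed_homs_independent:
  assumes \<rho>: "\<rho> \<in> characters" and g0: "\<rho> g0 \<noteq> 1"
    and b: "basis_modulo cscale {c. bar_d1 \<rho> c = 0} (range (bar_d2 \<rho>)) S" "finite S" "card S = b"
  shows "\<exists>\<delta>. (\<forall>i<Suc b. crossed_hom \<rho> (\<delta> i)) \<and>
    (\<forall>c. (\<forall>g. (\<Sum>i<Suc b. c i * \<delta> i g) = 0) \<longrightarrow> (\<forall>i<Suc b. c i = 0))"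
proof -
  obtain s' where s': "bij_betw s' {..<b} S"
    using b(2,3) ex_bij_betw_nat_finite[of S] by (auto simp: lessThan_atLeast0)
  \<comment> \<open>The last vector is the chain \<open>[g0]\<close>, not a cycle since its boundary
    is \<open>\<rho> g0 - 1 \<noteq> 0\<close>. Applying \<open>bar_d1\<close> to a relation
    therefore isolates its coefficient, and the others vanish by the choice of
    \<open>S\<close>.\<close>
  define s where "s i = (if i < b then s' i else Poly_Mapping.single g0 1)" for i
  have B: "cscale.subspace (range (bar_d2 \<rho>))" unfolding range_bar_d2 by (rule cscale.subspace_span)
  interpret d1: Vector_Spaces.linear cscale "(*)" "bar_d1 \<rho>" by (rule linear_bar_d1)
  have indep: "c i = 0" if c: "(\<Sum>i<Suc b. cscale (c i) (s i)) \<in> range (bar_d2 \<rho>)" "i < Suc b" for c i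
  proof -
    have sS: "s i \<in> S" if "i < b" for i using that s' by (auto simp: s_def bij_betw_def)
    then have "bar_d1 \<rho> (s i) = 0" if "i < b" for i
      using that b(1) unfolding basis_modulo_def by blast
    then have "bar_d1 \<rho> (\<Sum>i<Suc b. cscale (c i) (s i)) = c b * (\<rho> g0 - 1)"
      by (simp add: d1.add d1.sum d1.scale s_def bar_d1_single)
    then have "c b = 0" using bar_d1_range_bar_d2[OF \<rho> c(1)] g0 by simp
    then have "(\<Sum>i<b. cscale (c i) (s' i)) \<in> range (bar_d2 \<rho>)" using c(1) by (simp add: s_def)
    also have "(\<Sum>i<b. cscale (c i) (s' i)) = (\<Sum>x\<in>S. cscale (c (the_inv_into {..<b} s' x)) x)"
      using s' by (intro sum.reindex_bij_witness[of _ "the_inv_into {..<b} s'" s'])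
        (auto simp: bij_betw_def the_inv_into_f_f f_the_inv_into_f intro: the_inv_into_into)
    finally have sum: "(\<Sum>x\<in>S. cscale (c (the_inv_into {..<b} s' x)) x) \<in> range (bar_d2 \<rho>)" .
    have clause: "\<forall>x\<in>T. a x = 0"
      if "finite T" "T \<subseteq> S" "(\<Sum>x\<in>T. cscale (a x) x) \<in> range (bar_d2 \<rho>)" for T a
      using b(1) that unfolding basis_modulo_def by blast
    have c0: "\<forall>x\<in>S. c (the_inv_into {..<b} s' x) = 0"
      by (rule clause[OF b(2) order_refl sum])
    have "c i = 0" if "i < b" for i
    proof -
      have "s' i \<in> S" using that s' by (auto simp: bij_betw_def)
      then have "c (the_inv_into {..<b} s' (s' i)) = 0" using c0 by blast
      then show ?thesis using that s' by (simp add: bij_betw_def the_inv_into_f_f)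
    qed
    then show ?thesis using \<open>c b = 0\<close> c(2) by (cases "i = b") auto
  qed
  have "\<exists>F. \<forall>i<Suc b. Vector_Spaces.linear cscale (*) (F i) \<and> (\<forall>x\<in>range (bar_d2 \<rho>). F i x = 0) \<and>
    (\<forall>j<Suc b. F i (s j) = (if i = j then 1 else 0))"
    by (rule dual_functionals[OF B]) (rule indep)
  then obtain F where F: "\<And>i. i < Suc b \<Longrightarrow> Vector_Spaces.linear cscale (*) (F i)"
    "\<And>i x. i < Suc b \<Longrightarrow> x \<in> range (bar_d2 \<rho>) \<Longrightarrow> F i x = 0"
    "\<And>i j. i < Suc b \<Longrightarrow> j < Suc b \<Longrightarrow> F i (s j) = (if i = j then 1 else 0)"
    by blast
  define \<delta> where "\<delta> i g = F i (Poly_Mapping.single g 1)" for i g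
  have "crossed_hom \<rho> (\<delta> i)" if "i < Suc b" for i
    unfolding \<delta>_def using crossed_hom_functional[OF F(1)[OF that] F(2)[OF that]] .
  moreover have "c j = 0" if c: "\<forall>g. (\<Sum>i<Suc b. c i * \<delta> i g) = 0" and j: "j < Suc b" for c j
  proof -
    have "c j = (\<Sum>i<Suc b. c i * F i (s j))"
      using j by (simp add: F(3) if_distrib cong: if_cong del: sum.lessThan_Suc)
    also have "\<dots> = (\<Sum>i<Suc b. \<Sum>g\<in>Poly_Mapping.keys (s j). Poly_Mapping.lookup (s j) g * (c i * \<delta> i g))"
    proof (rule sum.cong[OF refl])
      fix i assume "i \<in> {..<Suc b}"
      then have "F i (s j) = (\<Sum>g\<in>Poly_Mapping.keys (s j). Poly_Mapping.lookup (s j) g * \<delta> i g)"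
        unfolding \<delta>_def by (intro functional_expansion F) simp
      then show "c i * F i (s j) =
        (\<Sum>g\<in>Poly_Mapping.keys (s j). Poly_Mapping.lookup (s j) g * (c i * \<delta> i g))"
        by (simp add: sum_distrib_left mult_ac)
    qed
    also have "\<dots> = (\<Sum>g\<in>Poly_Mapping.keys (s j). Poly_Mapping.lookup (s j) g * (\<Sum>i<Suc b. c i * \<delta> i g))"
      unfolding sum_distrib_left by (rule sum.swap)
    also have "\<dots> = 0" using c by simp
    finally show ?thesis .
  qed
  ultimately show ?thesis by blast
qed

section \<open>The Alexander module\<close>

lemma abf_proj_add: "abf_proj (g + h) = abf_proj g + abf_proj h"
  by (simp add: abf_proj_def plus_ab.abs_eq plus_mod_torsion.abs_eq)

lemma abf_proj_surj: "\<exists>g. abf_proj g = u"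
proof -
  obtain a where "u = abs_mod_torsion a" using mod_torsion.abs_induct[of "\<lambda>u. \<exists>a. u = abs_mod_torsion a" u] by blast
  moreover obtain g where "a = abs_ab g" using ab.abs_induct[of "\<lambda>a. \<exists>g. a = abs_ab g" a] by blast
  ultimately show ?thesis by (auto simp: abf_proj_def)
qed

lemma character_abf_proj: "\<sigma> \<in> characters \<Longrightarrow> \<sigma> \<circ> abf_proj \<in> characters"
  by (simp add: characters_def abf_proj_add)

section \<open>Fox calculus and functionals on the tensor product\<close>

lemma pm_eval_of_int_add:
  "pm_eval of_int \<delta> (x + y) = pm_eval of_int \<delta> x + (pm_eval of_int \<delta> y :: complex)"
  by (rule pm_eval_add) simp_all

lemma pm_eval_of_int_uminus: "pm_eval of_int \<delta> (- x) = - (pm_eval of_int \<delta> x :: complex)"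
  using pm_eval_of_int_add[of \<delta> x "- x"] by (simp add: pm_eval_def[of _ _ 0] eq_neg_iff_add_eq_0 add.commute)

lemma pm_eval_of_int_diff:
  "pm_eval of_int \<delta> (x - y) = pm_eval of_int \<delta> x - (pm_eval of_int \<delta> y :: complex)"
  using pm_eval_of_int_add[of \<delta> x "- y"] pm_eval_of_int_uminus[of \<delta> y] by simp

lemma pm_eval_of_int_frag_of: "pm_eval of_int \<delta> (frag_of a) = (\<delta> a :: complex)"
  by (simp add: pm_eval_single)

lemma augmentation_single: "augmentation (Poly_Mapping.single g c) = c"
  by (simp add: augmentation_def)

text \<open>The product rule of Fox calculus. On the augmentation ideal the second summand vanishes,
  so a crossed homomorphism is there linear over the group ring; this makes the balancing relations
  of the tensor product hold.\<close>

lemma pm_eval_crossed_hom_mult: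
  assumes "crossed_hom \<rho> \<delta>"
  shows "pm_eval of_int \<delta> (r * x) =
    pm_eval of_int \<rho> r * pm_eval of_int \<delta> x + (pm_eval of_int \<delta> r :: complex) * of_int (augmentation x)"
proof (induction r rule: poly_mapping_single_induct)
  case (single g c)
  show ?case
  proof (induction x rule: poly_mapping_single_induct)
    case (single h d)
    have "\<delta> (g + h) = \<delta> g + \<rho> g * \<delta> h" using assms by (simp add: crossed_hom_def)
    then show ?case by (simp add: mult_single pm_eval_single augmentation_single algebra_simps)
  qed (simp add: distrib_left pm_eval_of_int_add augmentation_add algebra_simps)
qed (simp add: distrib_right pm_eval_of_int_add algebra_simps)

lemma eval_group_ring_proj:
  assumes "\<sigma> \<in> characters"
  shows "eval_char (complexify (group_ring_proj r)) \<sigma> = pm_eval of_int (\<sigma> \<circ> abf_proj) r"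
proof -
  interpret C: comm_ring_hom complexify by (rule comm_ring_hom_complexify)
  interpret s: comm_ring_hom "\<lambda>f. eval_char f \<sigma>" by (rule comm_ring_hom_eval_char[OF assms])
  show ?thesis
  proof (induction r rule: frag_induction[of _ UNIV, OF subset_UNIV])
    case (2 g)
    show ?case
      by (simp add: group_ring_proj_def pm_eval_of_int_frag_of)
         (simp add: complexify_single eval_char_eq_pm_eval pm_eval_single)
  next
    case (3 a b)
    then show ?case
      by (simp add: group_ring_proj_def frag_extend_diff C.hom_minus s.hom_minus pm_eval_of_int_diff)
  qed (simp add: group_ring_proj_def pm_eval_def C.hom_zero s.hom_zero)
qed

definition tensor_functional ::
    "('g::group_add abf \<Rightarrow> complex) \<Rightarrow> ('g \<Rightarrow> complex) \<Rightarrow> 'g tensor_free \<Rightarrow> complex" where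
  "tensor_functional \<sigma> \<delta> =
     pm_eval of_int (\<lambda>(p, y). eval_char (complexify p) \<sigma> * pm_eval of_int \<delta> (Rep_aug y))"

lemma tensor_functional_span:
  assumes \<sigma>: "\<sigma> \<in> characters" and \<delta>: "crossed_hom (\<sigma> \<circ> abf_proj) \<delta>"
    and "x \<in> group_span tensor_gens"
  shows "tensor_functional \<sigma> \<delta> x = 0"
proof -
  interpret C: comm_ring_hom complexify by (rule comm_ring_hom_complexify)
  interpret s: comm_ring_hom "\<lambda>f. eval_char f \<sigma>" by (rule comm_ring_hom_eval_char[OF \<sigma>])
  have aug: "augmentation (Rep_aug y) = 0" for y :: "'a aug"
    using Rep_aug[of y] by (simp add: augmentation_ideal_def)
  show ?thesis using assms(3)
  proof induction
    case (base x)
    then consider (1) p q y where "x = frag_of (p + q, y) - frag_of (p, y) - frag_of (q, y)"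
      | (2) p y y' where "x = frag_of (p, aug_add y y') - frag_of (p, y) - frag_of (p, y')"
      | (3) p r y where "x = frag_of (p * group_ring_proj r, y) - frag_of (p, aug_lmult r y)"
      unfolding tensor_gens_def by blast
    then show ?case
    proof cases
      case 1
      show ?thesis
        unfolding 1 tensor_functional_def
        by (simp add: pm_eval_of_int_diff pm_eval_of_int_frag_of pm_eval_of_int_add C.hom_add s.hom_add algebra_simps)
    next
      case 2
      show ?thesis
        unfolding 2 tensor_functional_def
        by (simp add: pm_eval_of_int_diff pm_eval_of_int_frag_of aug_add.rep_eq pm_eval_of_int_add algebra_simps)
    next
      case 3
      show ?thesis
        unfolding 3 tensor_functional_def
        by (simp add: pm_eval_of_int_diff pm_eval_of_int_frag_of aug_lmult.rep_eq C.hom_mult s.hom_mult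
            eval_group_ring_proj[OF \<sigma>] pm_eval_crossed_hom_mult[OF \<delta>] aug)
    qed
  qed (simp_all add: tensor_functional_def pm_eval_of_int_add pm_eval_of_int_uminus pm_eval_def[of _ _ 0])
qed

lemma tensor_functional_scale:
  assumes "\<sigma> \<in> characters"
  shows "tensor_functional \<sigma> \<delta> (tensor_free_scale r x) = eval_char (complexify r) \<sigma> * tensor_functional \<sigma> \<delta> x"
proof -
  interpret C: comm_ring_hom complexify by (rule comm_ring_hom_complexify)
  interpret s: comm_ring_hom "\<lambda>f. eval_char f \<sigma>" by (rule comm_ring_hom_eval_char[OF assms])
  show ?thesis
  proof (induction x rule: frag_induction[of _ UNIV, OF subset_UNIV])
    case (2 x)
    obtain p y where "x = (p, y)" by force
    then show ?case
      unfolding tensor_functional_def tensor_free_scale_def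
      by (simp add: pm_eval_of_int_frag_of C.hom_mult s.hom_mult)
  next
    case (3 a b)
    then show ?case
      unfolding tensor_functional_def tensor_free_scale_def
      by (simp add: frag_extend_diff pm_eval_of_int_diff right_diff_distrib)
  qed (simp add: tensor_functional_def tensor_free_scale_def pm_eval_def)
qed

text \<open>The \<open>\<Lambda>\<close>-linear map \<open>A\<^sub>G \<rightarrow> \<complex>\<^sub>\<sigma>\<close>, \<open>p \<otimes> (g - 1) \<mapsto> \<sigma>(p) \<delta>(g)\<close>, of a crossed homomorphism.\<close>
definition alexander_functional ::
    "('g::group_add abf \<Rightarrow> complex) \<Rightarrow> ('g \<Rightarrow> complex) \<Rightarrow> 'g alexander_module \<Rightarrow> complex" where
  "alexander_functional \<sigma> \<delta> a = tensor_functional \<sigma> \<delta> (rep_alexander_module a)"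

lemma alexander_functional_abs:
  assumes "\<sigma> \<in> characters" "crossed_hom (\<sigma> \<circ> abf_proj) \<delta>"
  shows "alexander_functional \<sigma> \<delta> (abs_alexander_module x) = tensor_functional \<sigma> \<delta> x"
proof -
  have "rep_alexander_module (abs_alexander_module x) - x \<in> group_span tensor_gens"
    using Quotient3_rep_abs[OF Quotient3_alexander_module, of x] by (simp add: group_span.zero)
  from tensor_functional_span[OF assms this] show ?thesis
    by (simp add: alexander_functional_def tensor_functional_def pm_eval_of_int_diff)
qed

lemma alexander_functional_add:
  assumes "\<sigma> \<in> characters" "crossed_hom (\<sigma> \<circ> abf_proj) \<delta>"
  shows "alexander_functional \<sigma> \<delta> (a + b) = alexander_functional \<sigma> \<delta> a + alexander_functional \<sigma> \<delta> b"
proof -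
  obtain x where x: "a = abs_alexander_module x"
    using alexander_module.abs_induct[of "\<lambda>a. \<exists>x. a = abs_alexander_module x" a] by blast
  obtain y where y: "b = abs_alexander_module y"
    using alexander_module.abs_induct[of "\<lambda>a. \<exists>x. a = abs_alexander_module x" b] by blast
  show ?thesis
    unfolding x y plus_alexander_module.abs_eq alexander_functional_abs[OF assms]
    by (simp add: tensor_functional_def pm_eval_of_int_add)
qed

lemma alexander_functional_scale:
  assumes "\<sigma> \<in> characters" "crossed_hom (\<sigma> \<circ> abf_proj) \<delta>"
  shows "alexander_functional \<sigma> \<delta> (alexander_scale r a) =
    eval_char (complexify r) \<sigma> * alexander_functional \<sigma> \<delta> a"
proof -
  obtain x where x: "a = abs_alexander_module x"
    using alexander_module.abs_induct[of "\<lambda>a. \<exists>x. a = abs_alexander_module x" a] by blast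
  show ?thesis
    unfolding x alexander_scale.abs_eq alexander_functional_abs[OF assms]
    by (rule tensor_functional_scale[OF assms(1)])
qed

lemma alexander_functional_sum:
  assumes "\<sigma> \<in> characters" "crossed_hom (\<sigma> \<circ> abf_proj) \<delta>"
  shows "alexander_functional \<sigma> \<delta> (\<Sum>i\<in>I. alexander_scale (c i) (a i)) =
    (\<Sum>i\<in>I. eval_char (complexify (c i)) \<sigma> * alexander_functional \<sigma> \<delta> (a i))"
proof (induction I rule: infinite_finite_induct)
  case empty
  have "alexander_functional \<sigma> \<delta> 0 = 0" using alexander_functional_add[OF assms, of 0 0] by simp
  then show ?case by simp
next
  case (infinite I)
  have "alexander_functional \<sigma> \<delta> 0 = 0" using alexander_functional_add[OF assms, of 0 0] by simp
  then show ?case using infinite by simp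
qed (simp add: alexander_functional_add[OF assms] alexander_functional_scale[OF assms])

lemma crossed_hom_zero: "crossed_hom \<rho> \<delta> \<Longrightarrow> \<rho> \<in> characters \<Longrightarrow> \<delta> 0 = 0"
proof -
  assume "crossed_hom \<rho> \<delta>" "\<rho> \<in> characters"
  then have "\<delta> (0 + 0) = \<delta> 0 + \<rho> 0 * \<delta> 0" "\<rho> 0 \<noteq> 0"
    unfolding crossed_hom_def characters_def by blast+
  then show "\<delta> 0 = 0" by simp
qed

text \<open>The element is \<open>1 \<otimes> (g - 1)\<close>, the unit being
  \<open>frag_of 0\<close> in additive notation. It is the same for all \<open>\<delta>\<close>, so
  a crossed homomorphism whose functional is zero is itself zero.\<close>

lemma alexander_functional_generator:
  assumes "\<sigma> \<in> characters" "crossed_hom (\<sigma> \<circ> abf_proj) \<delta>"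
  shows "\<exists>a. \<forall>\<delta>. crossed_hom (\<sigma> \<circ> abf_proj) \<delta> \<longrightarrow> alexander_functional \<sigma> \<delta> a = \<delta> g"
proof (intro exI allI impI)
  fix \<delta> assume \<delta>: "crossed_hom (\<sigma> \<circ> abf_proj) \<delta>"
  let ?y = "frag_of g - frag_of 0 :: 'a \<Rightarrow>\<^sub>0 int"
  have "?y \<in> augmentation_ideal"
    by (simp only: augmentation_ideal_def mem_Collect_eq augmentation_diff augmentation_frag_of diff_self)
  then have "Rep_aug (Abs_aug ?y) = ?y" by (rule Abs_aug_inverse)
  moreover have "eval_char (complexify (frag_of 0)) \<sigma> = 1"
    by (simp add: complexify_single eval_char_eq_pm_eval pm_eval_single characters_zero[OF assms(1)] del: single_one)
  ultimately show "alexander_functional \<sigma> \<delta> (abs_alexander_module (frag_of (frag_of 0, Abs_aug ?y))) = \<delta> g"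
    unfolding alexander_functional_abs[OF assms(1) \<delta>] tensor_functional_def pm_eval_of_int_frag_of
    using crossed_hom_zero[OF \<delta> character_abf_proj[OF assms(1)]]
    by (simp only: prod.case pm_eval_of_int_diff pm_eval_of_int_frag_of) simp
qed

lemma crossed_hom_combination:
  assumes "\<And>i. i \<in> I \<Longrightarrow> crossed_hom \<rho> (\<delta> i)"
  shows "crossed_hom \<rho> (\<lambda>g. \<Sum>i\<in>I. c i * \<delta> i g)"
  using assms unfolding crossed_hom_def
  by (simp add: sum_distrib_left sum.distrib[symmetric] algebra_simps)

lemma alexander_functional_combination:
  "alexander_functional \<sigma> (\<lambda>g. \<Sum>i\<in>I. c i * \<delta> i g) a = (\<Sum>i\<in>I. c i * alexander_functional \<sigma> (\<delta> i) a)"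
proof -
  have *: "pm_eval of_int (\<lambda>g. \<Sum>i\<in>I. c i * F i g) y = (\<Sum>i\<in>I. c i * pm_eval of_int (F i) y)"
    for F :: "'b \<Rightarrow> 'c \<Rightarrow> complex" and y
    unfolding pm_eval_def sum_distrib_left by (subst sum.swap) (simp add: mult_ac)
  have "(\<lambda>(p, y). eval_char (complexify p) \<sigma> * pm_eval of_int (\<lambda>g. \<Sum>i\<in>I. c i * \<delta> i g) (Rep_aug y)) =
    (\<lambda>x. \<Sum>i\<in>I. c i * (case x of (p, y) \<Rightarrow> eval_char (complexify p) \<sigma> * pm_eval of_int (\<delta> i) (Rep_aug y)))"
    by (auto simp: fun_eq_iff * sum_distrib_left mult_ac)
  then show ?thesis
    unfolding alexander_functional_def tensor_functional_def by (simp add: *)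
qed

text \<open>The crossed homomorphisms, read off on the generators \<open>a j\<close> of the
  presentation, are the kernel vectors for the minors. The map \<open>h\<close> stands for any
  restriction to a line through \<open>\<sigma>\<close>; only its constant term enters.\<close>

theorem fps_X_power_twisted_b1_dvd:
  fixes M :: "('g::group_add abf \<Rightarrow>\<^sub>0 int) Matrix.mat"
  assumes \<sigma>: "\<sigma> \<in> characters" "\<sigma> \<noteq> (\<lambda>_. 1)"
    and M: "presentation_matrix alexander_scale M"
    and h: "comm_ring_hom h" "\<And>x. fps_nth (h x) 0 = eval_char (complexify x) \<sigma>"
    and x: "x \<in> alexander_ideal_of M"
  shows "fps_X ^ twisted_b1 (\<sigma> \<circ> abf_proj) dvd h x"
proof -
  define \<rho> where "\<rho> = \<sigma> \<circ> (abf_proj :: 'g \<Rightarrow> _)"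
  define m where "m = dim_col M"
  have \<rho>: "\<rho> \<in> characters" unfolding \<rho>_def by (rule character_abf_proj[OF \<sigma>(1)])
  obtain u where "\<sigma> u \<noteq> 1" using \<sigma>(2) by blast
  then obtain g0 where g0: "\<rho> g0 \<noteq> 1" using abf_proj_surj[of u] by (auto simp: \<rho>_def)
  obtain S where S: "basis_modulo cscale {c. bar_d1 \<rho> c = 0} (range (bar_d2 \<rho>)) S" "twisted_b1 \<rho> = card S"
    using twisted_b1_basis[OF \<rho>] by blast
  show ?thesis
  proof (cases "finite S")
    \<comment> \<open>An infinite set has cardinality 0, which makes the claimed divisibility
      trivial.\<close>
    case False
    then show ?thesis using S(2) by (simp add: \<rho>_def)
  next
    case True
    define b where "b = card S"
    obtain \<delta> where \<delta>: "\<And>i. i < Suc b \<Longrightarrow> crossed_hom \<rho> (\<delta> i)"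
      and indep: "\<And>c i. \<forall>g. (\<Sum>i<Suc b. c i * \<delta> i g) = 0 \<Longrightarrow> i < Suc b \<Longrightarrow> c i = 0"
      using crossed_homs_independent[OF \<rho> g0 S(1) True b_def[symmetric]] by blast
    obtain a where a: "(\<lambda>c. \<Sum>i<m. alexander_scale (vec_index c i) (a i)) ` carrier_vec m = UNIV"
      and ker: "{c \<in> carrier_vec m. (\<Sum>i<m. alexander_scale (vec_index c i) (a i)) = 0} =
        (\<lambda>d. transpose_mat M *\<^sub>v d) ` carrier_vec (dim_row M)"
      using M unfolding presentation_matrix_def Let_def m_def by blast
    define v where "v i j = alexander_functional \<sigma> (\<delta> i) (a j)" for i j
    have "fps_X ^ b dvd h x"
    proof (rule fps_X_power_dvd_ideal[OF h(1) _ _ x])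
      fix r i assume r: "r < dim_row M" and i: "i < Suc b"
      \<comment> \<open>Each row is the image of a unit vector under the transposed matrix, hence a
        relation between the generators.\<close>
      have "Matrix.row M r = transpose_mat M *\<^sub>v unit_vec (dim_row M) r"
        using r by (intro eq_vecI) (auto simp: scalar_prod_right_unit)
      then have "Matrix.row M r \<in> (\<lambda>d. transpose_mat M *\<^sub>v d) ` carrier_vec (dim_row M)" by simp
      then have "(\<Sum>j<m. alexander_scale (M $$ (r, j)) (a j)) = 0"
        unfolding ker[symmetric] using r by (simp add: m_def)
      then have "alexander_functional \<sigma> (\<delta> i) (\<Sum>j<m. alexander_scale (M $$ (r, j)) (a j)) =
          alexander_functional \<sigma> (\<delta> i) (\<Sum>j\<in>{}. alexander_scale (M $$ (r, j)) (a j))" by simp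
      then show "(\<Sum>j<dim_col M. fps_nth (h (M $$ (r, j))) 0 * v i j) = 0"
        unfolding alexander_functional_sum[OF \<sigma>(1) \<delta>[OF i, unfolded \<rho>_def]]
        by (simp add: h(2) v_def m_def)
    next
      fix c i assume c: "\<forall>j<dim_col M. (\<Sum>i<Suc b. c i * v i j) = 0" and i: "i < Suc b"
      \<comment> \<open>A linear relation between the value vectors gives a crossed homomorphism
        whose functional kills all generators, hence the whole module. So
        \<open>\<epsilon> = 0\<close>, and independence of the \<open>\<delta> i\<close>
        applies.\<close>
      define \<epsilon> where "\<epsilon> g = (\<Sum>i<Suc b. c i * \<delta> i g)" for g
      have \<epsilon>: "crossed_hom (\<sigma> \<circ> abf_proj) \<epsilon>"
        unfolding \<epsilon>_def using \<delta> unfolding \<rho>_def by (intro crossed_hom_combination) simp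
      have zero: "alexander_functional \<sigma> \<epsilon> (a j) = 0" if "j < m" for j
        using c that unfolding \<epsilon>_def alexander_functional_combination v_def m_def by blast
      have "alexander_functional \<sigma> \<epsilon> y = 0" for y
      proof -
        obtain d where "y = (\<Sum>i<m. alexander_scale (vec_index d i) (a i))" using a by blast
        then show ?thesis by (simp add: alexander_functional_sum[OF \<sigma>(1) \<epsilon>] zero)
      qed
      then have "\<epsilon> g = 0" for g
        using alexander_functional_generator[OF \<sigma>(1) \<epsilon>, of g] \<epsilon> by metis
      then show "c i = 0" using indep i unfolding \<epsilon>_def by blast
    qed
    then show ?thesis using S(2) by (simp add: b_def \<rho>_def)
  qed
qed

text \<open>The additive group of complex numbers is abelian and torsion-free, so commutators and
  elements of finite order modulo commutators go to 0.\<close>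

lemma additive_vanishes_on_kernel:
  fixes \<delta> :: "'g::group_add \<Rightarrow> complex"
  assumes add: "\<And>g h. \<delta> (g + h) = \<delta> g + \<delta> h" and "abf_proj x = 0"
  shows "\<delta> x = 0"
proof -
  have zero: "\<delta> 0 = 0" using add[of 0 0] by simp
  have uminus: "\<delta> (- g) = - \<delta> g" for g
    using add[of g "- g"] zero by (simp add: eq_neg_iff_add_eq_0 add.commute)
  have diff: "\<delta> (g - h) = \<delta> g - \<delta> h" for g h
    using add[of g "- h"] uminus by simp
  have comm: "\<delta> y = 0" if "y \<in> commutator_subgroup" for y
    using that unfolding commutator_subgroup_def
    by induction (auto simp: zero add uminus diff)
  have "is_torsion (abs_ab x - 0)"
    using assms(2) unfolding abf_proj_def zero_mod_torsion_def
    by (simp add: mod_torsion.abs_eq_iff)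
  then obtain k :: nat where k: "k > 0" "(\<Sum>i<k. abs_ab x) = 0"
    unfolding is_torsion_def by auto
  have "\<exists>y. (\<Sum>i<l. abs_ab x) = abs_ab y \<and> \<delta> y = of_nat l * \<delta> x" for l :: nat
  proof (induction l)
    case 0
    show ?case by (intro exI[of _ 0]) (simp add: zero_ab_def zero)
  next
    case (Suc l)
    then obtain y where "(\<Sum>i<l. abs_ab x) = abs_ab y" "\<delta> y = of_nat l * \<delta> x" by blast
    then show ?case
      by (intro exI[of _ "x + y"]) (simp add: plus_ab.abs_eq add algebra_simps)
  qed
  then obtain y where y: "abs_ab y = 0" "\<delta> y = of_nat k * \<delta> x" using k(2) by metis
  have "y \<in> commutator_subgroup" using y(1) by (simp add: zero_ab_def ab.abs_eq_iff)
  then show ?thesis using comm y(2) k(1) by simp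
qed

text \<open>At the trivial character crossed homomorphisms are additive maps. They factor through
  the free quotient, which is infinite cyclic here, so all are multiples of one map, whereas two
  independent classes would yield two independent functionals.\<close>

lemma twisted_b1_trivial_le_1:
  fixes \<phi> :: "'g::group_add abf \<Rightarrow> nat \<Rightarrow> int"
  assumes "lattice_coordinates \<phi> 1 e"
  shows "twisted_b1 (\<lambda>_ :: 'g. 1) \<le> 1"
proof (rule ccontr)
  interpret lattice_coordinates \<phi> 1 e by fact
  let ?\<rho> = "\<lambda>_ :: 'g. 1 :: complex"
  assume "\<not> twisted_b1 ?\<rho> \<le> 1"
  moreover have "?\<rho> \<in> characters" by (simp add: characters_def)
  ultimately obtain S where S: "basis_modulo cscale {c. bar_d1 ?\<rho> c = 0} (range (bar_d2 ?\<rho>)) S" "card S > 1"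
    using twisted_b1_basis[of ?\<rho>] by auto
  then have "finite S" by (metis card.infinite not_less_zero)
  then obtain s1 s2 where s: "s1 \<in> S" "s2 \<in> S" "s1 \<noteq> s2"
    using S(2) by (metis card_le_Suc0_iff_eq One_nat_def not_le)
  define s' where "s' i = (if i = 0 then s1 else s2)" for i :: nat
  have B: "cscale.subspace (range (bar_d2 ?\<rho>))" unfolding range_bar_d2 by (rule cscale.subspace_span)
  have "\<exists>F. \<forall>i<2. Vector_Spaces.linear cscale (*) (F i) \<and> (\<forall>x\<in>range (bar_d2 ?\<rho>). F i x = 0) \<and>
    (\<forall>j<2. F i (s' j) = (if i = j then 1 else 0))"
  proof (rule dual_functionals[OF B])
    fix c i assume c: "(\<Sum>i<2. cscale (c i) (s' i)) \<in> range (bar_d2 ?\<rho>)" and i: "i < (2::nat)"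
    define u where "u x = (if x = s1 then c 0 else c 1)" for x
    have "(\<Sum>x\<in>{s1, s2}. cscale (u x) x) = (\<Sum>i<2. cscale (c i) (s' i))"
      using s(3) by (simp add: u_def s'_def numeral_2_eq_2)
    then have "(\<Sum>x\<in>{s1, s2}. cscale (u x) x) \<in> range (bar_d2 ?\<rho>)" using c by simp
    moreover have "finite {s1, s2}" "{s1, s2} \<subseteq> S" using s by auto
    ultimately have "\<forall>x\<in>{s1, s2}. u x = 0" using S(1) unfolding basis_modulo_def by blast
    then show "c i = 0" using s(3) i by (auto simp: u_def numeral_2_eq_2 less_Suc_eq)
  qed
  then obtain F where F: "\<And>i. i < 2 \<Longrightarrow> Vector_Spaces.linear cscale (*) (F i)"
    "\<And>i x. i < 2 \<Longrightarrow> x \<in> range (bar_d2 ?\<rho>) \<Longrightarrow> F i x = 0"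
    "\<And>i j. i < 2 \<Longrightarrow> j < 2 \<Longrightarrow> F i (s' j) = (if i = j then 1 else (0::complex))"
    by blast
  obtain g1 where g1: "abf_proj g1 = e 0" using abf_proj_surj by blast
  have multiple: "\<exists>c. \<forall>x. F i x = c * (\<Sum>g\<in>Poly_Mapping.keys x. Poly_Mapping.lookup x g * of_int (\<phi> (abf_proj g) 0))"
    if i: "i < 2" for i
  proof -
    define \<delta> where "\<delta> g = F i (Poly_Mapping.single g 1)" for g
    have add: "\<delta> (g + h) = \<delta> g + \<delta> h" for g h
      using crossed_hom_functional[OF F(1)[OF i] F(2)[OF i]] unfolding crossed_hom_def \<delta>_def by simp
    have zero: "\<delta> g = 0" if "abf_proj g = 0" for g
      using additive_vanishes_on_kernel[of \<delta>, OF add that] .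
    have proj_uminus: "abf_proj (- g) = - abf_proj g" for g :: 'g
    proof -
      have "abf_proj 0 = (0 :: 'g abf)" using abf_proj_add[of "0::'g" 0] by simp
      then show ?thesis using abf_proj_add[of g "- g"] by (simp add: eq_neg_iff_add_eq_0 add.commute)
    qed
    have uminus: "\<delta> (- g) = - \<delta> g" for g
    proof -
      have "\<delta> 0 = 0" using add[of 0 0] by simp
      then show ?thesis using add[of g "- g"] by (simp add: eq_neg_iff_add_eq_0 add.commute)
    qed
    have "\<forall>g. abf_proj g = u \<longrightarrow> \<delta> g = of_int (\<phi> u 0) * \<delta> g1" for u
    proof (induction u rule: lattice_induct)
      case 1
      show ?case using zero by (simp add: coord_zero)
    next
      case (2 u i)
      show ?case
      proof (intro allI impI)
        fix g :: 'g assume g: "abf_proj g = u + e i"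
        then have "abf_proj (g + - g1) = u"
          using 2(1) by (simp add: abf_proj_add proj_uminus g1 del: add_uminus_conv_diff)
        then have "\<delta> (g + - g1) = of_int (\<phi> u 0) * \<delta> g1" using 2(2) by blast
        then show "\<delta> g = of_int (\<phi> (u + e i) 0) * \<delta> g1"
          using 2(1) unfolding add uminus by (simp add: coord_add coord_basis algebra_simps)
      qed
    next
      case (3 u i)
      show ?case
      proof (intro allI impI)
        fix g :: 'g assume g: "abf_proj g = u - e i"
        then have "abf_proj (g + g1) = u" using 3(1) by (simp add: abf_proj_add g1)
        then have "\<delta> (g + g1) = of_int (\<phi> u 0) * \<delta> g1" using 3(2) by blast
        then show "\<delta> g = of_int (\<phi> (u - e i) 0) * \<delta> g1"
          using 3(1) unfolding add by (simp add: coord_diff coord_basis algebra_simps)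
      qed
    qed
    then have "\<delta> g = of_int (\<phi> (abf_proj g) 0) * \<delta> g1" for g by blast
    then have \<delta>: "\<delta> g = \<delta> g1 * of_int (\<phi> (abf_proj g) 0)" for g by (subst mult.commute)
    have "F i x = \<delta> g1 * (\<Sum>g\<in>Poly_Mapping.keys x. Poly_Mapping.lookup x g * of_int (\<phi> (abf_proj g) 0))" for x
    proof -
      have "F i x = (\<Sum>g\<in>Poly_Mapping.keys x. Poly_Mapping.lookup x g * \<delta> g)"
        unfolding \<delta>_def by (rule functional_expansion[OF F(1)[OF i]])
      also have "\<dots> = (\<Sum>g\<in>Poly_Mapping.keys x. Poly_Mapping.lookup x g * (\<delta> g1 * of_int (\<phi> (abf_proj g) 0)))"
        by (intro sum.cong refl arg_cong2[where f = "(*)"] \<delta>)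
      also have "\<dots> = \<delta> g1 * (\<Sum>g\<in>Poly_Mapping.keys x. Poly_Mapping.lookup x g * of_int (\<phi> (abf_proj g) 0))"
        by (simp add: sum_distrib_left mult.left_commute)
      finally show ?thesis .
    qed
    then show ?thesis by blast
  qed
  define \<Phi> where "\<Phi> x = (\<Sum>g\<in>Poly_Mapping.keys x. Poly_Mapping.lookup x g * complex_of_int (\<phi> (abf_proj g) 0))"
    for x :: "'g \<Rightarrow>\<^sub>0 complex"
  obtain c0 where "\<And>x. F 0 x = c0 * \<Phi> x" using multiple[of 0] unfolding \<Phi>_def by auto
  moreover obtain c1 where "\<And>x. F 1 x = c1 * \<Phi> x" using multiple[of 1] unfolding \<Phi>_def by auto
  \<comment> \<open>From \<open>F 0 s1 = 1\<close> one gets \<open>c0 \<noteq> 0\<close>, then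
    \<open>F 0 s2 = 0\<close> gives \<open>\<Phi> s2 = 0\<close>, against
    \<open>F 1 s2 = 1\<close>.\<close>
  ultimately show False using F(3)[of 0 0] F(3)[of 0 1] F(3)[of 1 1] by (auto simp: s'_def)
qed

section \<open>The bounds\<close>

lemma ideal_power_mem: "a \<in> A \<Longrightarrow> a ^ d \<in> ideal_power A d"
proof (induction d)
  case (Suc d)
  then have "a * a ^ d \<in> ideal_mult A (ideal_power A d)"
    unfolding ideal_mult_def by (intro ideal_gen_base) blast
  then show ?case by (simp add: ideal_power_def)
qed (simp add: ideal_power_def)

lemma lattice_coordinates_abf:
  assumes "abf_coordinates n \<phi>"
  shows "lattice_coordinates (\<lambda>u. vec_index (\<phi> u)) n (\<lambda>i. inv_into UNIV \<phi> (unit_vec n i))"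
proof -
  have bij: "bij_betw \<phi> UNIV (carrier_vec n)" and add: "\<And>x y. \<phi> (x + y) = \<phi> x + \<phi> y"
    using assms by (auto simp: abf_coordinates_def)
  have car: "\<phi> u \<in> carrier_vec n" for u using bij by (auto simp: bij_betw_def)
  show ?thesis
  proof
    show "vec_index (\<phi> (u + v)) i = vec_index (\<phi> u) i + vec_index (\<phi> v) i" if "i < n" for i u v
      using that car[of v] by (simp add: add)
    show "vec_index (\<phi> (inv_into UNIV \<phi> (unit_vec n i))) j = (if i = j then 1 else 0)" if "i < n" "j < n" for i j
    proof -
      have "\<phi> (inv_into UNIV \<phi> (unit_vec n i)) = unit_vec n i"
        using bij by (intro f_inv_into_f) (simp add: bij_betw_def)
      then show ?thesis using that by simp
    qed
    show "u = v" if "\<And>i. i < n \<Longrightarrow> vec_index (\<phi> u) i = vec_index (\<phi> v) i" for u v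
    proof -
      have "\<phi> u = \<phi> v" using that car[of u] car[of v] by (intro eq_vecI) auto
      then show ?thesis using bij by (auto simp: bij_betw_def inj_def)
    qed
  qed
qed

section \<open>Vanishing orders as subdegrees of germs\<close>

lemma (in lattice_coordinates) germ_cong:
  assumes "\<And>i. i < n \<Longrightarrow> z i = z' i" "\<And>i. i < n \<Longrightarrow> w i = w' i"
  shows "germ z w f = germ z' w' f"
  unfolding germ_def germ_char_def pm_eval_def using assms by (intro sum.cong arg_cong2[where f = "(*)"] prod.cong) auto

context
  fixes n :: nat and \<phi> :: "'g::group_add abf \<Rightarrow> int Matrix.vec"
  assumes coords: "abf_coordinates n \<phi>"
begin

interpretation lattice_coordinates "\<lambda>u. vec_index (\<phi> u)" n "\<lambda>i. inv_into UNIV \<phi> (unit_vec n i)"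
  by (rule lattice_coordinates_abf[OF coords])

lemma taylor_term_eq_germ_nth:
  assumes z: "z \<in> carrier_vec n" "\<And>i. i < n \<Longrightarrow> vec_index z i \<noteq> 0" and w: "w \<in> carrier_vec n"
  shows "taylor_term (laurent_eval n \<phi> f) z k w = fps_nth (germ (vec_index z) (vec_index w) f) k"
proof -
  have lin: "(\<lambda>s. vec_index (z + s \<cdot>\<^sub>v w) i) has_fps_expansion linear_germ (vec_index z i) (vec_index w i)"
    if "i < n" for i
  proof -
    have "(\<lambda>s. vec_index z i + vec_index w i * s) has_fps_expansion linear_germ (vec_index z i) (vec_index w i)"
      unfolding linear_germ_def by (intro fps_expansion_intros)
    moreover have "(\<lambda>s. vec_index (z + s \<cdot>\<^sub>v w) i) = (\<lambda>s. vec_index z i + vec_index w i * s)"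
      using that w by (auto simp: fun_eq_iff)
    ultimately show ?thesis by simp
  qed
  have "(\<lambda>s. laurent_eval n \<phi> f (z + s \<cdot>\<^sub>v w)) has_fps_expansion germ (vec_index z) (vec_index w) f"
    unfolding laurent_eval_def germ_def germ_char_def pm_eval_def
    by (intro has_fps_expansion_sum has_fps_expansion_cmult_left has_fps_expansion_prod
        has_fps_expansion_power_int lin) (use z in auto)
  from fps_nth_fps_expansion[OF this] show ?thesis by (simp add: taylor_term_def)
qed

text \<open>The minimum in the definition is attained because \<open>f\<close> has a nonzero germ
  along some line through the point.\<close>

lemma vanishing_order_germ:
  assumes \<sigma>: "\<sigma> \<in> characters" and "f \<noteq> 0"
  shows "\<exists>w. fps_nth (germ (vec_index (torus_point n \<phi> \<sigma>)) w f) (vanishing_order n \<phi> \<sigma> f) \<noteq> 0"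
proof -
  let ?z = "torus_point n \<phi> \<sigma>"
  have z: "?z \<in> carrier_vec n" "\<And>i. i < n \<Longrightarrow> vec_index ?z i \<noteq> 0"
    using characters_nonzero[OF \<sigma>] by (simp_all add: torus_point_def)
  obtain w where "germ (vec_index ?z) w f \<noteq> 0" using germ_nonzero[of "vec_index ?z" f] z(2) \<open>f \<noteq> 0\<close> by blast
  then obtain k where "fps_nth (germ (vec_index ?z) w f) k \<noteq> 0" using fps_nonzero_nth by blast
  moreover have "germ (vec_index ?z) w f = germ (vec_index ?z) (vec_index (Matrix.vec n w)) f"
    by (rule germ_cong) simp_all
  ultimately have "\<exists>w\<in>carrier_vec n. taylor_term (laurent_eval n \<phi> f) ?z k w \<noteq> 0"
    using taylor_term_eq_germ_nth[OF z, of "Matrix.vec n w"] by (intro bexI[of _ "Matrix.vec n w"]) auto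
  then have "\<exists>k. \<exists>w\<in>carrier_vec n. taylor_term (laurent_eval n \<phi> f) ?z k w \<noteq> 0" by blast
  from LeastI_ex[OF this] obtain w where "w \<in> carrier_vec n"
    "taylor_term (laurent_eval n \<phi> f) ?z (vanishing_order n \<phi> \<sigma> f) w \<noteq> 0"
    unfolding vanishing_order_def by blast
  then show ?thesis using taylor_term_eq_germ_nth[OF z] by auto
qed

text \<open>The common core of (i) and (ii), with the line \<open>w\<close> and the multiplier
  \<open>y\<close> left open. Comparing subdegrees, \<open>y\<close> contributes 0 because it does
  not vanish at \<open>\<sigma>\<close>.\<close>

lemma twisted_b1_le_sum_subdegree:
  fixes M :: "('g abf \<Rightarrow>\<^sub>0 int) Matrix.mat" and f :: "nat \<Rightarrow> 'g abf \<Rightarrow>\<^sub>0 complex"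
  assumes \<sigma>: "\<sigma> \<in> characters" "\<sigma> \<noteq> (\<lambda>_. 1)"
    and M: "presentation_matrix alexander_scale M"
    and z: "\<And>i. i < n \<Longrightarrow> z i = \<sigma> (inv_into UNIV \<phi> (unit_vec n i))"
    and \<Delta>: "eq_up_to_unit (complexify \<Delta>) (\<Prod>j\<in>J. f j ^ \<mu> j)"
    and f: "finite J" "\<And>j. j \<in> J \<Longrightarrow> germ z w (f j) \<noteq> 0"
    and y: "y * complexify \<Delta> \<in> complex_extension (alexander_ideal_of M)" "eval_char y \<sigma> \<noteq> 0"
  shows "twisted_b1 (\<sigma> \<circ> abf_proj) \<le> (\<Sum>j\<in>J. \<mu> j * subdegree (germ z w (f j)))"
proof -
  let ?b = "twisted_b1 (\<sigma> \<circ> (abf_proj :: 'g \<Rightarrow> _))"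
  have z0: "z i \<noteq> 0" if "i < n" for i using z[OF that] characters_nonzero[OF \<sigma>(1)] by simp
  interpret g: comm_ring_hom "germ z w" by (rule comm_ring_hom_germ[OF z0])
  interpret C: comm_ring_hom "complexify :: ('g abf \<Rightarrow>\<^sub>0 int) \<Rightarrow> _" by (rule comm_ring_hom_complexify)
  note nth_0 = germ_nth_0[OF \<sigma>(1) z]
  have hom: "comm_ring_hom (\<lambda>x. germ z w (complexify x))"
    by unfold_locales (simp_all add: C.hom_add C.hom_mult g.hom_add g.hom_mult)
  have "fps_X ^ ?b dvd germ z w x" if "x \<in> complex_extension (alexander_ideal_of M)" for x
    using that unfolding complex_extension_def
  proof (induction rule: ideal_gen_induct)
    case (base x)
    then obtain x' where x': "x' \<in> alexander_ideal_of M" "x = complexify x'" by blast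
    have "fps_nth (germ z w (complexify a)) 0 = eval_char (complexify a) \<sigma>" for a by (rule nth_0)
    from fps_X_power_twisted_b1_dvd[OF \<sigma> M hom this x'(1)] show ?case unfolding x'(2) .
  qed (simp_all add: g.hom_add g.hom_mult dvd_add dvd_mult)
  from this[OF y(1)] have dvd: "fps_X ^ ?b dvd germ z w y * germ z w (complexify \<Delta>)"
    unfolding g.hom_mult .
  obtain u v where u: "u * v = 1" "complexify \<Delta> = u * (\<Prod>j\<in>J. f j ^ \<mu> j)"
    using \<Delta> unfolding eq_up_to_unit_def by (metis dvdE)
  \<comment> \<open>A unit goes to an invertible power series, of subdegree 0, so the equality up to
    units does not affect orders.\<close>
  have uv: "germ z w u * germ z w v = 1" using u(1) by (metis g.hom_mult g.hom_one)
  then have u0: "germ z w u \<noteq> 0" "germ z w v \<noteq> 0" by auto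
  have "subdegree (germ z w u) + subdegree (germ z w v) = 0"
    using subdegree_mult[OF u0] uv by simp
  then have su: "subdegree (germ z w u) = 0" by simp
  have y0: "fps_nth (germ z w y) 0 \<noteq> 0" using y(2) nth_0 by simp
  then have sy: "subdegree (germ z w y) = 0" "germ z w y \<noteq> 0" by auto
  have P0: "(\<Prod>j\<in>J. germ z w (f j) ^ \<mu> j) \<noteq> 0" using f by simp
  have "subdegree (\<Prod>j\<in>J. germ z w (f j) ^ \<mu> j) = (\<Sum>j\<in>J. \<mu> j * subdegree (germ z w (f j)))"
    using f by (subst subdegree_prod) auto
  moreover have germ_\<Delta>: "germ z w (complexify \<Delta>) = germ z w u * (\<Prod>j\<in>J. germ z w (f j) ^ \<mu> j)"
    unfolding u(2) by (simp add: g.hom_mult g.hom_prod g.hom_power)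
  ultimately have "subdegree (germ z w y * germ z w (complexify \<Delta>)) = (\<Sum>j\<in>J. \<mu> j * subdegree (germ z w (f j)))"
    using sy su u0 P0 by simp
  moreover have "germ z w y * germ z w (complexify \<Delta>) \<noteq> 0" using germ_\<Delta> sy u0 P0 by simp
  then have "subdegree (fps_X ^ ?b :: complex fps) \<le> subdegree (germ z w y * germ z w (complexify \<Delta>))"
    using dvd by (subst (asm) fps_dvd_iff) auto
  ultimately show ?thesis by simp
qed

end

theorem theorem3:
  fixes n s :: nat
    and \<phi> :: "'g::group_add abf \<Rightarrow> int Matrix.vec"
    and M :: "('g abf \<Rightarrow>\<^sub>0 int) Matrix.mat"
    and \<Delta> :: "'g abf \<Rightarrow>\<^sub>0 int"
    and f :: "nat \<Rightarrow> 'g abf \<Rightarrow>\<^sub>0 complex"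
    and \<mu> :: "nat \<Rightarrow> nat"
  assumes "finitely_generated TYPE('g)"
    and "abf_coordinates n \<phi>"
    and "presentation_matrix alexander_scale M"
    and "is_gcd_of \<Delta> (alexander_ideal_of M)"
    and "\<And>j. j \<in> {1..s} \<Longrightarrow> Factorial_Ring.irreducible (f j)"
    and "\<And>j. j \<in> {1..s} \<Longrightarrow> \<mu> j \<ge> 1"
    and "\<And>i j. i \<in> {1..s} \<Longrightarrow> j \<in> {1..s} \<Longrightarrow> i \<noteq> j \<Longrightarrow> \<not> eq_up_to_unit (f i) (f j)"
    and "eq_up_to_unit (complexify \<Delta>) (\<Prod>j=1..s. f j ^ \<mu> j)"
  shows "(\<forall>j\<in>{1..s}. generic_b1 (f j) \<le> \<mu> j) \<and>
    (almost_principal (alexander_ideal_of M) \<Delta> \<longrightarrow>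
      (\<forall>\<sigma>\<in>characters - {\<lambda>_. 1}.
         twisted_b1 (\<sigma> \<circ> (abf_proj :: 'g \<Rightarrow> 'g abf))
           \<le> (\<Sum>j=1..s. \<mu> j * vanishing_order n \<phi> \<sigma> (f j))))"
proof (intro conjI impI ballI)
  note irr = assms(5) and nonassoc = assms(7)
  define e where "e i = inv_into UNIV \<phi> (unit_vec n i)" for i
  interpret lattice_coordinates "\<lambda>u. vec_index (\<phi> u)" n e
    unfolding e_def by (rule lattice_coordinates_abf[OF assms(2)])
  interpret C: comm_ring_hom "complexify :: ('g abf \<Rightarrow>\<^sub>0 int) \<Rightarrow> _" by (rule comm_ring_hom_complexify)
  have f0: "f j \<noteq> 0" if "j \<in> {1..s}" for j using irr[OF that] by (simp add: Factorial_Ring.irreducible_def)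
  note bound = twisted_b1_le_sum_subdegree[OF assms(2) _ _ assms(3) _ assms(8), folded e_def]
  {
    fix j assume j: "j \<in> {1..s}"
    let ?K = "{k. (\<lambda>\<sigma>. \<sigma> \<circ> (abf_proj :: 'g \<Rightarrow> _)) ` zero_locus (f j) \<subseteq> char_variety k}"
    interpret UC: factorial_subdomain "UNIV :: ('g abf \<Rightarrow>\<^sub>0 complex) set"
      using factorial_complex_subring[of "{..<n}"] by (simp add: subring_full)
    have prime: "prime_in UNIV (f j)"
      by (rule irreducible_imp_prime_in_UNIV[OF UC.factorial_subdomain_axioms irr[OF j]])
    have ndvd: "\<not> f j dvd f l" if l: "l \<in> {1..s} - {j}" for l
    proof
      assume "f j dvd f l"
      then obtain c where c: "f l = f j * c" by (metis dvdE)
      have "f j dvd 1 \<or> c dvd 1" using irr[of l] l c by (auto simp: Factorial_Ring.irreducible_def)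
      moreover have "\<not> f j dvd 1" using irr[OF j] by (simp add: Factorial_Ring.irreducible_def)
      ultimately have "eq_up_to_unit (f l) (f j)"
        unfolding eq_up_to_unit_def using c by (metis mult.commute)
      then show False using nonassoc[of l j] l j by blast
    qed
    have prod0: "(\<Prod>l=1..s. f l ^ \<mu> l) \<noteq> 0"
    proof -
      have pow: "a ^ k \<noteq> 0" if "a \<noteq> 0" for a :: "'g abf \<Rightarrow>\<^sub>0 complex" and k
        using that UC.no_zero_div UC.factorial by (induction k) auto
      have "(\<Prod>l\<in>K. f l ^ \<mu> l) \<noteq> 0" if "finite K" "K \<subseteq> {1..s}" for K
        using that
      proof (induction K)
        case (insert l K)
        then show ?case using UC.no_zero_div[of "f l ^ \<mu> l"] pow[OF f0[of l]] by auto
      qed simp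
      then show ?thesis by simp
    qed
    have "\<Delta> \<noteq> 0"
    proof
      assume "\<Delta> = 0"
      then obtain u where u: "u dvd 1" "0 = u * (\<Prod>l=1..s. f l ^ \<mu> l)"
        using assms(8) by (auto simp: eq_up_to_unit_def C.hom_zero)
      then show False using UC.no_zero_div[of u "\<Prod>l=1..s. f l ^ \<mu> l"] prod0 by auto
    qed
    obtain a where a: "\<Delta> * a \<in> alexander_ideal_of M" "\<not> f j dvd complexify a"
      using gcd_complexify[OF assms(4) \<open>\<Delta> \<noteq> 0\<close> irr[OF j]] by blast
    have ndvd_mult: "\<not> f j dvd x * y" if "\<not> f j dvd x" "\<not> f j dvd y" for x y
      using prime that unfolding prime_in_def dvd_in_UNIV by blast
    have ndvd_prod: "\<not> f j dvd (\<Prod>l\<in>K. f l)" if "finite K" "K \<subseteq> {1..s} - {j}" for K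
      using that
    proof (induction K)
      case empty
      then show ?case using irr[OF j] by (simp add: Factorial_Ring.irreducible_def)
    next
      case (insert l K)
      then show ?case using ndvd_mult ndvd[of l] by simp
    qed
    have "\<not> f j dvd complexify a * (\<Prod>l\<in>{1..s} - {j}. f l)"
      by (rule ndvd_mult[OF a(2) ndvd_prod]) simp_all
    then obtain i \<sigma> where i: "i < n" and \<sigma>: "\<sigma> \<in> characters" "eval_char (f j) \<sigma> = 0"
      "eval_char (complexify a * (\<Prod>l\<in>{1..s} - {j}. f l)) \<sigma> \<noteq> 0"
      "eval_char (partial i (f j)) \<sigma> \<noteq> 0" "n \<ge> 2 \<Longrightarrow> \<sigma> \<noteq> (\<lambda>_. 1)"
      using generic_zero[OF irr[OF j]] by metis
    interpret s: comm_ring_hom "\<lambda>f. eval_char f \<sigma>" by (rule comm_ring_hom_eval_char[OF \<sigma>(1)])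
    have b: "twisted_b1 (\<sigma> \<circ> (abf_proj :: 'g \<Rightarrow> _)) \<le> \<mu> j"
    proof (cases "\<sigma> = (\<lambda>_. 1)")
      case True
      \<comment> \<open>The zero can be the trivial character only for \<open>n < 2\<close>, and
        \<open>i < n\<close> excludes \<open>n = 0\<close>. The bound 1 on the Betti number is then
        at most \<open>\<mu> j\<close>.\<close>
      then have "n = 1" using \<sigma>(5) i by linarith
      have "lattice_coordinates (\<lambda>u. vec_index (\<phi> u)) 1 e"
        using lattice_coordinates_axioms by (simp add: \<open>n = 1\<close>)
      from twisted_b1_trivial_le_1[OF this] show ?thesis
        using assms(6)[OF j] True by (simp add: comp_def)
    next
      case False
      define z where "z i = \<sigma> (e i)" for i
      \<comment> \<open>The direction of the \<open>i\<close>-th coordinate, in which the first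
        Taylor coefficient of \<open>f j\<close> is a nonzero multiple of its nonvanishing
        derivative.\<close>
      define w where "w l = (if l = i then 1 else 0 :: complex)" for l
      note nth_0 = germ_nth_0[of \<sigma> z, OF \<sigma>(1) z_def]
      have "z i * fps_nth (germ z w (f j)) 1 = eval_char (partial i (f j)) \<sigma>"
        by (rule germ_nth_1[OF \<sigma>(1) z_def i]) (simp add: w_def fun_eq_iff)
      then have "fps_nth (germ z w (f j)) 1 \<noteq> 0" using \<sigma>(4) by auto
      then have sj: "germ z w (f j) \<noteq> 0" "subdegree (germ z w (f j)) \<le> 1"
        by (auto intro: subdegree_leI)
      have l0: "fps_nth (germ z w (f l)) 0 \<noteq> 0" if "l \<in> {1..s} - {j}" for l
        using \<sigma>(3) that by (simp add: nth_0 s.hom_mult s.hom_prod)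
      have ya: "complexify a * complexify \<Delta> \<in> complex_extension (alexander_ideal_of M)"
        unfolding complex_extension_def using a(1)
        by (intro ideal_gen_base) (metis C.hom_mult imageI mult.commute)
      have "twisted_b1 (\<sigma> \<circ> (abf_proj :: 'g \<Rightarrow> _)) \<le> (\<Sum>l=1..s. \<mu> l * subdegree (germ z w (f l)))"
      proof (rule bound[OF \<sigma>(1) False])
        show "z i = \<sigma> (e i)" for i by (rule z_def)
        show "germ z w (f l) \<noteq> 0" if "l \<in> {1..s}" for l using that sj l0[of l] by (cases "l = j") auto
        show "eval_char (complexify a) \<sigma> \<noteq> 0" using \<sigma>(3) by (auto simp: s.hom_mult)
      qed (use ya in auto)
      also have "\<dots> = \<mu> j * subdegree (germ z w (f j)) + (\<Sum>l\<in>{1..s}-{j}. \<mu> l * subdegree (germ z w (f l)))"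
        using j by (subst sum.remove[of _ j]) auto
      also have "(\<Sum>l\<in>{1..s}-{j}. \<mu> l * subdegree (germ z w (f l))) = 0"
        using l0 by (intro sum.neutral) auto
      also have "\<mu> j * subdegree (germ z w (f j)) + 0 \<le> \<mu> j" using sj by simp
      finally show ?thesis .
    qed
    have "k \<le> \<mu> j" if "k \<in> ?K" for k
    proof -
      have "\<sigma> \<in> zero_locus (f j)" using \<sigma> by (simp add: zero_locus_def)
      then have "\<sigma> \<circ> abf_proj \<in> char_variety k" using that by blast
      then show ?thesis using b by (simp add: char_variety_def)
    qed
    \<comment> \<open>Together with the bound just shown, this makes the maximum in
      \<open>generic_b1\<close> one over a finite nonempty set.\<close>
    moreover have "0 \<in> ?K"
      by (auto simp: char_variety_def zero_locus_def intro: character_abf_proj)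
    moreover have "finite ?K" using calculation(1) by (intro finite_subset[of ?K "{..\<mu> j}"]) auto
    ultimately show "generic_b1 (f j) \<le> \<mu> j"
      unfolding generic_b1_def by (subst Max_le_iff) auto
  next
    fix \<sigma> :: "'g abf \<Rightarrow> complex" assume "almost_principal (alexander_ideal_of M) \<Delta>"
      and "\<sigma> \<in> characters - {\<lambda>_. 1 :: complex}"
    then have \<sigma>: "\<sigma> \<in> characters" "\<sigma> \<noteq> (\<lambda>_. 1)" by auto
    obtain d where d: "complex_extension (ideal_mult (ideal_power augmentation_ideal d) (ideal_gen {\<Delta>}))
       \<subseteq> complex_extension (alexander_ideal_of M)"
      using \<open>almost_principal _ _\<close> unfolding almost_principal_def by blast
    interpret s: comm_ring_hom "\<lambda>f. eval_char f \<sigma>" by (rule comm_ring_hom_eval_char[OF \<sigma>(1)])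
    obtain u where u: "\<sigma> u \<noteq> 1" using \<sigma>(2) by blast
    define x :: "'g abf \<Rightarrow>\<^sub>0 int" where "x = frag_of u - frag_of 0"
    have "x \<in> augmentation_ideal"
      by (simp only: x_def augmentation_ideal_def mem_Collect_eq augmentation_diff augmentation_frag_of diff_self)
    then have "x ^ d \<in> ideal_power augmentation_ideal d" by (rule ideal_power_mem)
    moreover have "\<Delta> \<in> ideal_gen {\<Delta>}" by (rule ideal_gen_base) simp
    ultimately have "x ^ d * \<Delta> \<in> ideal_mult (ideal_power augmentation_ideal d) (ideal_gen {\<Delta>})"
      unfolding ideal_mult_def by (intro ideal_gen_base) blast
    then have "complexify (x ^ d * \<Delta>) \<in> complex_extension (alexander_ideal_of M)"
      using d ideal_gen_base unfolding complex_extension_def by blast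
    then have xd: "complexify x ^ d * complexify \<Delta> \<in> complex_extension (alexander_ideal_of M)"
      by (simp add: C.hom_mult C.hom_power)
    have "eval_char (complexify x) \<sigma> = \<sigma> u - 1"
      unfolding x_def C.hom_minus s.hom_minus complexify_single
      by (simp add: eval_char_eq_pm_eval pm_eval_single characters_zero[OF \<sigma>(1)] del: single_one)
    then have nz: "eval_char (complexify x ^ d) \<sigma> \<noteq> 0" using u by (simp add: s.hom_power)
    define z where "z = vec_index (torus_point n \<phi> \<sigma>)"
    have z: "z i = \<sigma> (e i)" if "i < n" for i using that by (simp add: z_def torus_point_def e_def)
    have z0: "z i \<noteq> 0" if "i < n" for i using z[OF that] characters_nonzero[OF \<sigma>(1)] by simp
    have "\<exists>w. \<forall>j\<in>{1..s}. fps_nth (germ z w (f j)) (vanishing_order n \<phi> \<sigma> (f j)) \<noteq> 0"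
      by (rule common_direction[OF z0])
         (use vanishing_order_germ[OF assms(2) \<sigma>(1) f0, folded e_def z_def] in auto)
    then obtain w where w: "\<And>j. j \<in> {1..s} \<Longrightarrow> fps_nth (germ z w (f j)) (vanishing_order n \<phi> \<sigma> (f j)) \<noteq> 0"
      by blast
    have "twisted_b1 (\<sigma> \<circ> (abf_proj :: 'g \<Rightarrow> _)) \<le> (\<Sum>j=1..s. \<mu> j * subdegree (germ z w (f j)))"
    proof (rule bound[OF \<sigma> z _ _ xd nz])
      show "germ z w (f j) \<noteq> 0" if "j \<in> {1..s}" for j using w[OF that] by auto
    qed simp_all
    \<comment> \<open>A nonzero coefficient at the index of the vanishing order bounds the subdegree
      from above, and this for all factors along the same line.\<close>
    also have "\<dots> \<le> (\<Sum>j=1..s. \<mu> j * vanishing_order n \<phi> \<sigma> (f j))"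
      using w by (intro sum_mono mult_left_mono subdegree_leI) auto
    finally show "twisted_b1 (\<sigma> \<circ> (abf_proj :: 'g \<Rightarrow> _)) \<le> (\<Sum>j=1..s. \<mu> j * vanishing_order n \<phi> \<sigma> (f j))" .
  }
qed

end
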